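(* Let $\{T_t\}_{t\in\mathbb{R}}$ be a measure preserving flow on a Lebesgue space $(X,\mathcal{X},\mu)$, let $d,k\in\mathbb{N}$, and let $p_1,\ldots,p_k\colon \mathbb{R}^d\to\mathbb{R}$ be any collection of polynomials. Then for all $f_1,\ldots,f_k\in L^\infty(\mu)$, the averages $$\frac{1}{R_1}\int_0^{R_1}\cdots\frac{1}{R_d}\int_0^{R_d} (f_1\circ T_{p_1(\mathbf{s})})\cdot\ldots\cdot (f_k\circ T_{p_k(\mathbf{s})})\, d\mathbf{s}$$ converge in $L^2(\mu)$ as $R_1,\ldots,R_d\to\infty$.
   Context: $(X,\mathcal{X},\mu)$ is a Lebesgue space with $\mu(X)=1$. A measure preserving flow on it is a collection $\{T_t\}_{t\in\mathbb{R}}$ of invertible measure preserving transformations of $(X,\mathcal{X},\mu)$ such that $(t,x)\mapsto T_t(x)$ is measurable from $\mathbb{R}\times X$ to $X$, $T_0$ is the identity, and $T_s\circ T_t=T_{s+t}$ for all $s,t\in\mathbb{R}$. Functions are real-valued. $\mathbf{s}=(s_1,\ldots,s_d)\in\mathbb{R}^d$ and $d\mathbf{s}$ is Lebesgue measure. The limit is taken as $R_1,\ldots,R_d$ all tend to infinity, independently of each other. *)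

theory Defs
  imports "HOL-Probability.Probability"
begin

definition isomorphic_mod_0 :: "'a measure \<Rightarrow> 'b measure \<Rightarrow> bool" where
  "isomorphic_mod_0 M N \<longleftrightarrow>
     (\<exists>A B \<phi> \<psi>. A \<subseteq> space M \<and> space M - A \<in> null_sets M \<and>
        B \<subseteq> space N \<and> space N - B \<in> null_sets N \<and>
        \<phi> \<in> measurable (restrict_space M A) (restrict_space N B) \<and>
        \<psi> \<in> measurable (restrict_space N B) (restrict_space M A) \<and>
        (\<forall>x\<in>A. \<psi> (\<phi> x) = x) \<and> (\<forall>y\<in>B. \<phi> (\<psi> y) = y) \<and>
        distr (restrict_space M A) (restrict_space N B) \<phi> = restrict_space N B)"

text \<open>
  A Lebesgue space in the sense of Rokhlin, of total mass 1: a complete probability space that is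
  isomorphic mod 0 to an interval with Lebesgue measure together with countably many atoms.
  Either part may be absent (\<open>c = 0\<close>, respectively \<open>D = {}\<close>).
\<close>

definition lebesgue_space :: "'a measure \<Rightarrow> bool" where
  "lebesgue_space M \<longleftrightarrow> prob_space M \<and> complete_measure M \<and>
     (\<exists>D c. countable D \<and> D \<subseteq> space M \<and> (\<forall>a\<in>D. {a} \<in> sets M \<and> emeasure M {a} > 0) \<and>
        0 \<le> c \<and> isomorphic_mod_0 (restrict_space M (space M - D)) (lebesgue_on {0..c::real}))"

lemma lebesgue_space_unit_interval: "lebesgue_space (lebesgue_on {0..1::real})"
proof -
  let ?M = "lebesgue_on {0..1::real}"
  have eq: "restrict_space ?M {0..1} = ?M"
    by (simp add: restrict_restrict_space)
  have "prob_space ?M"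
    by (intro prob_spaceI) (simp add: emeasure_restrict_space)
  moreover have "complete_measure ?M"
    by standard (auto simp: null_sets_restrict_space sets_restrict_space_iff
        intro: completion.complete)
  moreover have "isomorphic_mod_0 ?M ?M"
    unfolding isomorphic_mod_0_def
    by (intro exI[of _ "{0..1::real}"] exI[of _ "\<lambda>x::real. x"]) (auto simp: eq distr_id)
  ultimately show ?thesis
    unfolding lebesgue_space_def
    by (intro conjI exI[of _ "{}"] exI[of _ "1::real"]) (auto simp: eq)
qed

definition invertible_measure_preserving :: "'a measure \<Rightarrow> ('a \<Rightarrow> 'a) \<Rightarrow> bool" where
  "invertible_measure_preserving M S \<longleftrightarrow>
     S \<in> measurable M M \<and> bij_betw S (space M) (space M) \<and>
     the_inv_into (space M) S \<in> measurable M M \<and> distr M M S = M"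

text \<open>
  Joint measurability refers to the completed product \<open>\<sigma>\<close>-algebra on \<open>\<real> \<times> X\<close>. As
  \<open>\<sigma>\<close>-algebras of Lebesgue spaces are complete, the uncompleted product of the Borel sets with
  them would be too small: it does not contain the set of all \<open>(t, x)\<close> with \<open>x + t \<in> N\<close> for a
  non-Borel null set \<open>N\<close>, and so it would exclude the rotation flow on the circle.
\<close>

definition measure_preserving_flow :: "'a measure \<Rightarrow> (real \<Rightarrow> 'a \<Rightarrow> 'a) \<Rightarrow> bool" where
  "measure_preserving_flow M T \<longleftrightarrow>
     (\<forall>t. invertible_measure_preserving M (T t)) \<and>
     (\<lambda>(t, x). T t x) \<in> measurable (completion (lborel \<Otimes>\<^sub>M M)) M \<and>
     (\<forall>x\<in>space M. T 0 x = x) \<and>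
     (\<forall>s t. \<forall>x\<in>space M. T s (T t x) = T (s + t) x)"

text \<open>Elements of \<open>L\<^sup>\<infinity>(\<mu>)\<close> and \<open>L\<^sup>2(\<mu>)\<close> are represented by measurable functions.\<close>

definition L_infinity :: "'a measure \<Rightarrow> ('a \<Rightarrow> real) set" where
  "L_infinity M = {f \<in> borel_measurable M. \<exists>C. AE x in M. \<bar>f x\<bar> \<le> C}"

definition L_two :: "'a measure \<Rightarrow> ('a \<Rightarrow> real) set" where
  "L_two M = {f \<in> borel_measurable M. integrable M (\<lambda>x. (f x)\<^sup>2)}"

definition L_two_norm :: "'a measure \<Rightarrow> ('a \<Rightarrow> real) \<Rightarrow> real" where
  "L_two_norm M f = sqrt (LINT x|M. (f x)\<^sup>2)"

definition converges_in_L_two :: "'a measure \<Rightarrow> ('i \<Rightarrow> 'a \<Rightarrow> real) \<Rightarrow> 'i filter \<Rightarrow> bool" where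
  "converges_in_L_two M u \<F> \<longleftrightarrow>
     (\<forall>\<^sub>F r in \<F>. u r \<in> L_two M) \<and>
     (\<exists>F\<in>L_two M. ((\<lambda>r. L_two_norm M (\<lambda>x. u r x - F x)) \<longlongrightarrow> 0) \<F>)"

text \<open>
  The order on \<^typ>\<open>real ^ 'd\<close> is componentwise, so \<open>at_top\<close> is the filter of all coordinates
  tending to infinity independently of each other, and \<open>cbox 0 R\<close> is the product of the
  intervals \<open>{0..R $ i}\<close>.
\<close>

lemma eventually_at_top_vec:
  "eventually P (at_top :: (real ^ 'd) filter) \<longleftrightarrow> (\<exists>r. \<forall>R. (\<forall>i. r \<le> R $ i) \<longrightarrow> P R)"
proof -
  have "eventually P (at_top :: (real ^ 'd) filter) \<longleftrightarrow> (\<exists>N. \<forall>R\<ge>N. P R)"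
    unfolding at_top_def
  proof (subst eventually_INF_base)
    fix a b :: "real ^ 'd"
    show "\<exists>x\<in>UNIV. principal {x..} \<le> inf (principal {a..}) (principal {b..})"
      by (intro bexI[of _ "\<chi> i. max (a $ i) (b $ i)"]) (auto simp: less_eq_vec_def)
  qed (auto simp: eventually_principal)
  also have "\<dots> \<longleftrightarrow> (\<exists>r. \<forall>R. (\<forall>i. r \<le> R $ i) \<longrightarrow> P R)"
  proof
    assume "\<exists>N. \<forall>R\<ge>N. P R"
    then obtain N where N: "\<forall>R\<ge>N. P R" ..
    have "N $ i \<le> (MAX i. N $ i)" for i
      by simp
    then show "\<exists>r. \<forall>R. (\<forall>i. r \<le> R $ i) \<longrightarrow> P R"
      using N by (intro exI[of _ "MAX i. N $ i"]) (auto simp: less_eq_vec_def intro: order_trans)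
  next
    assume "\<exists>r. \<forall>R. (\<forall>i. r \<le> R $ i) \<longrightarrow> P R"
    then obtain r where "\<forall>R. (\<forall>i. r \<le> R $ i) \<longrightarrow> P R" ..
    then show "\<exists>N. \<forall>R\<ge>N. P R"
      by (intro exI[of _ "\<chi> i. r"]) (auto simp: less_eq_vec_def)
  qed
  finally show ?thesis .
qed

text \<open>
  The integral over the box is taken with respect to the completed Lebesgue measure: for almost
  every \<open>x\<close> the integrand is a Lebesgue measurable, but in general not a Borel measurable, function
  of \<open>s\<close>.
\<close>

definition polynomial_average ::
  "(real \<Rightarrow> 'a \<Rightarrow> 'a) \<Rightarrow> nat \<Rightarrow> (nat \<Rightarrow> real ^ 'd \<Rightarrow> real) \<Rightarrow> (nat \<Rightarrow> 'a \<Rightarrow> real) \<Rightarrow> real ^ 'd \<Rightarrow> 'a \<Rightarrow> real"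
  where
  "polynomial_average T k p f R x =
     (\<Prod>i\<in>UNIV. 1 / R $ i) * (LINT s:cbox 0 R|lebesgue. (\<Prod>j=1..k. f j (T (p j s) x)))"

end

theory Submission
  imports Defs
begin

text \<open>
  Up to a boundary term, the average over a box is the integral over \<open>u\<close> in the unit cube of the
  averages of \<open>f\<^sub>1 \<circ> T (p\<^sub>1 (u + n)) \<cdots> f\<^sub>k \<circ> T (p\<^sub>k (u + n))\<close> over integer points \<open>n\<close>, so by
  dominated convergence it suffices that the latter are Cauchy for almost every \<open>u\<close>. This is an
  instance of Walsh's theorem for commuting transformations, proved here without quantitative bounds:
  all data depend on a parameter \<open>i\<close>, the seminorm is a finitely additive mean over \<open>i\<close> of squared
  \<open>L\<^sup>2\<close> norms, and the parameter space may be enlarged. On a suitable enlargement write one of the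
  functions as \<open>v + w\<close>, where \<open>v\<close> is a sum of dual functions and the norm of \<open>w\<close> is almost
  minimal. Then the averages with \<open>w\<close> are eventually small, as otherwise they would provide a dual
  function that reduces the norm further. The averages with a dual function are means of averages for
  a reduced family of polynomials, and repeated reduction terminates.
\<close>

section \<open>Polynomials and the reduction of families\<close>

text \<open>The dual function that corrects a remainder depends on the scale at which the averages
  of this remainder are large, and the scale is not known in advance. So the averages for the
  reduced family must converge uniformly in scale, shift and remainder. This uniformity is carried
  by the quantifier over all means in \<open>Conv\<close>. An unknown scale becomes an
  \<open>infinite_index\<close>: a fixed shift then changes an average over \<open>B (N i)\<close>
  only by a quantity of mean zero. Exponents are real even at integer points, so one flow supplies
  all the commuting maps, and real valued polynomials on N^d suffice. The other obstacle is
  measurability. Joint measurability for the completed product says nothing on {t} \<times> X for a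
  null set of times t. Substituting t = p(s) is harmless only if p pulls null sets back to null
  sets; this is proved for nonconstant p, and constant p is treated apart. Once the integrand is
  replaced by a product measurable kernel, the integer averages use only single maps
  \<open>T t\<close>, and the averages over real boxes use only the kernel.\<close>

text \<open>\<open>polys r\<close> consists of the polynomials of degree strictly less than \<open>r\<close>.\<close>

primrec polys :: "nat \<Rightarrow> ('g::cancel_comm_monoid_add \<Rightarrow> real) set" where
  "polys 0 = {\<lambda>_. 0}"
| "polys (Suc r) = {p. \<forall>m. (\<lambda>n. p (n + m) - p n) \<in> polys r}"

declare polys.simps(2) [simp del]

lemma polys_SucI: "(\<And>m. (\<lambda>n. p (n + m) - p n) \<in> polys r) \<Longrightarrow> p \<in> polys (Suc r)"
  by (simp add: polys.simps)

lemma polys_difference: "p \<in> polys (Suc r) \<Longrightarrow> (\<lambda>n. p (n + m) - p n) \<in> polys r"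
  by (simp add: polys.simps)

lemma polys_zero [simp]: "(\<lambda>_. 0) \<in> polys r"
  by (induction r) (auto simp: polys.simps)

lemma polys_const: "(\<lambda>_. c) \<in> polys (Suc r)"
  by (intro polys_SucI) simp

lemma polys_Suc_mono: "p \<in> polys r \<Longrightarrow> p \<in> polys (Suc r)"
  by (induction r arbitrary: p) (auto simp: polys.simps)

lemma polys_mono: "p \<in> polys r \<Longrightarrow> r \<le> s \<Longrightarrow> p \<in> polys s"
  by (induction s) (auto simp: le_Suc_eq intro: polys_Suc_mono)

lemma polys_add: "p \<in> polys r \<Longrightarrow> q \<in> polys r \<Longrightarrow> (\<lambda>n. p n + q n) \<in> polys r"
proof (induction r arbitrary: p q)
  case (Suc r)
  have "(\<lambda>n. (p (n + m) - p n) + (q (n + m) - q n)) \<in> polys r" for m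
    using Suc by (intro Suc.IH polys_difference)
  then show ?case
    by (intro polys_SucI) (simp add: algebra_simps)
qed simp

lemma polys_minus: "p \<in> polys r \<Longrightarrow> (\<lambda>n. - p n) \<in> polys r"
proof (induction r arbitrary: p)
  case (Suc r)
  have "(\<lambda>n. - (p (n + m) - p n)) \<in> polys r" for m
    using Suc by (intro Suc.IH polys_difference)
  then show ?case
    by (intro polys_SucI) (simp add: algebra_simps)
qed simp

lemma polys_diff: "p \<in> polys r \<Longrightarrow> q \<in> polys r \<Longrightarrow> (\<lambda>n. p n - q n) \<in> polys r"
  using polys_add[of p r "\<lambda>n. - q n"] polys_minus[of q r] by simp

lemma polys_shift: "p \<in> polys r \<Longrightarrow> (\<lambda>n. p (n + l)) \<in> polys r"
proof (induction r arbitrary: p)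
  case (Suc r)
  have "(\<lambda>n. p ((n + l) + m) - p (n + l)) \<in> polys r" for m
    using Suc.IH[OF polys_difference[OF Suc.prems]] .
  then show ?case
    by (intro polys_SucI) (simp add: ac_simps)
qed simp

text \<open>Discrete Leibniz rule: the difference of the product is (p(n + m) - p(n)) q(n + m) +
  p(n) (q(n + m) - q(n)), and each term lowers one of the two bounds. For positive r and s the bound
  r + s is one more than the sharp one, which avoids truncated subtraction in the induction.\<close>

lemma polys_mult: "p \<in> polys r \<Longrightarrow> q \<in> polys s \<Longrightarrow> (\<lambda>n. p n * q n) \<in> polys (r + s)"
proof (induction "r + s" arbitrary: r s p q)
  case (Suc t)
  show ?case
  proof (cases "r = 0 \<or> s = 0")
    case True
    with Suc.prems show ?thesis
      by auto
  next
    case False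
    then obtain r' s' where rs: "r = Suc r'" "s = Suc s'"
      by (metis not0_implies_Suc)
    have t: "t = r' + s" "t = r + s'" "r + s = Suc t" using Suc.hyps(2) rs by auto
    have 1: "(\<lambda>n. (p (n + m) - p n) * q (n + m)) \<in> polys t" for m
      unfolding t(1) using Suc.prems rs
      by (intro Suc.hyps(1)[OF t(1)] polys_difference polys_shift) auto
    have 2: "(\<lambda>n. p n * (q (n + m) - q n)) \<in> polys t" for m
      unfolding t(2) using Suc.prems rs
      by (intro Suc.hyps(1)[OF t(2)] polys_difference) auto
    have "(\<lambda>n. p (n + m) * q (n + m) - p n * q n) \<in> polys t" for m
      using polys_add[OF 1 2, of m m] by (simp add: algebra_simps)
    then show ?thesis
      unfolding t(3) by (rule polys_SucI)
  qed
qed simp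

text \<open>In a polynomial family, the second argument is the parameter on which all data depend.\<close>

type_synonym 'g pfam = "'g \<Rightarrow> nat \<Rightarrow> real"

section \<open>Families with a parameter and their reduction\<close>

definition ppolys :: "nat \<Rightarrow> 'g::cancel_comm_monoid_add pfam set" where
  "ppolys r = {g. \<forall>i. (\<lambda>n. g n i) \<in> polys r}"

text \<open>Base change: \<open>\<pi>\<close> maps an enlarged parameter space to the old one, both
  being coded into \<open>nat\<close>.\<close>

definition pull :: "(nat \<Rightarrow> nat) \<Rightarrow> 'g pfam \<Rightarrow> 'g pfam" where
  "pull \<pi> g = (\<lambda>n i. g n (\<pi> i))"

text \<open>The exponent that arises when the summand of index n + m of a dual function is composed
  with \<open>T (g n i)\<close>. The shift \<open>m i\<close> is itself read off the
  parameter.\<close>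

definition bracket :: "(nat \<Rightarrow> 'g) \<Rightarrow> 'g::cancel_comm_monoid_add pfam \<Rightarrow> 'g pfam \<Rightarrow> 'g pfam" where
  "bracket m g h = (\<lambda>n i. g n i - g (n + m i) i + h (n + m i) i)"

text \<open>The exponents left after g is eliminated: the old ones survive from the outer average,
  the brackets come from inside the dual function. If 0 is in S, the bracket with h = 0 is the
  exponent of the function b in \<open>dual\<close>.\<close>

definition reduct :: "(nat \<Rightarrow> nat) \<Rightarrow> (nat \<Rightarrow> 'g) \<Rightarrow> 'g::cancel_comm_monoid_add pfam \<Rightarrow> 'g pfam set \<Rightarrow> 'g pfam set"
  where "reduct \<pi> m g S = pull \<pi> ` S \<union> (\<lambda>h. bracket m (pull \<pi> g) (pull \<pi> h)) ` S"

text \<open>Termination of the reduction, expressed without a count of steps: each step branches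
  over all base changes and all shift functions, and only the eliminated g is a choice. The
  convergence proof is an induction over this predicate.\<close>

inductive good :: "'g::cancel_comm_monoid_add pfam set \<Rightarrow> bool" where
  good_zero: "good {\<lambda>n i. 0}"
| good_insert: "\<lbrakk>(\<lambda>n i. 0) \<in> S; \<And>\<pi> m. good (reduct \<pi> m g S)\<rbrakk> \<Longrightarrow> good (insert g S)"

lemma pull_zero [simp]: "pull \<pi> (\<lambda>n i. 0) = (\<lambda>n i. 0)"
  by (simp add: pull_def)

lemma pull_pull: "pull \<pi> (pull \<rho> g) = pull (\<rho> \<circ> \<pi>) g"
  by (simp add: pull_def)

lemma ppolys_pull: "g \<in> ppolys r \<Longrightarrow> pull \<pi> g \<in> ppolys r"
  by (simp add: ppolys_def pull_def)

lemma ppolys_bracket: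
  assumes "g \<in> ppolys r" "h \<in> ppolys r"
  shows "bracket m g h \<in> ppolys r"
proof -
  have "(\<lambda>n. g n i) \<in> polys r" "(\<lambda>n. h n i) \<in> polys r" for i
    using assms by (simp_all add: ppolys_def)
  then show ?thesis
    unfolding ppolys_def bracket_def
    using polys_shift[of "\<lambda>n. g n i" r "m i" for i] polys_shift[of "\<lambda>n. h n i" r "m i" for i]
    by (simp add: polys_add polys_diff)
qed

lemma ppolys_diff: "g \<in> ppolys r \<Longrightarrow> h \<in> ppolys r \<Longrightarrow> (\<lambda>n i. g n i - h n i) \<in> ppolys r"
  by (simp add: ppolys_def polys_diff)

lemma ppolys_add: "g \<in> ppolys r \<Longrightarrow> h \<in> ppolys r \<Longrightarrow> (\<lambda>n i. g n i + h n i) \<in> ppolys r"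
  by (simp add: ppolys_def polys_add)

lemma ppolys_Suc: "g \<in> ppolys r \<Longrightarrow> g \<in> ppolys (Suc r)"
  unfolding ppolys_def by (blast intro: polys_Suc_mono)

text \<open>\<open>bracket m g h\<close> is h plus the m-difference of h minus the m-difference of
  g, and differences lose a degree. So a bracket stays in the class of h modulo lower degree,
  whatever g and m are.\<close>

lemma bracket_diff:
  assumes "g \<in> ppolys (Suc r)" "h \<in> ppolys (Suc r)" "(\<lambda>n i. h n i - s n i) \<in> ppolys r"
  shows "(\<lambda>n i. bracket m g h n i - s n i) \<in> ppolys r"
proof -
  have "(\<lambda>n. (h n i - s n i) + ((h (n + m i) i - h n i) - (g (n + m i) i - g n i))) \<in> polys r" for i
  proof (rule polys_add)
    show "(\<lambda>n. h n i - s n i) \<in> polys r"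
      using assms(3) by (simp add: ppolys_def)
    show "(\<lambda>n. (h (n + m i) i - h n i) - (g (n + m i) i - g n i)) \<in> polys r"
      using assms(1,2)
      by (intro polys_diff polys_difference[of "\<lambda>n. h n i"] polys_difference[of "\<lambda>n. g n i"])
         (simp_all add: ppolys_def)
  qed
  then show ?thesis
    unfolding ppolys_def bracket_def by (simp add: algebra_simps)
qed

text \<open>\<open>covered r ss L\<close>: modulo degree below \<open>r\<close>, the members of \<open>L\<close> lie in the classes of
  \<open>0\<close> and of the members of \<open>ss\<close>.\<close>

definition covered :: "nat \<Rightarrow> 'g::cancel_comm_monoid_add pfam list \<Rightarrow> 'g pfam set \<Rightarrow> bool" where
  "covered r ss L \<longleftrightarrow> finite L \<and> (\<lambda>n i. 0) \<in> L \<and> L \<subseteq> ppolys (Suc r) \<and>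
     (\<forall>h\<in>L. h \<in> ppolys r \<or> (\<exists>s\<in>set ss. (\<lambda>n i. h n i - s n i) \<in> ppolys r))"

text \<open>By \<open>bracket_diff\<close> neither kind of member leaves the class it came from: a
  reduction may enlarge classes but creates none. Only the representatives are pulled back.\<close>

lemma covered_reduct:
  assumes "covered r ss L" "g \<in> ppolys (Suc r)"
  shows "covered r (map (pull \<pi>) ss) (reduct \<pi> m g L)"
proof -
  have 1: "h \<in> ppolys r \<or> (\<exists>s\<in>set (map (pull \<pi>) ss). (\<lambda>n i. h n i - s n i) \<in> ppolys r)"
    if h: "h \<in> reduct \<pi> m g L" for h
  proof -
    obtain h' where h': "h' \<in> L" "h = pull \<pi> h' \<or> h = bracket m (pull \<pi> g) (pull \<pi> h')"
      using h by (auto simp: reduct_def)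
    have P: "pull \<pi> h' \<in> ppolys (Suc r)" "pull \<pi> g \<in> ppolys (Suc r)"
      using h' assms by (auto simp: covered_def intro: ppolys_pull)
    consider "h' \<in> ppolys r" | s where "s \<in> set ss" "(\<lambda>n i. h' n i - s n i) \<in> ppolys r"
      using h'(1) assms(1) by (auto simp: covered_def)
    then show ?thesis
    proof cases
      case 1
      then have 2: "pull \<pi> h' \<in> ppolys r" by (rule ppolys_pull)
      moreover have "bracket m (pull \<pi> g) (pull \<pi> h') \<in> ppolys r"
        using bracket_diff[of "pull \<pi> g" r "pull \<pi> h'" "\<lambda>n i. 0" m] P 2 by simp
      ultimately show ?thesis using h' by auto
    next
      case 2
      have 3: "(\<lambda>n i. pull \<pi> h' n i - pull \<pi> s n i) \<in> ppolys r"
        using ppolys_pull[OF 2(2), of \<pi>] by (simp add: pull_def)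
      from bracket_diff[OF P(2,1) this, of m] 3 h'(2) 2(1) show ?thesis
        by auto
    qed
  qed
  have g: "pull \<pi> g \<in> ppolys (Suc r)"
    using assms(2) by (rule ppolys_pull)
  have L: "finite L" "(\<lambda>n i. 0) \<in> L" "L \<subseteq> ppolys (Suc r)"
    using assms(1) by (auto simp: covered_def)
  have 2: "reduct \<pi> m g L \<subseteq> ppolys (Suc r)"
    using L(3) ppolys_pull[of _ "Suc r" \<pi>] ppolys_bracket[OF g] unfolding reduct_def by blast
  have 3: "(\<lambda>n i. 0) \<in> reduct \<pi> m g L"
    using L(2) pull_zero[of \<pi>] unfolding reduct_def image_def by fastforce
  have 4: "finite (reduct \<pi> m g L)"
    using L(1) by (simp add: reduct_def)
  show ?thesis
    unfolding covered_def using 1 2 3 4 by blast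
qed

definition translate :: "'g pfam \<Rightarrow> 'g pfam \<Rightarrow> 'g pfam" where
  "translate s h = (\<lambda>n i. s n i + h n i)"

text \<open>The two values of s at n + m cancel and s(n) survives once. Hence the reduction within
  one class does not see the top-degree part common to its members.\<close>

lemma bracket_translate:
  "bracket m (translate s g) (translate s h) = translate s (bracket m g h)"
  unfolding bracket_def translate_def by (intro ext) linarith

lemma pull_translate: "pull \<pi> (translate s g) = translate (pull \<pi> s) (pull \<pi> g)"
  by (simp add: pull_def translate_def)

lemma reduct_Un: "reduct \<pi> m g (L \<union> L') = reduct \<pi> m g L \<union> reduct \<pi> m g L'"
  by (auto simp: reduct_def)

lemma reduct_translate:
  "reduct \<pi> m (translate s g) (translate s ` A) = translate (pull \<pi> s) ` reduct \<pi> m g A"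
  by (simp add: reduct_def image_Un image_image pull_translate bracket_translate)

text \<open>The reduction commutes with translating all members of one class, so a class is removed by
  running the reduction of its translate to lower degree.\<close>

lemma good_Un_translate:
  fixes A L :: "'g::cancel_comm_monoid_add pfam set"
  assumes "good A" "A \<subseteq> ppolys (Suc r)" "finite A" "s \<in> ppolys (Suc r)" "covered r ss L" "length ss = q"
    and IH: "\<And>ss L. length ss = q \<Longrightarrow> covered r ss (L :: 'g pfam set) \<Longrightarrow> good L"
  shows "good (L \<union> translate s ` A)"
  using assms(1-6)
proof (induction arbitrary: s ss L rule: good.induct)
  case good_zero
  \<comment> \<open>The class has shrunk to s alone. Eliminating s leaves a reduction of L, which is
    covered by q classes.\<close>
  have "good (reduct \<pi> m s L)" for \<pi> m
    using good_zero.prems by (intro IH[of "map (pull \<pi>) ss"] covered_reduct) auto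
  then have "good (insert s L)"
    using good_zero.prems by (intro good.good_insert) (auto simp: covered_def)
  then show ?case by (simp add: translate_def)
next
  case (good_insert A a)
  have sa: "translate s a \<in> ppolys (Suc r)"
    using good_insert.prems by (auto simp: translate_def intro: ppolys_add)
  \<comment> \<open>On the translated class this step acts as the reduction of A by a; on L it is
    harmless, since eliminating any member of the right degree keeps L covered by q classes.\<close>
  have "good (reduct \<pi> m (translate s a) (L \<union> translate s ` A))" for \<pi> m
    unfolding reduct_Un reduct_translate
  proof (rule good_insert.IH)
    have "pull \<pi> a \<in> ppolys (Suc r)" using good_insert.prems by (auto intro: ppolys_pull)
    then show "reduct \<pi> m a A \<subseteq> ppolys (Suc r)"
      using good_insert.prems by (auto simp: reduct_def intro!: ppolys_pull ppolys_bracket)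
    show "finite (reduct \<pi> m a A)" using good_insert.prems by (auto simp: reduct_def)
    show "pull \<pi> s \<in> ppolys (Suc r)" using good_insert.prems by (auto intro: ppolys_pull)
    show "covered r (map (pull \<pi>) ss) (reduct \<pi> m (translate s a) L)"
      using good_insert.prems sa by (intro covered_reduct)
    show "length (map (pull \<pi>) ss) = q" using good_insert.prems by simp
  qed
  moreover have "(\<lambda>n i. 0) \<in> L" using good_insert.prems by (auto simp: covered_def)
  ultimately have "good (insert (translate s a) (L \<union> translate s ` A))"
    by (intro good.good_insert) auto
  then show ?case by simp
qed

text \<open>As in PET induction, the outer induction is on the degree bound and the inner one on the
  number q of nonzero top-degree classes. A single class, translated so as to contain 0, has lower
  degree; running its reduction removes it, while the other classes cannot multiply.\<close>

theorem good_ppolys: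
  fixes S :: "'g::cancel_comm_monoid_add pfam set"
  assumes "finite S" "(\<lambda>n i. 0) \<in> S" "S \<subseteq> ppolys r"
  shows "good S"
  using assms
proof (induction r arbitrary: S)
  case 0
  then have "S = {\<lambda>n i. 0}"
    by (auto simp: ppolys_def fun_eq_iff)
  then show ?case by (simp add: good_zero)
next
  case (Suc r)
  note degree_IH = Suc.IH
  have main: "good L" if "length ss = q" "covered r ss L" for q ss and L :: "'g pfam set"
    using that
  proof (induction q arbitrary: ss L)
    case 0
    then show ?case
      by (intro Suc.IH) (auto simp: covered_def)
  next
    case (Suc q)
    then obtain s ss' where ss: "ss = s # ss'" "length ss' = q"
      by (auto simp: length_Suc_conv)
    define L' where "L' = {h \<in> L. h \<in> ppolys r \<or> (\<exists>s\<in>set ss'. (\<lambda>n i. h n i - s n i) \<in> ppolys r)}"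
    have L': "covered r ss' L'"
      using Suc.prems unfolding covered_def L'_def
      by (auto simp: ppolys_def)
    show ?case
    proof (cases "L = L'")
      case True
      then show ?thesis using Suc.IH[OF ss(2) L'] by simp
    next
      case False
      \<comment> \<open>Translating by a member s' of the class puts 0 into A, as
        \<open>good\<close> requires; the representative s need not belong to L.\<close>
      then obtain s' where s': "s' \<in> L - L'" unfolding L'_def by auto
      define A where "A = (\<lambda>h n i. h n i - s' n i) ` (L - L')"
      have d: "(\<lambda>n i. h n i - s n i) \<in> ppolys r" if "h \<in> L - L'" for h
        using that Suc.prems unfolding covered_def L'_def ss by auto
      have A: "A \<subseteq> ppolys r"
      proof
        fix a assume "a \<in> A"
        then obtain h where h: "h \<in> L - L'" "a = (\<lambda>n i. h n i - s' n i)"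
          by (auto simp: A_def)
        have "(\<lambda>n i. (h n i - s n i) - (s' n i - s n i)) \<in> ppolys r"
          by (rule ppolys_diff[OF d[OF h(1)] d[OF s']])
        then show "a \<in> ppolys r" using h by simp
      qed
      have "(\<lambda>n i. 0) \<in> A" using s' by (force simp: A_def)
      then have "good A"
        using A Suc.prems by (intro degree_IH) (auto simp: A_def covered_def)
      moreover have "translate s' ` A = L - L'"
        by (simp add: A_def image_image translate_def)
      moreover have "finite A" using Suc.prems by (auto simp: A_def covered_def)
      moreover have "A \<subseteq> ppolys (Suc r)" using A ppolys_Suc by blast
      moreover have "s' \<in> ppolys (Suc r)" using s' Suc.prems by (auto simp: covered_def)
      ultimately have "good (L' \<union> (L - L'))"
        using good_Un_translate[OF _ _ _ _ L' ss(2) Suc.IH, of A s'] by simp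
      then show ?thesis by (simp add: L'_def Un_absorb1)
    qed
  qed
  obtain ss where "set ss = S" using Suc.prems finite_list by blast
  moreover have "(\<lambda>n i. (0::real)) \<in> (ppolys r :: 'g pfam set)"
    by (simp add: ppolys_def)
  ultimately have "covered r ss S"
    using Suc.prems unfolding covered_def by force
  then show ?case using main by blast
qed

section \<open>Means on bounded sequences and averages\<close>

definition bdd :: "(nat \<Rightarrow> real) \<Rightarrow> bool" where
  "bdd h \<longleftrightarrow> (\<exists>C. \<forall>i. \<bar>h i\<bar> \<le> C)"

text \<open>A finitely additive probability on the parameters, written as a positive functional; on
  unbounded sequences its values are arbitrary.\<close>

definition mean :: "((nat \<Rightarrow> real) \<Rightarrow> real) \<Rightarrow> bool" where
  "mean \<phi> \<longleftrightarrow>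
     (\<forall>h k. bdd h \<longrightarrow> bdd k \<longrightarrow> \<phi> (\<lambda>i. h i + k i) = \<phi> h + \<phi> k) \<and>
     (\<forall>c h. bdd h \<longrightarrow> \<phi> (\<lambda>i. c * h i) = c * \<phi> h) \<and>
     (\<forall>h. bdd h \<longrightarrow> (\<forall>i. 0 \<le> h i) \<longrightarrow> 0 \<le> \<phi> h) \<and>
     \<phi> (\<lambda>_. 1) = 1"

lemma bddI: "(\<And>i. \<bar>h i\<bar> \<le> C) \<Longrightarrow> bdd h"
  by (auto simp: bdd_def)

lemma bddE:
  assumes "bdd h" obtains C where "0 < C" "\<And>i. \<bar>h i\<bar> \<le> C"
proof -
  obtain C where "\<And>i. \<bar>h i\<bar> \<le> C" using assms by (auto simp: bdd_def)
  then show ?thesis using that[of "max C 1"] by (simp add: le_max_iff_disj)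
qed

lemma bdd_const: "bdd (\<lambda>_. c)"
  by (auto simp: bdd_def)

lemma bdd_add: assumes "bdd h" "bdd k" shows "bdd (\<lambda>i. h i + k i)"
proof -
  obtain C D where "\<And>i. \<bar>h i\<bar> \<le> C" "\<And>i. \<bar>k i\<bar> \<le> D"
    using assms by (auto simp: bdd_def)
  then show ?thesis
    by (intro bddI[of _ "C + D"]) (meson abs_triangle_ineq add_mono order_trans)
qed

lemma bdd_cmult: assumes "bdd h" shows "bdd (\<lambda>i. c * h i)"
proof -
  obtain C where "\<And>i. \<bar>h i\<bar> \<le> C" using assms by (auto simp: bdd_def)
  then show ?thesis
    by (intro bddI[of _ "\<bar>c\<bar> * C"]) (simp add: abs_mult mult_left_mono)
qed

lemma bdd_diff: "bdd h \<Longrightarrow> bdd k \<Longrightarrow> bdd (\<lambda>i. h i - k i)"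
  using bdd_add[of h "\<lambda>i. -1 * k i"] bdd_cmult[of k "-1"] by simp

lemma bdd_comp: "bdd h \<Longrightarrow> bdd (\<lambda>i. h (\<pi> i))"
  by (auto simp: bdd_def)

lemma mean_add: "mean \<phi> \<Longrightarrow> bdd h \<Longrightarrow> bdd k \<Longrightarrow> \<phi> (\<lambda>i. h i + k i) = \<phi> h + \<phi> k"
  by (simp add: mean_def)

lemma mean_cmult: "mean \<phi> \<Longrightarrow> bdd h \<Longrightarrow> \<phi> (\<lambda>i. c * h i) = c * \<phi> h"
  by (simp add: mean_def)

lemma mean_nonneg: "mean \<phi> \<Longrightarrow> bdd h \<Longrightarrow> (\<And>i. 0 \<le> h i) \<Longrightarrow> 0 \<le> \<phi> h"
  by (simp add: mean_def)

lemma mean_const: "mean \<phi> \<Longrightarrow> \<phi> (\<lambda>_. c) = c"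
  using mean_cmult[of \<phi> "\<lambda>_. 1" c] bdd_const[of 1] by (simp add: mean_def)

lemma mean_diff: "mean \<phi> \<Longrightarrow> bdd h \<Longrightarrow> bdd k \<Longrightarrow> \<phi> (\<lambda>i. h i - k i) = \<phi> h - \<phi> k"
  using mean_add[of \<phi> h "\<lambda>i. -1 * k i"] bdd_cmult[of k "-1"] mean_cmult[of \<phi> k "-1"] by simp

lemma mean_mono:
  assumes "mean \<phi>" "bdd h" "bdd k" "\<And>i. h i \<le> k i" shows "\<phi> h \<le> \<phi> k"
  using mean_nonneg[OF assms(1) bdd_diff[OF assms(3,2)]] mean_diff[OF assms(1,3,2)] assms(4)
  by simp

lemma mean_abs_le:
  assumes "mean \<phi>" "\<And>i. \<bar>h i\<bar> \<le> C" shows "\<bar>\<phi> h\<bar> \<le> C"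
proof -
  have "bdd h" using assms(2) by (rule bddI)
  then have "\<phi> h \<le> C" "- C \<le> \<phi> h"
    using mean_mono[OF assms(1), of h "\<lambda>_. C"] mean_mono[OF assms(1), of "\<lambda>_. - C" h]
      bdd_const mean_const[OF assms(1)] assms(2) by (auto simp: abs_le_iff minus_le_iff)
  then show ?thesis by simp
qed

text \<open>A cluster point of the evaluation functionals, in the compact product of intervals.\<close>

lemma banach_limit_exists:
  obtains L where "mean L" "\<And>h l. bdd h \<Longrightarrow> h \<longlonglongrightarrow> l \<Longrightarrow> L h = l"
proof -
  have "\<forall>h. \<exists>C. bdd h \<longrightarrow> (\<forall>i. \<bar>h i\<bar> \<le> C)" by (auto simp: bdd_def)
  then obtain C where C: "\<And>h i. bdd h \<Longrightarrow> \<bar>h i\<bar> \<le> C h" by metis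
  define X where "X = PiE UNIV (\<lambda>h. if bdd h then {- C h..C h} else {0})"
  \<comment> \<open>Unbounded sequences are sent to 0 so that every evaluation lies in X.\<close>
  define e where "e = (\<lambda>k h. if bdd h then h k else (0::real) :: real)"
  have "compactin euclidean X"
    unfolding X_def euclidean_product_topology[symmetric] by (auto simp: compactin_PiE)
  then have "compact X" by simp
  moreover have "\<forall>\<^sub>F \<psi> in filtermap e sequentially. \<psi> \<in> X"
  proof -
    have "e k \<in> X" for k
      using C[of _ k] by (auto simp: X_def e_def PiE_iff abs_le_iff minus_le_iff)
    then show ?thesis by (simp add: eventually_filtermap)
  qed
  ultimately obtain L where L: "inf (nhds L) (filtermap e sequentially) \<noteq> bot"
    unfolding compact_filter by (metis filtermap_bot_iff sequentially_bot)
  define G where "G = inf (nhds L) (filtermap e sequentially)"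
  have G: "G \<noteq> bot" using L by (simp add: G_def)
  have coord: "((\<lambda>\<psi>. \<psi> h) \<longlongrightarrow> L h) G" for h
  proof -
    have "((\<lambda>\<psi>. \<psi> h) \<longlongrightarrow> L h) (nhds L)"
    proof (rule topological_tendstoI)
      fix S :: "real set" assume S: "open S" "L h \<in> S"
      have "open ((\<lambda>\<psi>. \<psi> h) -` S)"
        using S(1) continuous_on_product_coordinates[of h] by (rule open_vimage)
      then show "\<forall>\<^sub>F \<psi> in nhds L. \<psi> h \<in> S"
        unfolding eventually_nhds using S(2) by (intro exI[of _ "(\<lambda>\<psi>. \<psi> h) -` S"]) auto
    qed
    then show ?thesis unfolding G_def by (rule tendsto_mono[rotated]) simp
  qed
  have ev: "\<forall>\<^sub>F \<psi> in G. P \<psi>" if "\<And>k. P (e k)" for P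
  proof -
    have "\<forall>\<^sub>F \<psi> in filtermap e sequentially. P \<psi>"
      using that by (simp add: eventually_filtermap)
    then show ?thesis unfolding G_def using filter_leD[OF inf_le2] by blast
  qed
  have uniq: "a = b" if "((\<lambda>\<psi>. u \<psi>) \<longlongrightarrow> a) G" "((\<lambda>\<psi>. v \<psi>) \<longlongrightarrow> b) G" "\<And>k. u (e k) = v (e k)"
    for u v :: "((nat \<Rightarrow> real) \<Rightarrow> real) \<Rightarrow> real" and a b
    using that ev[of "\<lambda>\<psi>. u \<psi> = v \<psi>"] tendsto_unique[OF G] tendsto_cong by metis
  have "mean L"
    unfolding mean_def
  proof (intro conjI allI impI)
    show "L (\<lambda>i. h i + k i) = L h + L k" if "bdd h" "bdd k" for h k
      using that bdd_add[OF that]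
      by (intro uniq[OF coord tendsto_add[OF coord coord]]) (simp add: e_def)
    show "L (\<lambda>i. c * h i) = c * L h" if "bdd h" for c h
      using that bdd_cmult[OF that]
      by (intro uniq[OF coord tendsto_mult_left[OF coord]]) (simp add: e_def)
    show "0 \<le> L h" if "bdd h" "\<forall>i. 0 \<le> h i" for h
      using that by (intro tendsto_lowerbound[OF coord _ G] ev) (simp add: e_def)
    show "L (\<lambda>_. 1) = 1"
      by (intro uniq[OF coord tendsto_const]) (simp add: e_def bdd_const)
  qed
  moreover have "L h = l" if "bdd h" "h \<longlonglongrightarrow> l" for h l
  proof -
    have "((\<lambda>\<psi>. \<psi> h) \<longlongrightarrow> l) (filtermap e sequentially)"
      using that by (simp add: filterlim_filtermap e_def)
    then have "((\<lambda>\<psi>. \<psi> h) \<longlongrightarrow> l) G"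
      unfolding G_def by (rule tendsto_mono[rotated]) simp
    then show ?thesis using coord tendsto_unique[OF G] by metis
  qed
  ultimately show ?thesis using that by blast
qed

text \<open>Each \<open>N i\<close> is finite, yet N exceeds every bound off a set of mean zero.
  This is possible because a mean need not be countably additive; N acts as an infinite
  integer.\<close>

definition infinite_index :: "((nat \<Rightarrow> real) \<Rightarrow> real) \<Rightarrow> (nat \<Rightarrow> nat) \<Rightarrow> bool" where
  "infinite_index \<phi> N \<longleftrightarrow> (\<forall>l. \<phi> (\<lambda>i. if N i \<le> l then 1 else 0) = 0)"

lemma mean_vanishing:
  assumes "mean \<phi>" "infinite_index \<phi> N" "e \<longlonglongrightarrow> 0"
  shows "\<phi> (\<lambda>i. e (N i)) = 0"
proof -
  obtain C where C: "\<And>k. \<bar>e k\<bar> \<le> C"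
    using convergent_imp_Bseq[of e] assms(3) by (auto simp: convergent_def Bseq_def)
  have C0: "0 \<le> C" using C[of 0] by linarith
  have "bdd e" using C by (rule bddI)
  then have b: "bdd (\<lambda>i. e (N i))" by (rule bdd_comp)
  have "\<bar>\<phi> (\<lambda>i. e (N i))\<bar> \<le> \<epsilon>" if \<epsilon>: "0 < \<epsilon>" for \<epsilon>
  proof -
    obtain l where l: "\<And>k. k \<ge> l \<Longrightarrow> \<bar>e k\<bar> < \<epsilon>"
      using LIMSEQ_D[OF assms(3) \<epsilon>] by auto
    define k where "k = (\<lambda>i. if N i \<le> l then 1 else (0::real))"
    have bk: "bdd k" by (rule bddI[of _ 1]) (simp add: k_def)
    have \<phi>k: "\<phi> k = 0" using assms(2) by (simp add: infinite_index_def k_def)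
    have bnd: "bdd (\<lambda>i. \<epsilon> + C * k i)" by (intro bdd_add bdd_const bdd_cmult bk)
    have val: "\<phi> (\<lambda>i. \<epsilon> + C * k i) = \<epsilon>"
      using mean_add[OF assms(1) bdd_const[of \<epsilon>] bdd_cmult[OF bk, of C]]
        mean_const[OF assms(1)] mean_cmult[OF assms(1) bk] \<phi>k by simp
    have le: "\<bar>e (N i)\<bar> \<le> \<epsilon> + C * k i" for i
      using l[of "N i"] C[of "N i"] \<epsilon> C0 by (auto simp: k_def not_le)
    have "\<phi> (\<lambda>i. e (N i)) \<le> \<epsilon>"
      using mean_mono[OF assms(1) b bnd] le val by (metis abs_le_D1)
    moreover have "\<phi> (\<lambda>i. -1 * e (N i)) \<le> \<epsilon>"
      using mean_mono[OF assms(1) bdd_cmult[OF b, of "-1"] bnd] le val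
      by (metis abs_le_D2 mult_minus1)
    ultimately show ?thesis
      using mean_cmult[OF assms(1) b, of "-1"] by simp
  qed
  then show ?thesis by (metis abs_le_zero_iff dense_ge)
qed

section \<open>Averages over finite sets\<close>

definition avg :: "'b set \<Rightarrow> ('b \<Rightarrow> real) \<Rightarrow> real" where
  "avg A f = (\<Sum>n\<in>A. f n) / real (card A)"

lemma avg_cong: "(\<And>n. n \<in> A \<Longrightarrow> f n = g n) \<Longrightarrow> avg A f = avg A g"
  by (simp add: avg_def)

lemma avg_add: "avg A (\<lambda>n. f n + g n) = avg A f + avg A g"
  by (simp add: avg_def sum.distrib add_divide_distrib)

lemma avg_diff: "avg A (\<lambda>n. f n - g n) = avg A f - avg A g"
  by (simp add: avg_def sum_subtractf diff_divide_distrib)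

lemma avg_cmult: "avg A (\<lambda>n. c * f n) = c * avg A f"
  by (simp add: avg_def sum_distrib_left)

lemma avg_mult: "avg A (\<lambda>n. f n * c) = avg A f * c"
  by (simp add: avg_def sum_distrib_right)

lemma avg_const: "finite A \<Longrightarrow> A \<noteq> {} \<Longrightarrow> avg A (\<lambda>_. c) = c"
  by (simp add: avg_def)

lemma avg_mono: "(\<And>n. n \<in> A \<Longrightarrow> f n \<le> g n) \<Longrightarrow> avg A f \<le> avg A g"
  by (simp add: avg_def sum_mono divide_right_mono)

lemma avg_nonneg: "(\<And>n. n \<in> A \<Longrightarrow> 0 \<le> f n) \<Longrightarrow> 0 \<le> avg A f"
  by (simp add: avg_def sum_nonneg)

lemma avg_abs_le:
  assumes "finite A" "A \<noteq> {}" "\<And>n. n \<in> A \<Longrightarrow> \<bar>f n\<bar> \<le> C"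
  shows "\<bar>avg A f\<bar> \<le> C"
proof -
  have "avg A f \<le> avg A (\<lambda>_. C)" "avg A (\<lambda>_. - C) \<le> avg A f"
    using assms(3) by (auto intro!: avg_mono simp: abs_le_iff minus_le_iff)
  then show ?thesis using assms(1,2) by (simp add: avg_const)
qed

lemma avg_power2_le:
  assumes "finite A" "A \<noteq> {}"
  shows "(avg A f)\<^sup>2 \<le> avg A (\<lambda>n. (f n)\<^sup>2)"
proof -
  have "0 \<le> avg A (\<lambda>n. (f n - avg A f)\<^sup>2)" by (rule avg_nonneg) simp
  also have "(\<lambda>n. (f n - avg A f)\<^sup>2) = (\<lambda>n. ((f n)\<^sup>2 - (2 * avg A f) * f n) + (avg A f)\<^sup>2)"
    by (auto simp: power2_eq_square algebra_simps)
  also have "avg A \<dots> = avg A (\<lambda>n. (f n)\<^sup>2) - (avg A f)\<^sup>2"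
    using assms by (simp add: avg_add avg_diff avg_cmult avg_const power2_eq_square)
  finally show ?thesis by simp
qed

text \<open>The two sums differ only over the symmetric difference of A and l + A, which is what the
  Folner condition controls.\<close>

lemma avg_shift_le:
  fixes A :: "'g::cancel_comm_monoid_add set"
  assumes "finite A" "\<And>n. \<bar>f n\<bar> \<le> C"
  shows "\<bar>avg A f - avg A (\<lambda>n. f (l + n))\<bar> \<le>
     C * (real (card ((A - (+) l ` A) \<union> ((+) l ` A - A))) / real (card A))"
proof -
  let ?B = "(+) l ` A"
  have "(\<Sum>n\<in>A. f (l + n)) = sum f ?B"
    by (simp add: sum.reindex)
  moreover have "sum f A - sum f ?B = sum f (A - ?B) - sum f (?B - A)"
    using assms(1) sum.Int_Diff[of A f ?B] sum.Int_Diff[of ?B f A] by (simp add: Int_commute)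
  moreover have "\<bar>sum f D\<bar> \<le> C * real (card D)" if "finite D" for D
    using order_trans[OF sum_abs[of f D] sum_mono[of D "\<lambda>n. \<bar>f n\<bar>" "\<lambda>_. C"]] assms(2)
    by (simp add: mult.commute)
  then have "\<bar>sum f (A - ?B)\<bar> \<le> C * real (card (A - ?B))" "\<bar>sum f (?B - A)\<bar> \<le> C * real (card (?B - A))"
    using assms(1) by auto
  moreover have "card ((A - ?B) \<union> (?B - A)) = card (A - ?B) + card (?B - A)"
    using assms(1) by (intro card_Un_disjoint) auto
  ultimately have "\<bar>sum f A - (\<Sum>n\<in>A. f (l + n))\<bar> \<le> C * real (card ((A - ?B) \<union> (?B - A)))"
    by (simp add: distrib_left)
  then have "\<bar>sum f A - (\<Sum>n\<in>A. f (l + n))\<bar> / real (card A) \<le>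
      C * real (card ((A - ?B) \<union> (?B - A))) / real (card A)"
    by (rule divide_right_mono) simp
  then show ?thesis
    by (simp add: avg_def diff_divide_distrib[symmetric])
qed

section \<open>Norm convergence of averages along a Folner sequence\<close>

text \<open>The index type is meant for N^d, hence a cancellative monoid. Its countability allows a
  shift to be coded into the parameter. Measurability of each single \<open>T t\<close> is enough
  here, as all averages are finite sums.\<close>

locale folner_flow = prob_space M for M :: "'a measure" +
  fixes T :: "real \<Rightarrow> 'a \<Rightarrow> 'a"
    and B :: "nat \<Rightarrow> 'g::{cancel_comm_monoid_add, countable} set"
  assumes T_measurable [measurable]: "T t \<in> measurable M M"
    and T_preserves: "distr M M (T t) = M"
    and T_zero: "x \<in> space M \<Longrightarrow> T 0 x = x"
    and T_add: "x \<in> space M \<Longrightarrow> T s (T t x) = T (s + t) x"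
    and B_finite: "finite (B j)"
    and B_nonempty: "B j \<noteq> {}"
    and B_folner: "(\<lambda>j. real (card ((B j - (+) l ` B j) \<union> ((+) l ` B j - B j))) / real (card (B j))) \<longlonglongrightarrow> 0"
begin

lemma T_space: "x \<in> space M \<Longrightarrow> T t x \<in> space M"
  by (rule measurable_space[OF T_measurable])

lemma integral_T:
  fixes F :: "'a \<Rightarrow> real"
  assumes [measurable]: "F \<in> borel_measurable M"
  shows "(\<integral>x. F (T t x) \<partial>M) = (\<integral>x. F x \<partial>M)"
proof -
  have "(\<integral>x. F x \<partial>distr M M (T t)) = (\<integral>x. F (T t x) \<partial>M)"
    by (rule integral_distr) measurable
  then show ?thesis by (simp add: T_preserves)
qed

section \<open>Uniformly bounded functions depending on a parameter\<close>

definition bfun :: "(nat \<Rightarrow> 'a \<Rightarrow> real) \<Rightarrow> bool" where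
  "bfun F \<longleftrightarrow> (\<forall>i. F i \<in> borel_measurable M) \<and> (\<exists>C. \<forall>i. \<forall>x\<in>space M. \<bar>F i x\<bar> \<le> C)"

lemma bfunI:
  "(\<And>i. F i \<in> borel_measurable M) \<Longrightarrow> (\<And>i x. x \<in> space M \<Longrightarrow> \<bar>F i x\<bar> \<le> C) \<Longrightarrow> bfun F"
  by (auto simp: bfun_def)

lemma bfun_measurable: "bfun F \<Longrightarrow> F i \<in> borel_measurable M"
  by (simp add: bfun_def)

lemma bfunE:
  assumes "bfun F" obtains C where "0 < C" "\<And>i x. x \<in> space M \<Longrightarrow> \<bar>F i x\<bar> \<le> C"
proof -
  obtain C where "\<And>i x. x \<in> space M \<Longrightarrow> \<bar>F i x\<bar> \<le> C" using assms by (auto simp: bfun_def)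
  then show ?thesis using that[of "max C 1"] by (simp add: le_max_iff_disj)
qed

lemma bfun_integrable: assumes "bfun F" shows "integrable M (F i)"
proof -
  obtain C where "\<And>i x. x \<in> space M \<Longrightarrow> \<bar>F i x\<bar> \<le> C" using assms by (auto simp: bfun_def)
  then show ?thesis
    using bfun_measurable[OF assms] by (intro integrable_const_bound[of _ C]) auto
qed

lemma bfun_const: "bfun (\<lambda>i x. c)"
  by (auto simp: bfun_def)

lemma bfun_add: assumes "bfun F" "bfun G" shows "bfun (\<lambda>i x. F i x + G i x)"
proof -
  obtain C where C: "\<And>i x. x \<in> space M \<Longrightarrow> \<bar>F i x\<bar> \<le> C" using bfunE[OF assms(1)] by metis
  obtain D where D: "\<And>i x. x \<in> space M \<Longrightarrow> \<bar>G i x\<bar> \<le> D" using bfunE[OF assms(2)] by metis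
  then show ?thesis
    using bfun_measurable[OF assms(1)] bfun_measurable[OF assms(2)]
    by (intro bfunI[of _ "C + D"])
      (auto intro!: order_trans[OF abs_triangle_ineq] add_mono C D)
qed

lemma bfun_mult: assumes "bfun F" "bfun G" shows "bfun (\<lambda>i x. F i x * G i x)"
proof -
  obtain C where C: "0 < C" "\<And>i x. x \<in> space M \<Longrightarrow> \<bar>F i x\<bar> \<le> C" using bfunE[OF assms(1)] by metis
  obtain D where D: "\<And>i x. x \<in> space M \<Longrightarrow> \<bar>G i x\<bar> \<le> D" using bfunE[OF assms(2)] by metis
  then show ?thesis
    using bfun_measurable[OF assms(1)] bfun_measurable[OF assms(2)]
    by (intro bfunI[of _ "C * D"]) (auto simp: abs_mult C(1)[THEN less_imp_le] intro!: mult_mono C(2) D)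
qed

lemma bfun_cmult: "bfun F \<Longrightarrow> bfun (\<lambda>i x. c * F i x)"
  using bfun_mult[OF bfun_const] .

lemma bfun_diff: "bfun F \<Longrightarrow> bfun G \<Longrightarrow> bfun (\<lambda>i x. F i x - G i x)"
  using bfun_add[OF _ bfun_cmult[of G "-1"], of F] by simp

lemma bfun_power2: "bfun F \<Longrightarrow> bfun (\<lambda>i x. (F i x)\<^sup>2)"
  unfolding power2_eq_square by (rule bfun_mult)

lemma bfun_comp: "bfun F \<Longrightarrow> bfun (\<lambda>i. F (\<pi> i))"
  by (auto simp: bfun_def)

lemma bfun_T:
  assumes "bfun F" shows "bfun (\<lambda>i x. F i (T (\<theta> i) x))"
proof -
  obtain C where "\<And>i x. x \<in> space M \<Longrightarrow> \<bar>F i x\<bar> \<le> C" using bfunE[OF assms] by metis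
  then show ?thesis
    using measurable_compose[OF T_measurable bfun_measurable[OF assms]]
    by (intro bfunI[of _ C]) (auto simp: T_space)
qed

lemma bfun_avg:
  assumes "\<And>i. finite (A i)" "\<And>i. A i \<noteq> {}" "\<And>i n. F i n \<in> borel_measurable M"
    and "\<And>i n x. x \<in> space M \<Longrightarrow> \<bar>F i n x\<bar> \<le> C"
  shows "bfun (\<lambda>i x. avg (A i) (\<lambda>n. F i n x))"
proof (rule bfunI)
  show "(\<lambda>x. avg (A i) (\<lambda>n. F i n x)) \<in> borel_measurable M" for i
    unfolding avg_def using assms(3) by (intro borel_measurable_divide borel_measurable_sum) auto
  show "\<bar>avg (A i) (\<lambda>n. F i n x)\<bar> \<le> C" if "x \<in> space M" for i x
    using assms that by (intro avg_abs_le) auto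
qed

lemma integral_avg:
  assumes "\<And>n. n \<in> A \<Longrightarrow> integrable M (F n)"
  shows "(\<integral>x. avg A (\<lambda>n. F n x) \<partial>M) = avg A (\<lambda>n. \<integral>x. F n x \<partial>M)"
  unfolding avg_def using assms by (simp add: Bochner_Integration.integral_sum)

lemma abs_integral_le:
  fixes F :: "'a \<Rightarrow> real"
  assumes "F \<in> borel_measurable M" "\<And>x. x \<in> space M \<Longrightarrow> \<bar>F x\<bar> \<le> C"
  shows "\<bar>\<integral>x. F x \<partial>M\<bar> \<le> C"
proof -
  have "integrable M F"
    using assms by (intro integrable_const_bound[of _ C]) auto
  then have "(\<integral>x. F x \<partial>M) \<le> (\<integral>x. C \<partial>M)" "(\<integral>x. - C \<partial>M) \<le> (\<integral>x. F x \<partial>M)"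
    using assms(2) by (intro integral_mono; force simp: abs_le_iff)+
  then show ?thesis by (simp add: prob_space abs_le_iff)
qed

lemma bdd_integral: assumes "bfun F" shows "bdd (\<lambda>i. \<integral>x. F i x \<partial>M)"
proof -
  obtain C where "\<And>i x. x \<in> space M \<Longrightarrow> \<bar>F i x\<bar> \<le> C" using bfunE[OF assms] by metis
  then show ?thesis
    using bfun_measurable[OF assms] by (intro bddI[of _ C] abs_integral_le) auto
qed

definition Q :: "((nat \<Rightarrow> real) \<Rightarrow> real) \<Rightarrow> (nat \<Rightarrow> 'a \<Rightarrow> real) \<Rightarrow> real" where
  "Q \<phi> F = \<phi> (\<lambda>i. \<integral>x. (F i x)\<^sup>2 \<partial>M)"

lemma Q_nonneg: "mean \<phi> \<Longrightarrow> bfun F \<Longrightarrow> 0 \<le> Q \<phi> F"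
  unfolding Q_def by (rule mean_nonneg[OF _ bdd_integral[OF bfun_power2]]) simp_all

lemma Q_mono:
  assumes "mean \<phi>" "bfun F" "bfun G"
    and "\<And>i. (\<integral>x. (F i x)\<^sup>2 \<partial>M) \<le> c * (\<integral>x. (G i x)\<^sup>2 \<partial>M)"
  shows "Q \<phi> F \<le> c * Q \<phi> G"
  using mean_mono[OF assms(1) bdd_integral[OF bfun_power2[OF assms(2)]]
      bdd_cmult[OF bdd_integral[OF bfun_power2[OF assms(3)]], of c]]
    mean_cmult[OF assms(1) bdd_integral[OF bfun_power2[OF assms(3)]], of c] assms(4)
  by (simp add: Q_def)

lemma Q_cong: "(\<And>i x. x \<in> space M \<Longrightarrow> F i x = G i x) \<Longrightarrow> Q \<phi> F = Q \<phi> G"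
  unfolding Q_def by (intro arg_cong[where f=\<phi>] ext Bochner_Integration.integral_cong) auto

text \<open>From (a + b)^2 \<le> 2 a^2 + 2 b^2. This serves as the triangle inequality throughout,
  so that no square roots of means occur; the fractions of \<epsilon> chosen later pay for its
  constants.\<close>

lemma Q_add_le:
  assumes "mean \<phi>" "bfun F" "bfun G"
  shows "Q \<phi> (\<lambda>i x. F i x + G i x) \<le> 2 * Q \<phi> F + 2 * Q \<phi> G"
proof -
  note b = bdd_integral[OF bfun_power2]
  have "Q \<phi> (\<lambda>i x. F i x + G i x) \<le> \<phi> (\<lambda>i. 2 * (\<integral>x. (F i x)\<^sup>2 \<partial>M) + 2 * (\<integral>x. (G i x)\<^sup>2 \<partial>M))"
    unfolding Q_def
  proof (rule mean_mono[OF assms(1) b[OF bfun_add[OF assms(2,3)]]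
          bdd_add[OF bdd_cmult[OF b[OF assms(2)]] bdd_cmult[OF b[OF assms(3)]]]])
    fix i
    have "(\<integral>x. (F i x + G i x)\<^sup>2 \<partial>M) \<le> (\<integral>x. 2 * (F i x)\<^sup>2 + 2 * (G i x)\<^sup>2 \<partial>M)"
    proof (intro integral_mono)
      show "integrable M (\<lambda>x. (F i x + G i x)\<^sup>2)"
        using bfun_integrable[OF bfun_power2[OF bfun_add[OF assms(2,3)]]] .
      show "integrable M (\<lambda>x. 2 * (F i x)\<^sup>2 + 2 * (G i x)\<^sup>2)"
        using bfun_integrable[OF bfun_power2[OF assms(2)]] bfun_integrable[OF bfun_power2[OF assms(3)]]
        by simp
      show "(F i x + G i x)\<^sup>2 \<le> 2 * (F i x)\<^sup>2 + 2 * (G i x)\<^sup>2" for x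
        using zero_le_power2[of "F i x - G i x"] by (simp add: power2_eq_square algebra_simps)
    qed
    also have "\<dots> = 2 * (\<integral>x. (F i x)\<^sup>2 \<partial>M) + 2 * (\<integral>x. (G i x)\<^sup>2 \<partial>M)"
      using bfun_integrable[OF bfun_power2[OF assms(2)]] bfun_integrable[OF bfun_power2[OF assms(3)]]
      by simp
    finally show "(\<integral>x. (F i x + G i x)\<^sup>2 \<partial>M) \<le> 2 * (\<integral>x. (F i x)\<^sup>2 \<partial>M) + 2 * (\<integral>x. (G i x)\<^sup>2 \<partial>M)" .
  qed
  also have "\<dots> = 2 * Q \<phi> F + 2 * Q \<phi> G"
    using mean_add[OF assms(1) bdd_cmult[OF b] bdd_cmult[OF b], OF assms(2,3), of 2 2]
      mean_cmult[OF assms(1) b[OF assms(2)], of 2] mean_cmult[OF assms(1) b[OF assms(3)], of 2]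
    by (simp add: Q_def)
  finally show ?thesis .
qed

lemma Q_diff_le:
  assumes "mean \<phi>" "bfun F" "bfun G"
  shows "Q \<phi> (\<lambda>i x. F i x - G i x) \<le> 2 * Q \<phi> F + 2 * Q \<phi> G"
  using Q_add_le[OF assms(1,2) bfun_cmult[OF assms(3), of "-1"]]
  by (simp add: Q_def)

text \<open>Cauchy instead of convergent, since the bounded functions need not be complete for the
  seminorm of a mean. A limit is formed only for the averages over real boxes.\<close>

definition qcauchy :: "((nat \<Rightarrow> real) \<Rightarrow> real) \<Rightarrow> (nat \<Rightarrow> nat \<Rightarrow> 'a \<Rightarrow> real) \<Rightarrow> bool" where
  "qcauchy \<phi> u \<longleftrightarrow> (\<forall>\<epsilon>>0. \<exists>J. \<forall>i\<ge>J. \<forall>j\<ge>J. Q \<phi> (\<lambda>\<iota> x. u i \<iota> x - u j \<iota> x) \<le> \<epsilon>)"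

lemma qcauchyD:
  assumes "qcauchy \<phi> u" "0 < \<epsilon>"
  obtains J where "\<And>i j. i \<ge> J \<Longrightarrow> j \<ge> J \<Longrightarrow> Q \<phi> (\<lambda>\<iota> x. u i \<iota> x - u j \<iota> x) \<le> \<epsilon>"
  using assms unfolding qcauchy_def by blast

lemma qcauchy_add:
  assumes "mean \<phi>" "\<And>j. bfun (u j)" "\<And>j. bfun (v j)" "qcauchy \<phi> u" "qcauchy \<phi> v"
  shows "qcauchy \<phi> (\<lambda>j \<iota> x. u j \<iota> x + v j \<iota> x)"
  unfolding qcauchy_def
proof (intro allI impI)
  fix \<epsilon> :: real assume \<epsilon>: "0 < \<epsilon>"
  obtain J where J: "\<And>i j. i \<ge> J \<Longrightarrow> j \<ge> J \<Longrightarrow> Q \<phi> (\<lambda>\<iota> x. u i \<iota> x - u j \<iota> x) \<le> \<epsilon> / 4"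
    using qcauchyD[OF assms(4), of "\<epsilon> / 4"] \<epsilon> by auto
  obtain K where K: "\<And>i j. i \<ge> K \<Longrightarrow> j \<ge> K \<Longrightarrow> Q \<phi> (\<lambda>\<iota> x. v i \<iota> x - v j \<iota> x) \<le> \<epsilon> / 4"
    using qcauchyD[OF assms(5), of "\<epsilon> / 4"] \<epsilon> by auto
  have "Q \<phi> (\<lambda>\<iota> x. u i \<iota> x + v i \<iota> x - (u j \<iota> x + v j \<iota> x)) \<le> \<epsilon>" if "i \<ge> max J K" "j \<ge> max J K" for i j
  proof -
    have "Q \<phi> (\<lambda>\<iota> x. (u i \<iota> x - u j \<iota> x) + (v i \<iota> x - v j \<iota> x)) \<le> \<epsilon>"
      using Q_add_le[OF assms(1) bfun_diff bfun_diff, OF assms(2,2,3,3), of i j i j]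
        J[of i j] K[of i j] that by simp
    then show ?thesis by (simp add: algebra_simps)
  qed
  then show "\<exists>J. \<forall>i\<ge>J. \<forall>j\<ge>J. Q \<phi> (\<lambda>\<iota> x. u i \<iota> x + v i \<iota> x - (u j \<iota> x + v j \<iota> x)) \<le> \<epsilon>"
    by blast
qed

lemma qcauchy_cong:
  assumes "\<And>j \<iota> x. x \<in> space M \<Longrightarrow> u j \<iota> x = v j \<iota> x" "qcauchy \<phi> u"
  shows "qcauchy \<phi> v"
proof -
  have "Q \<phi> (\<lambda>\<iota> x. v i \<iota> x - v j \<iota> x) = Q \<phi> (\<lambda>\<iota> x. u i \<iota> x - u j \<iota> x)" for i j
    using assms(1) by (intro Q_cong) simp
  then show ?thesis using assms(2) by (simp add: qcauchy_def)
qed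

lemma qcauchy_null_diff:
  assumes "mean \<phi>" "\<And>j. bfun (u j)" "\<And>j. bfun (v j)" "qcauchy \<phi> v"
    and "\<And>j. Q \<phi> (\<lambda>\<iota> x. u j \<iota> x - v j \<iota> x) \<le> 0"
  shows "qcauchy \<phi> u"
proof -
  have "Q \<phi> (\<lambda>\<iota> x. (u i \<iota> x - v i \<iota> x) - (u j \<iota> x - v j \<iota> x)) \<le> 0" for i j
    using Q_diff_le[OF assms(1) bfun_diff bfun_diff, OF assms(2,3,2,3), of i i j j]
      assms(5)[of i] assms(5)[of j] by linarith
  from order_trans[OF this] have "qcauchy \<phi> (\<lambda>j \<iota> x. u j \<iota> x - v j \<iota> x)"
    unfolding qcauchy_def by (simp add: less_imp_le)
  from qcauchy_add[OF assms(1) bfun_diff[OF assms(2,3)] assms(3) this assms(4)] show ?thesis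
    by simp
qed

text \<open>The assignment \<open>\<theta>\<close> of exponents is left open so that one list of
  factors serves for the averages, for the dual functions and for the reduced families.\<close>

definition tprod :: "('g pfam \<times> (nat \<Rightarrow> 'a \<Rightarrow> real)) list \<Rightarrow> ('g pfam \<Rightarrow> real) \<Rightarrow> nat \<Rightarrow> 'a \<Rightarrow> real" where
  "tprod fs \<theta> i x = (\<Prod>(h, c)\<leftarrow>fs. c i (T (\<theta> h) x))"

lemma tprod_Nil [simp]: "tprod [] \<theta> i x = 1"
  by (simp add: tprod_def)

lemma tprod_Cons [simp]: "tprod ((h, c) # fs) \<theta> i x = c i (T (\<theta> h) x) * tprod fs \<theta> i x"
  by (simp add: tprod_def)

lemma tprod_append: "tprod (fs @ gs) \<theta> i x = tprod fs \<theta> i x * tprod gs \<theta> i x"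
  by (simp add: tprod_def)

definition bfuns :: "('g pfam \<times> (nat \<Rightarrow> 'a \<Rightarrow> real)) list \<Rightarrow> bool" where
  "bfuns fs \<longleftrightarrow> (\<forall>(h, c)\<in>set fs. bfun c)"

lemma bfuns_simps [simp]:
  "bfuns []" "bfuns ((h, c) # fs) \<longleftrightarrow> bfun c \<and> bfuns fs" "bfuns (fs @ gs) \<longleftrightarrow> bfuns fs \<and> bfuns gs"
  by (auto simp: bfuns_def)

lemma tprod_measurable: "bfuns fs \<Longrightarrow> tprod fs \<theta> i \<in> borel_measurable M"
proof (induction fs)
  case (Cons p fs)
  obtain h c where p: "p = (h, c)" by (cases p)
  have "(\<lambda>x. c i (T (\<theta> h) x) * tprod fs \<theta> i x) \<in> borel_measurable M"
    using Cons p by (intro borel_measurable_times measurable_compose[OF T_measurable bfun_measurable]) auto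
  then show ?case by (simp add: p tprod_Cons[abs_def])
qed (simp add: tprod_Nil[abs_def])

lemma tprod_bound:
  assumes "bfuns fs"
  obtains K where "0 < K" "\<And>\<theta> i x. x \<in> space M \<Longrightarrow> \<bar>tprod fs \<theta> i x\<bar> \<le> K"
proof -
  have "\<exists>K>0. \<forall>\<theta> i. \<forall>x\<in>space M. \<bar>tprod fs \<theta> i x\<bar> \<le> K"
    using assms
  proof (induction fs)
    case Nil
    then show ?case by (intro exI[of _ 1]) simp
  next
    case (Cons p fs)
    obtain h c where p: "p = (h, c)" by (cases p)
    obtain K where K: "0 < K" "\<And>\<theta> i x. x \<in> space M \<Longrightarrow> \<bar>tprod fs \<theta> i x\<bar> \<le> K"
      using Cons p by auto
    obtain C where C: "0 < C" "\<And>i x. x \<in> space M \<Longrightarrow> \<bar>c i x\<bar> \<le> C"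
      using Cons.prems p bfunE[of c] by auto
    show ?case
      using K C by (intro exI[of _ "C * K"]) (auto simp: p abs_mult T_space intro!: mult_mono)
  qed
  then show ?thesis using that by blast
qed

definition Av :: "('g pfam \<times> (nat \<Rightarrow> 'a \<Rightarrow> real)) list \<Rightarrow> nat \<Rightarrow> nat \<Rightarrow> 'a \<Rightarrow> real" where
  "Av fs j i x = avg (B j) (\<lambda>n. tprod fs (\<lambda>h. h n i) i x)"

lemma bfun_Av: assumes "bfuns fs" shows "bfun (Av fs j)"
proof -
  obtain K where "\<And>\<theta> i x. x \<in> space M \<Longrightarrow> \<bar>tprod fs \<theta> i x\<bar> \<le> K"
    using tprod_bound[OF assms] by metis
  then show ?thesis
    unfolding Av_def[abs_def]
    by (rule bfun_avg[OF B_finite B_nonempty tprod_measurable[OF assms]])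
qed

text \<open>The adjoint of w \<mapsto> \<open>Av ((g, w) # fs)\<close> applied to b, see
  \<open>integral_mult_dual\<close>. The averaging set varies with the parameter, so that one
  function can hold the duals at all scales.\<close>

definition dual :: "'g pfam \<Rightarrow> ('g pfam \<times> (nat \<Rightarrow> 'a \<Rightarrow> real)) list \<Rightarrow> (nat \<Rightarrow> nat) \<Rightarrow>
    (nat \<Rightarrow> 'a \<Rightarrow> real) \<Rightarrow> nat \<Rightarrow> 'a \<Rightarrow> real" where
  "dual g fs N b i x =
     avg (B (N i)) (\<lambda>n. b i (T (- g n i) x) * tprod fs (\<lambda>h. h n i - g n i) i x)"

lemma bfun_dual: assumes "bfuns fs" "bfun b" shows "bfun (dual g fs N b)"
proof -
  obtain K where K: "0 < K" "\<And>\<theta> i x. x \<in> space M \<Longrightarrow> \<bar>tprod fs \<theta> i x\<bar> \<le> K"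
    using tprod_bound[OF assms(1)] by metis
  obtain C where C: "0 < C" "\<And>i x. x \<in> space M \<Longrightarrow> \<bar>b i x\<bar> \<le> C"
    using bfunE[OF assms(2)] by metis
  show ?thesis
    unfolding dual_def[abs_def]
  proof (rule bfun_avg[of _ _ "C * K"])
    show "(\<lambda>x. b i (T (- g n i) x) * tprod fs (\<lambda>h. h n i - g n i) i x) \<in> borel_measurable M" for n i
      by (intro borel_measurable_times tprod_measurable[OF assms(1)]
          measurable_compose[OF T_measurable bfun_measurable[OF assms(2)]])
    show "\<bar>b i (T (- g n i) x) * tprod fs (\<lambda>h. h n i - g n i) i x\<bar> \<le> C * K" if "x \<in> space M" for n i x
      unfolding abs_mult using C(1) by (intro mult_mono C(2) K(2) T_space that) auto
  qed (simp_all add: B_finite B_nonempty)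
qed

lemma tprod_T:
  assumes "x \<in> space M"
  shows "tprod fs \<theta> i (T t x) = tprod fs (\<lambda>h. \<theta> h + t) i x"
  unfolding tprod_def T_add[OF assms] ..


definition relabel :: "('g pfam \<Rightarrow> 'g pfam) \<Rightarrow> (nat \<Rightarrow> nat) \<Rightarrow> ('g pfam \<times> (nat \<Rightarrow> 'a \<Rightarrow> real)) list \<Rightarrow>
    ('g pfam \<times> (nat \<Rightarrow> 'a \<Rightarrow> real)) list" where
  "relabel F \<pi> fs = map (\<lambda>(h, c). (F h, \<lambda>i. c (\<pi> i))) fs"

lemma tprod_relabel: "tprod (relabel F \<pi> fs) \<theta> i x = tprod fs (\<lambda>h. \<theta> (F h)) (\<pi> i) x"
  by (induction fs) (auto simp: relabel_def)

lemma bfuns_relabel: "bfuns fs \<Longrightarrow> bfuns (relabel F \<pi> fs)"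
  by (auto simp: bfuns_def relabel_def intro: bfun_comp)

lemma fst_relabel: "fst ` set (relabel F \<pi> fs) = F ` fst ` set fs"
  by (force simp: relabel_def)

lemma Av_relabel_pull: "Av (relabel (pull \<pi>) \<pi> fs) j i = Av fs j (\<pi> i)"
  by (simp add: Av_def[abs_def] tprod_relabel pull_def)

lemma dual_relabel_pull:
  "dual (pull \<pi> g) (relabel (pull \<pi>) \<pi> fs) (\<lambda>i. N (\<pi> i)) (\<lambda>i. b (\<pi> i)) i = dual g fs N b (\<pi> i)"
  by (simp add: dual_def[abs_def] tprod_relabel pull_def)

definition Conv :: "'g pfam set \<Rightarrow> bool" where
  "Conv S \<longleftrightarrow> (\<forall>\<phi> fs. mean \<phi> \<longrightarrow> bfuns fs \<longrightarrow> fst ` set fs \<subseteq> S \<longrightarrow> qcauchy \<phi> (Av fs))"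

lemma avg_swap: "avg A (\<lambda>n. avg C (\<lambda>l. F n l)) = avg C (\<lambda>l. avg A (\<lambda>n. F n l))"
  unfolding avg_def sum_divide_distrib[symmetric] by (subst sum.swap) (simp add: mult.commute)

text \<open>A mean on pairs (i, n) coded by e: average over n in \<open>B (N i)\<close>, then apply
  \<phi> in i.\<close>

lemma mean_avg:
  assumes "mean \<phi>"
  shows "mean (\<lambda>h. \<phi> (\<lambda>i. avg (B (N i)) (\<lambda>n. h (e i n))))"
proof -
  have bd: "bdd (\<lambda>i. avg (B (N i)) (\<lambda>n. h (e i n)))" if h: "bdd h" for h
  proof -
    obtain C where "\<And>i. \<bar>h i\<bar> \<le> C" using bddE[OF h] by metis
    then show ?thesis by (intro bddI[of _ C] avg_abs_le B_finite B_nonempty)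
  qed
  show ?thesis
    unfolding mean_def
  proof (intro conjI allI impI)
    fix h k :: "nat \<Rightarrow> real" and c :: real
    assume h: "bdd h"
    show "\<phi> (\<lambda>i. avg (B (N i)) (\<lambda>n. c * h (e i n))) = c * \<phi> (\<lambda>i. avg (B (N i)) (\<lambda>n. h (e i n)))"
      by (simp add: avg_cmult mean_cmult[OF assms bd[OF h]])
    show "0 \<le> \<phi> (\<lambda>i. avg (B (N i)) (\<lambda>n. h (e i n)))" if "\<forall>i. 0 \<le> h i"
      using that by (intro mean_nonneg[OF assms bd[OF h]] avg_nonneg) auto
    show "\<phi> (\<lambda>i. avg (B (N i)) (\<lambda>n. h (e i n) + k (e i n))) =
        \<phi> (\<lambda>i. avg (B (N i)) (\<lambda>n. h (e i n))) + \<phi> (\<lambda>i. avg (B (N i)) (\<lambda>n. k (e i n)))" if "bdd k"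
      by (simp add: avg_add mean_add[OF assms bd[OF h] bd[OF that]])
  next
    show "\<phi> (\<lambda>i. avg (B (N i)) (\<lambda>n. 1)) = 1"
      by (simp add: avg_const B_finite B_nonempty mean_const[OF assms])
  qed
qed

text \<open>Shifting the variable of the dual function by \<open>l\<close>, which costs nothing as \<open>N\<close> is infinite,
  turns the \<open>l\<close>-th term into an average over shifts \<open>n\<close> of terms for the reduced family; the
  shift becomes part of the parameter.\<close>

lemma qcauchy_Av_dual:
  assumes "mean \<phi>" "infinite_index \<phi> N" "bfuns fs" "bfun b" "fst ` set fs \<subseteq> S" "(\<lambda>n i. 0) \<in> S"
    and conv: "\<And>\<pi> m. Conv (reduct \<pi> m g S)"
  shows "qcauchy \<phi> (Av ((g, dual g fs N b) # fs))"
proof -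
  \<comment> \<open>A parameter now codes a pair: an old parameter, read by \<open>\<pi>\<close>,
    and a shift, read by m.\<close>
  define \<pi> where "\<pi> = (\<lambda>i. fst (prod_decode i))"
  define m :: "nat \<Rightarrow> 'g" where "m = (\<lambda>i. from_nat (snd (prod_decode i)))"
  define e where "e = (\<lambda>i (n::'g). prod_encode (i, to_nat n))"
  have e: "\<pi> (e i n) = i" "m (e i n) = n" for i n
    by (simp_all add: e_def \<pi>_def m_def)
  define \<psi> where "\<psi> = (\<lambda>h. \<phi> (\<lambda>i. avg (B (N i)) (\<lambda>n. h (e i n))))"
  have \<psi>: "mean \<psi>" unfolding \<psi>_def by (rule mean_avg[OF assms(1)])
  define br where "br = (\<lambda>h. bracket m (pull \<pi> g) (pull \<pi> h))"
  \<comment> \<open>The old exponents come from the outer average, that of b and the remaining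
    brackets from the dual function.\<close>
  define gs where "gs = relabel (pull \<pi>) \<pi> fs @ (br (\<lambda>n i. 0), \<lambda>i. b (\<pi> i)) # relabel br \<pi> fs"
  have gs: "bfuns gs"
    using assms(3,4) by (simp add: gs_def bfuns_relabel bfun_comp)
  have "fst ` set gs \<subseteq> reduct \<pi> m g S"
    using assms(5,6) unfolding gs_def reduct_def br_def set_append list.set image_Un fst_relabel
      image_insert fst_conv by blast
  then have Y: "qcauchy \<psi> (Av gs)"
    using conv[of \<pi> m] \<psi> gs unfolding Conv_def by blast
  \<comment> \<open>The term of index l of the average and of index n of the dual function. With n
    replaced by l + n it becomes the term of index l of \<open>Av gs\<close> at the parameter coding
    (i, n).\<close>
  define W where "W = (\<lambda>i x l n. tprod fs (\<lambda>h. h l i) i x *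
     (b i (T (g l i - g n i) x) * tprod fs (\<lambda>h. g l i - g n i + h n i) i x))"
  define V where "V = (\<lambda>j i x. avg (B (N i)) (\<lambda>n. Av gs j (e i n) x))"
  have Av_gs: "Av gs j (e i n) x = avg (B j) (\<lambda>l. W i x l (l + n))" for j i n x
    by (simp add: Av_def gs_def tprod_append tprod_relabel W_def e br_def bracket_def pull_def)
  have V_eq: "V j i x = avg (B j) (\<lambda>l. avg (B (N i)) (\<lambda>n. W i x l (l + n)))" for j i x
    unfolding V_def Av_gs by (rule avg_swap)
  have U_eq: "Av ((g, dual g fs N b) # fs) j i x = avg (B j) (\<lambda>l. avg (B (N i)) (W i x l))"
    if x: "x \<in> space M" for j i x
  proof -
    have "dual g fs N b i (T (g l i) x) * tprod fs (\<lambda>h. h l i) i x = avg (B (N i)) (W i x l)" for l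
      unfolding dual_def avg_mult[symmetric]
      by (rule avg_cong) (simp add: W_def tprod_T[OF x] T_add[OF x] algebra_simps)
    then show ?thesis by (simp add: Av_def)
  qed
  obtain K where K: "0 < K" "\<And>\<theta> i x. x \<in> space M \<Longrightarrow> \<bar>tprod fs \<theta> i x\<bar> \<le> K"
    using tprod_bound[OF assms(3)] by metis
  obtain C where C: "0 < C" "\<And>i x. x \<in> space M \<Longrightarrow> \<bar>b i x\<bar> \<le> C"
    using bfunE[OF assms(4)] by metis
  define D where "D = K * (C * K)"
  have W: "\<bar>W i x l n\<bar> \<le> D" if "x \<in> space M" for i x l n
    unfolding W_def D_def abs_mult
    using K(1) C(1) by (intro mult_mono K(2) C(2) T_space that) auto
  define fo where "fo = (\<lambda>l k. real (card ((B k - (+) l ` B k) \<union> ((+) l ` B k - B k))) / real (card (B k)))"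
  \<comment> \<open>Bounds the cost of all shifts l in \<open>B j\<close> when the dual function
    averages over \<open>B k\<close>; the sum replaces a maximum. For fixed j it tends to 0 in k, so
    at the infinite index k = \<open>N i\<close> its square has mean zero.\<close>
  define er where "er = (\<lambda>j k. (\<Sum>l\<in>B j. D * fo l k))"
  have D0: "0 \<le> D" using K(1) C(1) by (simp add: D_def)
  have fo0: "0 \<le> fo l k" for l k by (simp add: fo_def)
  have UV: "\<bar>Av ((g, dual g fs N b) # fs) j i x - V j i x\<bar> \<le> er j (N i)" if x: "x \<in> space M" for j i x
    unfolding U_eq[OF x] V_eq avg_diff[symmetric]
  proof (rule avg_abs_le[OF B_finite B_nonempty])
    fix l assume l: "l \<in> B j"
    have "\<bar>avg (B (N i)) (W i x l) - avg (B (N i)) (\<lambda>n. W i x l (l + n))\<bar> \<le> D * fo l (N i)"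
      unfolding fo_def by (rule avg_shift_le[OF B_finite W[OF x]])
    also have "\<dots> \<le> er j (N i)"
      unfolding er_def by (rule member_le_sum[OF l]) (simp_all add: D0 fo0 B_finite)
    finally show "\<bar>avg (B (N i)) (\<lambda>n. W i x l n - W i x l (l + n))\<bar> \<le> er j (N i)"
      by (simp add: avg_diff)
  qed
  have er: "er j \<longlonglongrightarrow> 0" for j
  proof -
    have "er j \<longlonglongrightarrow> (\<Sum>l\<in>B j. D * 0)"
      unfolding er_def fo_def by (intro tendsto_sum tendsto_mult_left B_folner)
    then show ?thesis by simp
  qed
  have bU: "bfun (Av ((g, dual g fs N b) # fs) j)" for j
    using assms(3,4) by (intro bfun_Av) (simp add: bfun_dual)
  obtain L where L: "\<And>\<theta> i x. x \<in> space M \<Longrightarrow> \<bar>tprod gs \<theta> i x\<bar> \<le> L"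
    using tprod_bound[OF gs] by metis
  have bV: "bfun (V j)" for j
    unfolding V_def[abs_def]
  proof (rule bfun_avg[OF B_finite B_nonempty])
    show "Av gs j (e i n) \<in> borel_measurable M" for i n
      by (rule bfun_measurable[OF bfun_Av[OF gs]])
    show "\<bar>Av gs j (e i n) x\<bar> \<le> L" if "x \<in> space M" for i n x
      unfolding Av_def using that by (intro avg_abs_le B_finite B_nonempty L)
  qed
  have null: "Q \<phi> (\<lambda>i x. Av ((g, dual g fs N b) # fs) j i x - V j i x) \<le> 0" for j
  proof -
    have "Q \<phi> (\<lambda>i x. Av ((g, dual g fs N b) # fs) j i x - V j i x) \<le> \<phi> (\<lambda>i. (er j (N i))\<^sup>2)"
      unfolding Q_def
    proof (rule mean_mono[OF assms(1) bdd_integral[OF bfun_power2[OF bfun_diff[OF bU bV]]]])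
      have "Bseq (\<lambda>k. (er j k)\<^sup>2)"
        by (rule convergent_imp_Bseq, unfold convergent_def, rule exI, rule tendsto_power[OF er])
      then obtain c where "\<And>k. norm ((er j k)\<^sup>2) \<le> c"
        by (rule BseqE) blast
      then have "\<And>k. \<bar>(er j k)\<^sup>2\<bar> \<le> c"
        by simp
      then show "bdd (\<lambda>i. (er j (N i))\<^sup>2)" by (rule bddI)
      fix i
      have "\<bar>\<integral>x. (Av ((g, dual g fs N b) # fs) j i x - V j i x)\<^sup>2 \<partial>M\<bar> \<le> (er j (N i))\<^sup>2"
      proof (rule abs_integral_le)
        show "(\<lambda>x. (Av ((g, dual g fs N b) # fs) j i x - V j i x)\<^sup>2) \<in> borel_measurable M"
          by (rule bfun_measurable[OF bfun_power2[OF bfun_diff[OF bU bV]]])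
        show "\<bar>(Av ((g, dual g fs N b) # fs) j i x - V j i x)\<^sup>2\<bar> \<le> (er j (N i))\<^sup>2" if "x \<in> space M" for x
          using power_mono[OF UV[OF that], where n=2] by simp
      qed
      then show "(\<integral>x. (Av ((g, dual g fs N b) # fs) j i x - V j i x)\<^sup>2 \<partial>M) \<le> (er j (N i))\<^sup>2"
        by simp
    qed
    also have "\<dots> = 0"
      using mean_vanishing[OF assms(1,2), of "\<lambda>k. (er j k)\<^sup>2"] tendsto_power[OF er, of j 2] by simp
    finally show ?thesis .
  qed
  have bY: "bfun (\<lambda>\<iota> x. Av gs i \<iota> x - Av gs j \<iota> x)" for i j
    by (intro bfun_diff bfun_Av gs)
  \<comment> \<open>V averages over the shifts before squaring, \<psi> after it; convexity of the
    square compares the two.\<close>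
  have jensen: "Q \<phi> (\<lambda>\<iota> x. V i \<iota> x - V j \<iota> x) \<le> Q \<psi> (\<lambda>\<iota> x. Av gs i \<iota> x - Av gs j \<iota> x)" for i j
    unfolding Q_def \<psi>_def
  proof (rule mean_mono[OF assms(1) bdd_integral[OF bfun_power2[OF bfun_diff[OF bV bV]]]])
    let ?F = "\<lambda>\<iota> x. (Av gs i \<iota> x - Av gs j \<iota> x)\<^sup>2"
    obtain c where c: "\<And>\<iota>. \<bar>\<integral>x. ?F \<iota> x \<partial>M\<bar> \<le> c"
      using bddE[OF bdd_integral[OF bfun_power2[OF bY]]] by metis
    show "bdd (\<lambda>\<iota>. avg (B (N \<iota>)) (\<lambda>n. \<integral>x. ?F (e \<iota> n) x \<partial>M))"
      by (rule bddI, rule avg_abs_le[OF B_finite B_nonempty c])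
    fix \<iota>
    have int: "integrable M (?F k)" for k
      by (rule bfun_integrable[OF bfun_power2[OF bY]])
    have "(\<integral>x. (V i \<iota> x - V j \<iota> x)\<^sup>2 \<partial>M) \<le> (\<integral>x. avg (B (N \<iota>)) (\<lambda>n. ?F (e \<iota> n) x) \<partial>M)"
    proof (rule integral_mono)
      show "integrable M (\<lambda>x. (V i \<iota> x - V j \<iota> x)\<^sup>2)"
        by (rule bfun_integrable[OF bfun_power2[OF bfun_diff[OF bV bV]]])
      show "integrable M (\<lambda>x. avg (B (N \<iota>)) (\<lambda>n. ?F (e \<iota> n) x))"
        unfolding avg_def by (intro integrable_divide Bochner_Integration.integrable_sum int)
      show "(V i \<iota> x - V j \<iota> x)\<^sup>2 \<le> avg (B (N \<iota>)) (\<lambda>n. ?F (e \<iota> n) x)" for x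
        unfolding V_def avg_diff[symmetric] by (rule avg_power2_le[OF B_finite B_nonempty])
    qed
    also have "\<dots> = avg (B (N \<iota>)) (\<lambda>n. \<integral>x. ?F (e \<iota> n) x \<partial>M)"
      by (rule integral_avg[OF int])
    finally show "(\<integral>x. (V i \<iota> x - V j \<iota> x)\<^sup>2 \<partial>M) \<le> avg (B (N \<iota>)) (\<lambda>n. \<integral>x. ?F (e \<iota> n) x \<partial>M)" .
  qed
  have "qcauchy \<phi> V"
    using Y jensen unfolding qcauchy_def by (meson order_trans)
  then show ?thesis
    by (rule qcauchy_null_diff[OF assms(1) bU bV _ null])
qed


text \<open>In each summand x is replaced by \<open>T (g n i) x\<close>, which preserves the
  integral: b loses its flow time and w acquires the exponent g. If b is the average itself, the
  correlation is the squared norm of that average.\<close>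

lemma integral_mult_dual:
  assumes "bfuns fs" "bfun w" "bfun b"
  shows "(\<integral>x. w i x * dual g fs (\<lambda>_. j) b i x \<partial>M) = (\<integral>x. Av ((g, w) # fs) j i x * b i x \<partial>M)"
proof -
  define F where "F = (\<lambda>n x. w i x * (b i (T (- g n i) x) * tprod fs (\<lambda>h. h n i - g n i) i x))"
  have FT: "F n (T (g n i) x) = w i (T (g n i) x) * tprod fs (\<lambda>h. h n i) i x * b i x"
    if x: "x \<in> space M" for n x
    by (simp add: F_def tprod_T[OF x] T_add[OF x] T_zero[OF x])
  have "bfun (tprod fs \<theta>)" for \<theta>
    using tprod_measurable[OF assms(1)] tprod_bound[OF assms(1)] by (metis bfunI)
  then have bt: "bfun (\<lambda>_. tprod fs \<theta> i)" for \<theta>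
    by (rule bfun_comp)
  have Fb: "bfun (\<lambda>_. F n)" for n
    unfolding F_def by (intro bfun_mult bfun_T[of "\<lambda>_. b i" "\<lambda>_. - g n i"] bt bfun_comp[OF assms(2)] bfun_comp[OF assms(3)])
  have Fi: "integrable M (F n)" for n
    using bfun_integrable[OF Fb] .
  have FTi: "integrable M (\<lambda>x. F n (T (g n i) x))" for n
    using bfun_integrable[OF bfun_T[OF Fb]] .
  have "(\<integral>x. w i x * dual g fs (\<lambda>_. j) b i x \<partial>M) = (\<integral>x. avg (B j) (\<lambda>n. F n x) \<partial>M)"
    by (simp add: dual_def F_def avg_cmult)
  also have "\<dots> = avg (B j) (\<lambda>n. \<integral>x. F n x \<partial>M)"
    by (rule integral_avg[OF Fi])
  also have "\<dots> = avg (B j) (\<lambda>n. \<integral>x. F n (T (g n i) x) \<partial>M)"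
    using bfun_measurable[OF Fb] by (simp add: integral_T)
  also have "\<dots> = (\<integral>x. avg (B j) (\<lambda>n. F n (T (g n i) x)) \<partial>M)"
    by (rule integral_avg[OF FTi, symmetric])
  also have "\<dots> = (\<integral>x. Av ((g, w) # fs) j i x * b i x \<partial>M)"
    by (rule Bochner_Integration.integral_cong) (simp_all add: Av_def FT avg_mult)
  finally show ?thesis .
qed

text \<open>Convexity of the square, the bound K on the weights and invariance of the measure.
  Forming averages and forming dual functions are both operators of this shape, so both have L2 norm
  at most K.\<close>

lemma avg_T_norm_le:
  assumes "bfuns fs" "bfun b" "\<And>\<theta> i x. x \<in> space M \<Longrightarrow> \<bar>tprod fs \<theta> i x\<bar> \<le> K"
    "finite A" "A \<noteq> {}"
  shows "(\<integral>x. (avg A (\<lambda>n. b i (T (t n) x) * tprod fs (\<theta> n) i x))\<^sup>2 \<partial>M) \<le> K\<^sup>2 * (\<integral>x. (b i x)\<^sup>2 \<partial>M)"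
proof -
  have bt: "bfun (\<lambda>_. tprod fs (\<theta> n) i)" for n
    using tprod_measurable[OF assms(1)] assms(3) by (intro bfunI[of _ K])
  have bb: "bfun (\<lambda>_ x. b i (T (t n) x))" for n
    by (rule bfun_T[OF bfun_comp[OF assms(2)]])
  note int = bfun_integrable[OF bfun_power2]
  have "(\<integral>x. (avg A (\<lambda>n. b i (T (t n) x) * tprod fs (\<theta> n) i x))\<^sup>2 \<partial>M) \<le>
      (\<integral>x. avg A (\<lambda>n. K\<^sup>2 * (b i (T (t n) x))\<^sup>2) \<partial>M)"
  proof (rule integral_mono)
    obtain C where C: "0 < C" "\<And>i x. x \<in> space M \<Longrightarrow> \<bar>b i x\<bar> \<le> C"
      using bfunE[OF assms(2)] by metis
    have "bfun (\<lambda>_ x. avg A (\<lambda>n. b i (T (t n) x) * tprod fs (\<theta> n) i x))"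
    proof (rule bfun_avg[OF assms(4,5)])
      show "(\<lambda>x. b i (T (t n) x) * tprod fs (\<theta> n) i x) \<in> borel_measurable M" for n
        using bfun_measurable[OF bfun_mult[OF bb bt]] .
      show "\<bar>b i (T (t n) x) * tprod fs (\<theta> n) i x\<bar> \<le> C * K" if "x \<in> space M" for n x
        unfolding abs_mult using C(1) by (intro mult_mono C(2) assms(3) T_space that) auto
    qed
    from int[OF this]
    show "integrable M (\<lambda>x. (avg A (\<lambda>n. b i (T (t n) x) * tprod fs (\<theta> n) i x))\<^sup>2)" .
    show "integrable M (\<lambda>x. avg A (\<lambda>n. K\<^sup>2 * (b i (T (t n) x))\<^sup>2))"
      unfolding avg_def using int[OF bb]
      by (intro integrable_divide Bochner_Integration.integrable_sum) simp
    fix x assume x: "x \<in> space M"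
    have "(avg A (\<lambda>n. b i (T (t n) x) * tprod fs (\<theta> n) i x))\<^sup>2 \<le>
        avg A (\<lambda>n. (b i (T (t n) x) * tprod fs (\<theta> n) i x)\<^sup>2)"
      by (rule avg_power2_le[OF assms(4,5)])
    also have "\<dots> \<le> avg A (\<lambda>n. K\<^sup>2 * (b i (T (t n) x))\<^sup>2)"
    proof (rule avg_mono)
      fix n
      have "(tprod fs (\<theta> n) i x)\<^sup>2 \<le> K\<^sup>2"
        using power_mono[OF assms(3)[OF x], where n=2] by simp
      then show "(b i (T (t n) x) * tprod fs (\<theta> n) i x)\<^sup>2 \<le> K\<^sup>2 * (b i (T (t n) x))\<^sup>2"
        unfolding power_mult_distrib by (subst mult.commute) (rule mult_right_mono, simp_all)
    qed
    finally show "(avg A (\<lambda>n. b i (T (t n) x) * tprod fs (\<theta> n) i x))\<^sup>2 \<le>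
        avg A (\<lambda>n. K\<^sup>2 * (b i (T (t n) x))\<^sup>2)" .
  qed
  also have "\<dots> = avg A (\<lambda>n. \<integral>x. K\<^sup>2 * (b i (T (t n) x))\<^sup>2 \<partial>M)"
    using int[OF bb] by (intro integral_avg integrable_mult_right)
  also have "\<dots> = avg A (\<lambda>n. K\<^sup>2 * (\<integral>x. (b i x)\<^sup>2 \<partial>M))"
    using integral_T[OF bfun_measurable[OF bfun_power2[OF assms(2)]]] by simp
  also have "\<dots> = K\<^sup>2 * (\<integral>x. (b i x)\<^sup>2 \<partial>M)"
    by (rule avg_const[OF assms(4,5)])
  finally show ?thesis .
qed

text \<open>\<open>\<psi>\<close> is a mean on a parameter space lying over that of \<open>\<phi>\<close> through \<open>\<pi>\<close>.\<close>

definition extension :: "((nat \<Rightarrow> real) \<Rightarrow> real) \<Rightarrow> (nat \<Rightarrow> nat) \<Rightarrow> ((nat \<Rightarrow> real) \<Rightarrow> real) \<Rightarrow> bool" where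
  "extension \<phi> \<pi> \<psi> \<longleftrightarrow> mean \<psi> \<and> (\<forall>h. bdd h \<longrightarrow> \<psi> (\<lambda>i. h (\<pi> i)) = \<phi> h)"

definition dsum :: "'g pfam \<Rightarrow> ('g pfam \<times> (nat \<Rightarrow> 'a \<Rightarrow> real)) list \<Rightarrow>
    ((nat \<Rightarrow> nat) \<times> (nat \<Rightarrow> 'a \<Rightarrow> real)) list \<Rightarrow> nat \<Rightarrow> 'a \<Rightarrow> real" where
  "dsum g fs vs i x = (\<Sum>(N, b)\<leftarrow>vs. dual g fs N b i x)"

definition admissible :: "((nat \<Rightarrow> real) \<Rightarrow> real) \<Rightarrow> ((nat \<Rightarrow> nat) \<times> (nat \<Rightarrow> 'a \<Rightarrow> real)) list \<Rightarrow> bool" where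
  "admissible \<phi> vs \<longleftrightarrow> (\<forall>(N, b)\<in>set vs. infinite_index \<phi> N \<and> bfun b)"

lemma bfun_dsum: "bfuns fs \<Longrightarrow> admissible \<phi> vs \<Longrightarrow> bfun (dsum g fs vs)"
proof (induction vs)
  case Nil
  then show ?case by (simp add: dsum_def[abs_def] bfun_const)
next
  case (Cons v vs)
  then show ?case
    using bfun_add[OF bfun_dual[of fs "snd v" g "fst v"]]
    by (auto simp: dsum_def[abs_def] admissible_def split_beta)
qed

text \<open>A mean on pairs (i, k) coded by e: the inner mean is over the old parameter, the outer
  one over the new coordinate.\<close>

lemma mean_limit:
  assumes "mean L" "mean \<phi>"
  shows "mean (\<lambda>h. L (\<lambda>k. \<phi> (\<lambda>i. h (e i k))))"
proof -
  have bd: "bdd (\<lambda>k. \<phi> (\<lambda>i. h (e i k)))" if h: "bdd h" for h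
  proof -
    obtain C where "\<And>i. \<bar>h i\<bar> \<le> C" using bddE[OF h] by metis
    then show ?thesis by (intro bddI[of _ C] mean_abs_le[OF assms(2)])
  qed
  have bi: "bdd (\<lambda>i. h (e i k))" if "bdd h" for h k
    using that by (rule bdd_comp)
  show ?thesis
    unfolding mean_def
  proof (intro conjI allI impI)
    fix h k :: "nat \<Rightarrow> real" and c :: real
    assume h: "bdd h"
    show "L (\<lambda>k. \<phi> (\<lambda>i. c * h (e i k))) = c * L (\<lambda>k. \<phi> (\<lambda>i. h (e i k)))"
      by (simp add: mean_cmult[OF assms(2) bi[OF h]] mean_cmult[OF assms(1) bd[OF h]])
    show "0 \<le> L (\<lambda>k. \<phi> (\<lambda>i. h (e i k)))" if "\<forall>i. 0 \<le> h i"
      using that by (intro mean_nonneg[OF assms(1) bd[OF h]] mean_nonneg[OF assms(2) bi[OF h]]) simp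
    show "L (\<lambda>n. \<phi> (\<lambda>i. h (e i n) + k (e i n))) =
        L (\<lambda>k. \<phi> (\<lambda>i. h (e i k))) + L (\<lambda>n. \<phi> (\<lambda>i. k (e i n)))" if k: "bdd k"
      by (simp add: mean_add[OF assms(2) bi[OF h] bi[OF k]] mean_add[OF assms(1) bd[OF h] bd[OF k]])
  next
    show "L (\<lambda>k. \<phi> (\<lambda>i. 1)) = 1"
      by (simp add: mean_const[OF assms(1)] mean_const[OF assms(2)])
  qed
qed

lemma Q_diff_cmult:
  assumes "mean \<phi>" "bfun F" "bfun G"
  shows "Q \<phi> (\<lambda>i x. F i x - t * G i x) =
    Q \<phi> F - 2 * t * \<phi> (\<lambda>i. \<integral>x. F i x * G i x \<partial>M) + t\<^sup>2 * Q \<phi> G"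
proof -
  note bF = bfun_power2[OF assms(2)] and bG = bfun_power2[OF assms(3)] and bFG = bfun_mult[OF assms(2,3)]
  have "(\<integral>x. (F i x - t * G i x)\<^sup>2 \<partial>M) =
      (\<integral>x. (F i x)\<^sup>2 \<partial>M) - (2 * t) * (\<integral>x. F i x * G i x \<partial>M) + t\<^sup>2 * (\<integral>x. (G i x)\<^sup>2 \<partial>M)" for i
  proof -
    have "(\<integral>x. (F i x - t * G i x)\<^sup>2 \<partial>M) =
        (\<integral>x. (F i x)\<^sup>2 - (2 * t) * (F i x * G i x) + t\<^sup>2 * (G i x)\<^sup>2 \<partial>M)"
      by (rule Bochner_Integration.integral_cong) (auto simp: power2_eq_square algebra_simps)
    then show ?thesis
      using bfun_integrable[OF bF, of i] bfun_integrable[OF bG, of i] bfun_integrable[OF bFG, of i]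
      by simp
  qed
  then have "Q \<phi> (\<lambda>i x. F i x - t * G i x) = \<phi> (\<lambda>i. ((\<integral>x. (F i x)\<^sup>2 \<partial>M) -
      (2 * t) * (\<integral>x. F i x * G i x \<partial>M)) + t\<^sup>2 * (\<integral>x. (G i x)\<^sup>2 \<partial>M))"
    by (simp add: Q_def)
  also have "\<dots> = (Q \<phi> F - (2 * t) * \<phi> (\<lambda>i. \<integral>x. F i x * G i x \<partial>M)) + t\<^sup>2 * Q \<phi> G"
    unfolding Q_def
    using mean_add[OF assms(1) bdd_diff[OF bdd_integral[OF bF] bdd_cmult[OF bdd_integral[OF bFG], of "2 * t"]]
        bdd_cmult[OF bdd_integral[OF bG], of "t\<^sup>2"]]
      mean_diff[OF assms(1) bdd_integral[OF bF] bdd_cmult[OF bdd_integral[OF bFG], of "2 * t"]]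
      mean_cmult[OF assms(1) bdd_integral[OF bFG], of "2 * t"]
      mean_cmult[OF assms(1) bdd_integral[OF bG], of "t\<^sup>2"]
    by simp
  finally show ?thesis by simp
qed


text \<open>If the averages with the near-minimal remainder \<open>w\<close> had norm above \<open>\<epsilon>\<close> at \<open>js 0, js 1, \<dots>\<close>,
  make \<open>k\<close> a new parameter: by \<open>integral_mult_dual\<close> the dual function of the averages at \<open>js k\<close>
  correlates with \<open>w\<close>, so subtracting a multiple of it beats the infimum.\<close>

lemma structure_decomposition:
  assumes \<phi>: "mean \<phi>" and fs: "bfuns fs" and f: "bfun f" and \<epsilon>: "0 < \<epsilon>"
  obtains \<pi> \<psi> vs J where "extension \<phi> \<pi> \<psi>" "admissible \<psi> vs"
    "\<And>j. j \<ge> J \<Longrightarrow> Q \<psi> (Av ((pull \<pi> g,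
        \<lambda>i x. f (\<pi> i) x - dsum (pull \<pi> g) (relabel (pull \<pi>) \<pi> fs) vs i x) #
        relabel (pull \<pi>) \<pi> fs) j) \<le> \<epsilon>"
proof -
  define rest where "rest = (\<lambda>\<pi> vs i x. f (\<pi> i) x - dsum (pull \<pi> g) (relabel (pull \<pi>) \<pi> fs) vs i x)"
  \<comment> \<open>The infimum is over all extensions at once, so that an improvement found on a
    further extension still contradicts it.\<close>
  define E where "E = {Q \<psi> (rest \<pi> vs) |\<pi> \<psi> vs. extension \<phi> \<pi> \<psi> \<and> admissible \<psi> vs}"
  have rest_bfun: "bfun (rest \<pi> vs)" if "admissible \<psi> vs" for \<psi> \<pi> vs
    unfolding rest_def by (intro bfun_diff bfun_comp[OF f] bfun_dsum[OF bfuns_relabel[OF fs] that])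
  have E_nonneg: "0 \<le> r" if "r \<in> E" for r
    using that rest_bfun Q_nonneg by (auto simp: E_def extension_def)
  have bdd_E: "bdd_below E"
    using E_nonneg by (rule bdd_belowI)
  have "extension \<phi> (\<lambda>i. i) \<phi>" "admissible \<phi> []"
    using \<phi> by (auto simp: extension_def admissible_def)
  then have E_ne: "E \<noteq> {}" unfolding E_def by blast
  obtain K where K: "0 < K" "\<And>\<theta> i x. x \<in> space M \<Longrightarrow> \<bar>tprod fs \<theta> i x\<bar> \<le> K"
    using tprod_bound[OF fs] by metis
  \<comment> \<open>Two uses of \<open>avg_T_norm_le\<close> bound \<open>Q\<close> of the dual
    function by K^4 times \<open>Q\<close> of the remainder, which is below Inf E + 1 because \<eta>
    \<le> 1.\<close>
  define c where "c = (K\<^sup>2 * K\<^sup>2) * (Inf E + 1)"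
  have "0 \<le> Inf E" using E_nonneg by (rule cInf_greatest[OF E_ne])
  then have c: "0 < c" using K(1) by (simp add: c_def)
  \<comment> \<open>Subtracting t times the dual function lowers \<open>Q\<close> by at least 2 t
    \<epsilon> - t^2 c, with maximum \<epsilon>^2 / c at t = \<epsilon> / c. As 2 \<eta> is at most
    this gain, a value below Inf E + \<eta> drops to at most Inf E - \<eta>.\<close>
  define \<eta> where "\<eta> = min 1 (\<epsilon>\<^sup>2 / (2 * c))"
  have \<eta>: "0 < \<eta>" "\<eta> \<le> 1" "\<eta> \<le> \<epsilon>\<^sup>2 / (2 * c)" using \<epsilon> c by (auto simp: \<eta>_def)
  obtain r where r: "r \<in> E" "r < Inf E + \<eta>"
    using cInf_lessD[OF E_ne, of "Inf E + \<eta>"] \<eta> by auto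
  then obtain \<pi> \<psi> vs where ext: "extension \<phi> \<pi> \<psi>" and adm: "admissible \<psi> vs"
    and Qr: "Q \<psi> (rest \<pi> vs) < Inf E + \<eta>"
    unfolding E_def by blast
  have \<psi>: "mean \<psi>" using ext by (simp add: extension_def)
  define w where "w = rest \<pi> vs"
  define g' where "g' = pull \<pi> g"
  define fs' where "fs' = relabel (pull \<pi>) \<pi> fs"
  have w: "bfun w" unfolding w_def by (rule rest_bfun[OF adm])
  have fs': "bfuns fs'" unfolding fs'_def by (rule bfuns_relabel[OF fs])
  have K': "\<bar>tprod fs' \<theta> i x\<bar> \<le> K" if "x \<in> space M" for \<theta> i x
    unfolding fs'_def tprod_relabel by (rule K(2)[OF that])
  have "\<exists>J. \<forall>j\<ge>J. Q \<psi> (Av ((g', w) # fs') j) \<le> \<epsilon>"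
  proof (rule ccontr)
    assume "\<not> ?thesis"
    then have "\<forall>k. \<exists>j\<ge>k. \<epsilon> < Q \<psi> (Av ((g', w) # fs') j)" by (simp add: not_le)
    then obtain js where js: "\<And>k. k \<le> js k" "\<And>k. \<epsilon> < Q \<psi> (Av ((g', w) # fs') (js k))"
      by metis
    \<comment> \<open>L acts on the new coordinate k. It agrees with limits and thus ignores
      finitely many k, which makes the indices \<open>js k\<close> infinite.\<close>
    obtain L where L: "mean L" "\<And>h l. bdd h \<Longrightarrow> h \<longlonglongrightarrow> l \<Longrightarrow> L h = l"
      using banach_limit_exists by metis
    define \<rho> where "\<rho> = (\<lambda>i. fst (prod_decode i))"
    define \<kappa> where "\<kappa> = (\<lambda>i. snd (prod_decode i))"
    define e where "e = (\<lambda>i (k::nat). prod_encode (i, k))"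
    have e: "\<rho> (e i k) = i" "\<kappa> (e i k) = k" for i k
      by (simp_all add: e_def \<rho>_def \<kappa>_def)
    define \<xi> where "\<xi> = (\<lambda>h. L (\<lambda>k. \<psi> (\<lambda>i. h (e i k))))"
    have \<xi>: "mean \<xi>" unfolding \<xi>_def by (rule mean_limit[OF L(1) \<psi>])
    have \<xi>_\<rho>: "\<xi> (\<lambda>i. h (\<rho> i)) = \<psi> h" for h
      by (simp add: \<xi>_def e mean_const[OF L(1)])
    have ext2: "extension \<phi> (\<pi> \<circ> \<rho>) \<xi>"
      using ext \<xi> \<xi>_\<rho>[of "\<lambda>i. h (\<pi> i)" for h] by (simp add: extension_def)
    define t where "t = \<epsilon> / c"
    define u where "u = (\<lambda>k. Av ((g', w) # fs') (js k))"
    \<comment> \<open>The factor t is put into b since an admissible list carries no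
      coefficients.\<close>
    define b where "b = (\<lambda>i x. t * u (\<kappa> i) (\<rho> i) x)"
    define N where "N = (\<lambda>i. js (\<kappa> i))"
    define vs2 where "vs2 = (N, b) # map (\<lambda>(N, b). (\<lambda>i. N (\<rho> i), \<lambda>i. b (\<rho> i))) vs"
    define D where "D = (\<lambda>k. dual g' fs' (\<lambda>_. js k) (u k))"
    have u: "bfun (u k)" for k unfolding u_def using w fs' by (intro bfun_Av) simp
    have D: "bfun (D k)" for k unfolding D_def by (rule bfun_dual[OF fs' u])
    obtain C where C: "0 < C" "\<And>i x. x \<in> space M \<Longrightarrow> \<bar>w i x\<bar> \<le> C"
      using bfunE[OF w] by metis
    have u_bound: "\<bar>u k i x\<bar> \<le> C * K" if x: "x \<in> space M" for k i x
      unfolding u_def Av_def tprod_Cons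
    proof (rule avg_abs_le[OF B_finite B_nonempty])
      show "\<bar>w i (T (g' n i) x) * tprod fs' (\<lambda>h. h n i) i x\<bar> \<le> C * K" for n
        unfolding abs_mult using C(1) by (intro mult_mono C(2) K' T_space x) auto
    qed
    have "bfun (\<lambda>i x. u (\<kappa> i) (\<rho> i) x)"
      by (rule bfunI[OF bfun_measurable[OF u] u_bound])
    then have b: "bfun b" unfolding b_def by (rule bfun_cmult)
    have N: "infinite_index \<xi> N"
      unfolding infinite_index_def
    proof
      fix l
      have "(\<lambda>k. if js k \<le> l then 1 else 0 :: real) \<longlonglongrightarrow> 0"
      proof (rule tendsto_eventually)
        show "\<forall>\<^sub>F k in sequentially. (if js k \<le> l then 1 else 0 :: real) = 0"
          using eventually_gt_at_top[of l]
        proof eventually_elim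
          case (elim k)
          then show ?case using js(1)[of k] by simp
        qed
      qed
      then have "L (\<lambda>k. if js k \<le> l then 1 else 0) = 0"
        by (intro L(2) bddI[of _ 1]) auto
      then show "\<xi> (\<lambda>i. if N i \<le> l then 1 else 0) = 0"
        by (simp add: \<xi>_def N_def e mean_const[OF \<psi>])
    qed
    have "infinite_index \<xi> (\<lambda>i. N (\<rho> i)) \<and> bfun (\<lambda>i. b (\<rho> i))" if "(N, b) \<in> set vs" for N b
      using adm that \<xi>_\<rho>[of "\<lambda>i. if N i \<le> l then 1 else 0" for l] bfun_comp[of b \<rho>]
      by (auto simp: admissible_def infinite_index_def)
    with N b have adm2: "admissible \<xi> vs2"
      by (auto simp: admissible_def vs2_def)
    have pull2: "pull (\<pi> \<circ> \<rho>) g = pull \<rho> g'" "relabel (pull (\<pi> \<circ> \<rho>)) (\<pi> \<circ> \<rho>) fs = relabel (pull \<rho>) \<rho> fs'"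
      by (simp_all add: g'_def fs'_def relabel_def pull_pull split_beta comp_def)
    have old: "dsum (pull \<rho> g') (relabel (pull \<rho>) \<rho> fs') (map (\<lambda>(N, b). (\<lambda>i. N (\<rho> i), \<lambda>i. b (\<rho> i))) vs) i x
        = dsum g' fs' vs (\<rho> i) x" for i x
      by (simp add: dsum_def case_prod_unfold comp_def dual_relabel_pull)
    have new: "dual (pull \<rho> g') (relabel (pull \<rho>) \<rho> fs') N b i x = t * D (\<kappa> i) (\<rho> i) x" for i x
      by (simp add: D_def dual_def tprod_relabel pull_def N_def b_def avg_cmult[symmetric] mult.assoc)
    have rest2: "rest (\<pi> \<circ> \<rho>) vs2 i x = w (\<rho> i) x - t * D (\<kappa> i) (\<rho> i) x" for i x
    proof -
      have "dsum (pull \<rho> g') (relabel (pull \<rho>) \<rho> fs') vs2 i x =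
          t * D (\<kappa> i) (\<rho> i) x + dsum g' fs' vs (\<rho> i) x"
        unfolding old[symmetric] new[symmetric] by (simp add: dsum_def vs2_def)
      then show ?thesis
        unfolding rest_def pull2 w_def by (simp add: g'_def fs'_def)
    qed
    have lower: "Inf E \<le> Q \<xi> (rest (\<pi> \<circ> \<rho>) vs2)"
      using ext2 adm2 by (intro cInf_lower bdd_E) (auto simp: E_def)
    have Qk: "Q \<psi> (\<lambda>i x. w i x - t * D k i x) \<le> Inf E - \<eta>" for k
    proof -
      have ip: "\<psi> (\<lambda>i. \<integral>x. w i x * D k i x \<partial>M) = Q \<psi> (u k)"
        unfolding D_def integral_mult_dual[OF fs' w u] by (simp add: Q_def u_def power2_eq_square)
      have "Q \<psi> (D k) \<le> K\<^sup>2 * Q \<psi> (u k)"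
        unfolding D_def
        by (intro Q_mono[OF \<psi> bfun_dual[OF fs' u] u], unfold dual_def)
          (rule avg_T_norm_le[OF fs' u K' B_finite B_nonempty])
      also have "Q \<psi> (u k) \<le> K\<^sup>2 * Q \<psi> w"
        by (intro Q_mono[OF \<psi> u w], unfold u_def Av_def tprod_Cons)
          (rule avg_T_norm_le[OF fs' w K' B_finite B_nonempty])
      also have "Q \<psi> w \<le> Inf E + 1"
        using Qr \<eta> by (simp add: w_def)
      finally have QD: "Q \<psi> (D k) \<le> c"
        by (simp add: c_def mult_left_mono mult.assoc)
      have t: "0 < t" using \<epsilon> c by (simp add: t_def)
      have "Q \<psi> (\<lambda>i x. w i x - t * D k i x) = Q \<psi> w - 2 * t * Q \<psi> (u k) + t\<^sup>2 * Q \<psi> (D k)"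
        unfolding Q_diff_cmult[OF \<psi> w D] ip ..
      also have "\<dots> \<le> (Inf E + \<eta>) - 2 * t * \<epsilon> + t\<^sup>2 * c"
        using Qr QD js(2)[of k] t
        by (intro add_mono diff_mono mult_left_mono) (auto simp: w_def u_def)
      also have "\<dots> = Inf E + \<eta> - \<epsilon>\<^sup>2 / c"
        using c by (simp add: t_def power2_eq_square field_simps)
      also have "\<dots> \<le> Inf E - \<eta>"
        using \<eta>(3) c by (simp add: field_simps)
      finally show ?thesis .
    qed
    have "Q \<xi> (rest (\<pi> \<circ> \<rho>) vs2) = L (\<lambda>k. Q \<psi> (\<lambda>i x. w i x - t * D k i x))"
      by (simp add: Q_def \<xi>_def rest2 e)
    also have "\<dots> \<le> L (\<lambda>_. Inf E - \<eta>)"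
    proof (rule mean_mono[OF L(1) _ bdd_const Qk])
      have "0 \<le> Q \<psi> (\<lambda>i x. w i x - t * D k i x)" for k
        by (intro Q_nonneg[OF \<psi>] bfun_diff w bfun_cmult D)
      with Qk show "bdd (\<lambda>k. Q \<psi> (\<lambda>i x. w i x - t * D k i x))"
        by (intro bddI[of _ "Inf E - \<eta>"]) simp
    qed
    finally show False
      using lower \<eta>(1) mean_const[OF L(1)] by simp
  qed
  then show ?thesis
    using that ext adm unfolding w_def rest_def g'_def fs'_def by blast
qed


section \<open>Convergence by induction over good families\<close>

lemma reduct_pull: "reduct \<rho> m (pull \<pi> g) (pull \<pi> ` S) = reduct (\<pi> \<circ> \<rho>) m g S"
  by (simp add: reduct_def image_image pull_pull)

lemma Av_Cons_add:
  "Av ((g, \<lambda>i x. F i x + G i x) # fs) j i x = Av ((g, F) # fs) j i x + Av ((g, G) # fs) j i x"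
  by (simp add: Av_def distrib_right avg_add)

lemma qcauchy_Av_dsum:
  assumes "mean \<phi>" "admissible \<phi> vs" "bfuns fs" "fst ` set fs \<subseteq> S" "(\<lambda>n i. 0) \<in> S"
    and conv: "\<And>\<pi> m. Conv (reduct \<pi> m g S)"
  shows "qcauchy \<phi> (Av ((g, dsum g fs vs) # fs))"
  using assms(2)
proof (induction vs)
  case Nil
  have "qcauchy \<phi> (\<lambda>j i x. 0)"
    using mean_const[OF assms(1), of 0] by (auto simp: qcauchy_def Q_def intro!: exI[of _ 0])
  then show ?case
    by (rule qcauchy_cong[rotated]) (simp add: Av_def dsum_def avg_def)
next
  case (Cons v vs)
  obtain N b where v: "v = (N, b)" by (cases v)
  have N: "infinite_index \<phi> N" "bfun b" and vs: "admissible \<phi> vs"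
    using Cons.prems by (auto simp: admissible_def v)
  have "qcauchy \<phi> (\<lambda>j i x. Av ((g, dual g fs N b) # fs) j i x + Av ((g, dsum g fs vs) # fs) j i x)"
    using bfun_dual[OF assms(3) N(2)] bfun_dsum[OF assms(3) vs] assms(3)
    by (intro qcauchy_add[OF assms(1) bfun_Av bfun_Av] Cons.IH[OF vs]
        qcauchy_Av_dual[OF assms(1) N(1) assms(3) N(2) assms(4,5) conv]) simp_all
  moreover have "dsum g fs (v # vs) = (\<lambda>i x. dual g fs N b i x + dsum g fs vs i x)"
    by (simp add: dsum_def v fun_eq_iff)
  ultimately show ?case
    by (simp add: Av_Cons_add[abs_def])
qed

lemma extension_Q:
  assumes "extension \<phi> \<pi> \<psi>" "bfun F" shows "Q \<psi> (\<lambda>i. F (\<pi> i)) = Q \<phi> F"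
  unfolding Q_def
  by (rule assms(1)[unfolded extension_def, THEN conjunct2, rule_format,
      OF bdd_integral[OF bfun_power2[OF assms(2)]]])

text \<open>The enlarged parameter space depends on \<epsilon>, but the averages in question are
  pulled back from the old one, where the two seminorms agree. On the extension they split into a
  small part from the remainder and a Cauchy part from the dual functions.\<close>

lemma qcauchy_Av_Cons:
  assumes \<phi>: "mean \<phi>" and fs: "bfuns fs" and f: "bfun f"
    and S: "fst ` set fs \<subseteq> S" "(\<lambda>n i. 0) \<in> S"
    and conv: "\<And>\<pi> m. Conv (reduct \<pi> m g S)"
  shows "qcauchy \<phi> (Av ((g, f) # fs))"
  unfolding qcauchy_def
proof (intro allI impI)
  fix \<epsilon> :: real assume "0 < \<epsilon>"
  \<comment> \<open>The remainder contributes at most 2 \<epsilon>/16 + 2 \<epsilon>/16 =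
    \<epsilon>/4 to a difference and the dual part at most \<epsilon>/4; \<open>Q_add_le\<close>
    doubles both.\<close>
  then have \<epsilon>: "0 < \<epsilon> / 16" by simp
  obtain \<pi> \<psi> vs J where ext: "extension \<phi> \<pi> \<psi>" and adm: "admissible \<psi> vs"
    and J: "\<And>j. j \<ge> J \<Longrightarrow> Q \<psi> (Av ((pull \<pi> g,
        \<lambda>i x. f (\<pi> i) x - dsum (pull \<pi> g) (relabel (pull \<pi>) \<pi> fs) vs i x) #
        relabel (pull \<pi>) \<pi> fs) j) \<le> \<epsilon> / 16"
    by (rule structure_decomposition[OF \<phi> fs f \<epsilon>, where g=g]) (rule that)
  define g' where "g' = pull \<pi> g"
  define fs' where "fs' = relabel (pull \<pi>) \<pi> fs"
  define v where "v = dsum g' fs' vs"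
  define w where "w = (\<lambda>i x. f (\<pi> i) x - v i x)"
  have \<psi>: "mean \<psi>" using ext by (simp add: extension_def)
  have fs': "bfuns fs'" unfolding fs'_def by (rule bfuns_relabel[OF fs])
  have v: "bfun v" unfolding v_def by (rule bfun_dsum[OF fs' adm])
  have w: "bfun w" unfolding w_def by (intro bfun_diff bfun_comp[OF f] v)
  have v_cauchy: "qcauchy \<psi> (Av ((g', v) # fs'))"
    unfolding v_def
  proof (rule qcauchy_Av_dsum[OF \<psi> adm fs'])
    show "fst ` set fs' \<subseteq> pull \<pi> ` S"
      using S(1) by (auto simp: fs'_def fst_relabel)
    show "(\<lambda>n i. 0) \<in> pull \<pi> ` S"
      using S(2) pull_zero[of \<pi>] by force
    show "Conv (reduct \<rho> m g' (pull \<pi> ` S))" for \<rho> m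
      unfolding g'_def reduct_pull by (rule conv)
  qed
  have "0 < \<epsilon> / 4" using \<open>0 < \<epsilon>\<close> by simp
  then obtain I where I: "\<And>i j. i \<ge> I \<Longrightarrow> j \<ge> I \<Longrightarrow>
      Q \<psi> (\<lambda>\<iota> x. Av ((g', v) # fs') i \<iota> x - Av ((g', v) # fs') j \<iota> x) \<le> \<epsilon> / 4"
    by (rule qcauchyD[OF v_cauchy]) (rule that)
  have "Q \<phi> (\<lambda>\<iota> x. Av ((g, f) # fs) i \<iota> x - Av ((g, f) # fs) j \<iota> x) \<le> \<epsilon>"
    if ij: "i \<ge> max I J" "j \<ge> max I J" for i j
  proof -
    have b: "bfun (Av ((g, f) # fs) j)" "bfun (Av ((g', v) # fs') j)" "bfun (Av ((g', w) # fs') j)" for j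
      using f fs v w fs' by (auto intro!: bfun_Av)
    have eq: "Av ((g, f) # fs) j (\<pi> i) x = Av ((g', w) # fs') j i x + Av ((g', v) # fs') j i x" for i j x
    proof -
      have "Av ((g, f) # fs) j (\<pi> i) x = Av (relabel (pull \<pi>) \<pi> ((g, f) # fs)) j i x"
        by (simp only: Av_relabel_pull)
      also have "relabel (pull \<pi>) \<pi> ((g, f) # fs) = (g', \<lambda>i x. w i x + v i x) # fs'"
        by (simp add: relabel_def g'_def fs'_def w_def)
      finally show ?thesis by (simp only: Av_Cons_add)
    qed
    have "Q \<phi> (\<lambda>\<iota> x. Av ((g, f) # fs) i \<iota> x - Av ((g, f) # fs) j \<iota> x) =
        Q \<psi> (\<lambda>\<iota> x. (Av ((g', w) # fs') i \<iota> x - Av ((g', w) # fs') j \<iota> x) +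
          (Av ((g', v) # fs') i \<iota> x - Av ((g', v) # fs') j \<iota> x))"
      using extension_Q[OF ext bfun_diff[OF b(1,1)], of i j] by (simp add: eq algebra_simps)
    also have "\<dots> \<le> 2 * Q \<psi> (\<lambda>\<iota> x. Av ((g', w) # fs') i \<iota> x - Av ((g', w) # fs') j \<iota> x) +
        2 * Q \<psi> (\<lambda>\<iota> x. Av ((g', v) # fs') i \<iota> x - Av ((g', v) # fs') j \<iota> x)"
      by (intro Q_add_le[OF \<psi>] bfun_diff b)
    also have "Q \<psi> (\<lambda>\<iota> x. Av ((g', w) # fs') i \<iota> x - Av ((g', w) # fs') j \<iota> x) \<le> 2 * (\<epsilon> / 16) + 2 * (\<epsilon> / 16)"
      using Q_diff_le[OF \<psi> b(3,3), of i j] J[of i] J[of j] ij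
      unfolding g'_def[symmetric] fs'_def[symmetric] v_def[symmetric] w_def[symmetric] by simp
    also have "Q \<psi> (\<lambda>\<iota> x. Av ((g', v) # fs') i \<iota> x - Av ((g', v) # fs') j \<iota> x) \<le> \<epsilon> / 4"
      using I ij by simp
    finally show ?thesis by simp
  qed
  then show "\<exists>J. \<forall>i\<ge>J. \<forall>j\<ge>J. Q \<phi> (\<lambda>\<iota> x. Av ((g, f) # fs) i \<iota> x - Av ((g, f) # fs) j \<iota> x) \<le> \<epsilon>"
    by blast
qed

lemma Conv_insert:
  assumes "(\<lambda>n i. 0) \<in> S" "\<And>\<pi> m. Conv (reduct \<pi> m g S)"
  shows "Conv (insert g S)"
  unfolding Conv_def
proof (intro allI impI)
  fix \<phi> fs assume \<phi>: "mean \<phi>" and fs: "bfuns fs" "fst ` set fs \<subseteq> insert g S"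
  \<comment> \<open>The exponent g may occur several times in \<open>fs\<close>. All its factors are
    merged into one function, so that it is eliminated at once.\<close>
  define f' where "f' = (\<lambda>i x. \<Prod>(h, c)\<leftarrow>filter (\<lambda>p. fst p = g) fs. c i x)"
  have "tprod fs \<theta> i x = f' i (T (\<theta> g) x) * tprod (filter (\<lambda>p. fst p \<noteq> g) fs) \<theta> i x" for \<theta> i x
    unfolding f'_def by (induction fs) (auto simp: tprod_def)
  then have eq: "Av fs j i x = Av ((g, f') # filter (\<lambda>p. fst p \<noteq> g) fs) j i x" for j i x
    by (simp add: Av_def)
  have "bfun f'"
    unfolding f'_def using fs(1)
    by (induction fs) (auto simp: bfun_const bfun_mult)
  moreover have "bfuns (filter (\<lambda>p. fst p \<noteq> g) fs)"
    using fs(1) by (auto simp: bfuns_def)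
  moreover have "fst ` set (filter (\<lambda>p. fst p \<noteq> g) fs) \<subseteq> S"
    using fs(2) by auto
  ultimately have "qcauchy \<phi> (Av ((g, f') # filter (\<lambda>p. fst p \<noteq> g) fs))"
    using qcauchy_Av_Cons[OF \<phi> _ _ _ assms] by blast
  then show "qcauchy \<phi> (Av fs)"
    by (rule qcauchy_cong[rotated]) (rule eq[symmetric])
qed

lemma Conv_zero: "Conv {\<lambda>n i. 0}"
  unfolding Conv_def
proof (intro allI impI)
  fix \<phi> fs assume \<phi>: "mean \<phi>" and fs: "bfuns fs" "fst ` set fs \<subseteq> {(\<lambda>n i. 0) :: 'g pfam}"
  have "tprod fs (\<lambda>h. h n i) i x = tprod fs (\<lambda>_. 0) i x" for n i x
    using fs(2) unfolding tprod_def by (intro arg_cong[where f=prod_list] map_cong) auto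
  then have "Av fs j i x = tprod fs (\<lambda>_. 0) i x" for j i x
    by (simp add: Av_def avg_const B_finite B_nonempty)
  then show "qcauchy \<phi> (Av fs)"
    using mean_const[OF \<phi>, of 0] by (simp add: qcauchy_def Q_def)
qed

theorem Conv_good: "good S \<Longrightarrow> Conv S"
  by (induction rule: good.induct) (auto intro: Conv_zero Conv_insert)

text \<open>Evaluation at the parameter 0 is a mean, and for it \<open>Q\<close> is the ordinary
  squared L2 norm. The exponent 0 is added to the family because every \<open>good\<close> family
  contains it.\<close>

theorem polynomial_averages_cauchy:
  fixes p :: "nat \<Rightarrow> 'g \<Rightarrow> real"
  assumes "finite K" "\<And>k. k \<in> K \<Longrightarrow> p k \<in> polys r"
    and "\<And>k. k \<in> K \<Longrightarrow> f k \<in> borel_measurable M"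
    and "\<And>k x. k \<in> K \<Longrightarrow> x \<in> space M \<Longrightarrow> \<bar>f k x\<bar> \<le> C"
    and "0 < \<epsilon>"
  shows "\<exists>J. \<forall>i\<ge>J. \<forall>j\<ge>J. (\<integral>x. (avg (B i) (\<lambda>n. \<Prod>k\<in>K. f k (T (p k n) x)) -
      avg (B j) (\<lambda>n. \<Prod>k\<in>K. f k (T (p k n) x)))\<^sup>2 \<partial>M) \<le> \<epsilon>"
proof -
  obtain ks where ks: "set ks = K" "distinct ks"
    using finite_distinct_list[OF assms(1)] by blast
  define fs :: "('g pfam \<times> (nat \<Rightarrow> 'a \<Rightarrow> real)) list" where
    "fs = map (\<lambda>k. (\<lambda>n _. p k n, \<lambda>_. f k)) ks"
  have fs: "bfuns fs"
    unfolding bfuns_def bfun_def using assms(3,4) by (fastforce simp: fs_def ks)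
  let ?S = "insert (\<lambda>n i. 0) (fst ` set fs)"
  have "good ?S"
    using assms(1,2) by (intro good_ppolys[of _ r]) (auto simp: fs_def ppolys_def ks)
  then have "Conv ?S" by (rule Conv_good)
  moreover have "mean (\<lambda>h. h 0)" by (simp add: mean_def)
  ultimately have "qcauchy (\<lambda>h. h 0) (Av fs)"
    using fs unfolding Conv_def by blast
  moreover have "Av fs j 0 x = avg (B j) (\<lambda>n. \<Prod>k\<in>K. f k (T (p k n) x))" for j x
    by (simp add: Av_def tprod_def fs_def comp_def ks(1)[symmetric] prod.distinct_set_conv_list[OF ks(2)])
  ultimately show ?thesis
    using assms(5) by (simp add: qcauchy_def Q_def)
qed

end

section \<open>Polynomials on Euclidean space\<close>

definition of_nat_vec :: "nat ^ 'd \<Rightarrow> real ^ 'd" where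
  "of_nat_vec n = (\<chi> i. real (n $ i))"

lemma of_nat_vec_add: "of_nat_vec (n + m) = of_nat_vec n + of_nat_vec m"
  by (simp add: of_nat_vec_def vec_eq_iff)

text \<open>A linear function has constant differences, hence the bound 2; the rest is closure of
  \<open>polys\<close>. The base point u is a real vector, so the restriction is to a translated
  lattice.\<close>

lemma real_polynomial_polys:
  fixes p :: "real ^ 'd \<Rightarrow> real"
  assumes "real_polynomial_function p"
  shows "\<exists>r. \<forall>u. (\<lambda>n :: nat ^ 'd. p (u + of_nat_vec n)) \<in> polys r"
  using assms
proof induction
  case (linear f)
  then interpret bounded_linear f .
  have "(\<lambda>n. f (u + of_nat_vec (n + m)) - f (u + of_nat_vec n)) \<in> polys 1" for u and m :: "nat ^ 'd"
    using polys_const[of "f (of_nat_vec m)" 0] by (simp add: of_nat_vec_add add)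
  then show ?case
    by (intro exI[of _ 2] allI) (simp add: numeral_2_eq_2 polys_SucI)
next
  case (const c)
  show ?case by (intro exI[of _ 1] allI) (simp add: polys_const)
next
  case (add f g)
  then obtain r s where rs: "\<And>u. (\<lambda>n :: nat ^ 'd. f (u + of_nat_vec n)) \<in> polys r"
      "\<And>u. (\<lambda>n :: nat ^ 'd. g (u + of_nat_vec n)) \<in> polys s"
    by auto
  have "(\<lambda>n. f (u + of_nat_vec n) + g (u + of_nat_vec n)) \<in> polys (max r s)" for u :: "real ^ 'd"
    by (intro polys_add polys_mono[OF rs(1)] polys_mono[OF rs(2)]) auto
  then show ?case by blast
next
  case (mult f g)
  then obtain r s where rs: "\<And>u. (\<lambda>n :: nat ^ 'd. f (u + of_nat_vec n)) \<in> polys r"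
      "\<And>u. (\<lambda>n :: nat ^ 'd. g (u + of_nat_vec n)) \<in> polys s"
    by auto
  have "(\<lambda>n. f (u + of_nat_vec n) * g (u + of_nat_vec n)) \<in> polys (r + s)" for u :: "real ^ 'd"
    by (intro polys_mult rs)
  then show ?case by blast
qed

section \<open>Polynomials and null sets\<close>

lemma real_polynomial_function_on_line:
  assumes "real_polynomial_function p"
  shows "\<exists>P. \<forall>t. p (a + t *\<^sub>R v) = poly P t"
  using assms
proof induction
  case (linear f)
  then interpret bounded_linear f .
  show ?case
    by (intro exI[of _ "[:f a, f v:]"]) (simp add: add scaleR)
next
  case (const c)
  show ?case by (intro exI[of _ "[:c:]"]) simp
next
  case (add f g)
  then show ?case by (metis poly_add)
next
  case (mult f g)
  then show ?case by (metis poly_mult)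
qed

lemma real_polynomial_function_borel:
  fixes p :: "'a::euclidean_space \<Rightarrow> real"
  assumes "real_polynomial_function p" shows "p \<in> borel_measurable borel"
  using continuous_real_polymonial_function[OF assms]
  by (intro borel_measurable_continuous_onI) (simp add: continuous_on_eq_continuous_within)

text \<open>Instead of polar coordinates: the affine map \<open>s \<mapsto> a + t (s - a)\<close> preserves null sets for
  every fixed \<open>t \<noteq> 0\<close>, so one may integrate over \<open>t\<close> first.\<close>

lemma AE_not_in_rays:
  fixes Z :: "'a::euclidean_space set"
  assumes [measurable]: "Z \<in> sets borel"
    and ray: "AE s in lborel. AE t in lborel. a + t *\<^sub>R (s - a) \<notin> Z"
  shows "AE s in lborel. s \<notin> Z"
proof -
  have "AE t in (lborel :: real measure). AE s in lborel. a + t *\<^sub>R (s - a) \<notin> Z"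
    using ray by (subst lborel_pair.AE_commute) measurable
  then have "AE t in (lborel :: real measure). t \<noteq> 0 \<and> (AE s in lborel. a + t *\<^sub>R (s - a) \<notin> Z)"
    using AE_lborel_singleton[of "0::real"] by eventually_elim auto
  then have "\<exists>t. t \<noteq> 0 \<and> (AE s in lborel. a + t *\<^sub>R (s - a) \<notin> Z)"
    using eventually_happens[of _ "ae_filter (lborel :: real measure)"] by (simp add: trivial_limit_def[symmetric] ae_filter_eq_bot_iff)
  then obtain t where t: "t \<noteq> 0" and Z: "AE s in lborel. a + t *\<^sub>R (s - a) \<notin> Z"
    by blast
  have "AE s in lborel. (a - t *\<^sub>R a) + t *\<^sub>R s \<notin> Z"
    using Z by (simp add: algebra_simps)
  then show ?thesis
    by (subst lborel_affine[OF t, of "a - t *\<^sub>R a"]) (simp add: AE_density AE_distr_iff)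
qed

text \<open>Off the finitely many zeros of its derivative, P is differentiable with injective
  derivative, and such maps pull null sets back to null sets.\<close>

lemma AE_poly_not_in_null:
  assumes "pderiv P \<noteq> 0" and N: "N \<in> null_sets (lborel :: real measure)"
  shows "AE t in lborel. poly P t \<notin> N"
proof -
  let ?S = "{t. poly (pderiv P) t \<noteq> 0}"
  have "negligible {t \<in> ?S. poly P t \<in> N}"
  proof (rule negligible_differentiable_vimage)
    show "negligible N"
      using N by (simp add: negligible_iff_null_sets null_sets_completionI)
    show "inj ((*) (poly (pderiv P) t))" if "t \<in> ?S" for t
      using that by (auto intro: injI)
    show "(poly P has_derivative (*) (poly (pderiv P) t)) (at t within ?S)" for t
      using poly_DERIV[of P t] unfolding has_field_derivative_def
      by (rule has_derivative_at_withinI)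
  qed
  moreover have "negligible {t. poly (pderiv P) t = 0}"
    using poly_roots_finite[OF assms(1)] by (rule negligible_finite)
  ultimately have "negligible ({t \<in> ?S. poly P t \<in> N} \<union> {t. poly (pderiv P) t = 0})"
    by (rule negligible_Un)
  then have "negligible {t. poly P t \<in> N}"
    by (rule negligible_subset) auto
  moreover have "{t. poly P t \<in> N} = poly P -` N \<inter> space lborel" by auto
  moreover have "poly P -` N \<inter> space lborel \<in> sets lborel"
    using N by (intro measurable_sets[of _ _ borel])
      (auto intro!: borel_measurable_continuous_onI continuous_on_poly)
  ultimately have "{t. poly P t \<in> N} \<in> null_sets lborel"
    by (simp add: negligible_iff_null_sets null_sets_completion_iff)
  then show ?thesis by (auto dest: AE_not_in)
qed

text \<open>On every line through a the restriction is a nonzero polynomial in t, as its value at t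
  = 0 is p(a), and so it has finitely many zeros.\<close>

lemma AE_polynomial_not_zero:
  fixes p :: "'a::euclidean_space \<Rightarrow> real"
  assumes p: "real_polynomial_function p" and a: "p a \<noteq> 0"
  shows "AE s in lborel. p s \<noteq> 0"
proof -
  have [measurable]: "p \<in> borel_measurable borel" using p by (rule real_polynomial_function_borel)
  have "AE t in lborel. p (a + t *\<^sub>R (s - a)) \<noteq> 0" for s
  proof -
    obtain P where P: "\<And>t. p (a + t *\<^sub>R (s - a)) = poly P t"
      using real_polynomial_function_on_line[OF p] by metis
    have "P \<noteq> 0" using P[of 0] a by auto
    then have "finite {t. poly P t = 0}" by (rule poly_roots_finite)
    then have "{t. poly P t = 0} \<in> null_sets lborel"
      by (rule finite_imp_null_set_lborel)
    then show ?thesis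
      unfolding P by (auto dest: AE_not_in)
  qed
  then show ?thesis
    using AE_not_in_rays[of "{s. p s = 0}" a] by simp
qed

text \<open>For almost every s the restriction to the line through a and s differs at t = 0 and t =
  1, hence is nonconstant, and the case of one variable applies. This is what carries a null set of
  exceptional flow times back to a null set of s.\<close>

lemma AE_polynomial_not_in_null:
  fixes p :: "'a::euclidean_space \<Rightarrow> real"
  assumes p: "real_polynomial_function p" and ab: "p a \<noteq> p b"
    and N: "N \<in> null_sets lborel"
  shows "AE s in lborel. p s \<notin> N"
proof -
  have pm [measurable]: "p \<in> borel_measurable borel" using p by (rule real_polynomial_function_borel)
  have Nm [measurable]: "N \<in> sets borel" using N by auto
  have "real_polynomial_function (\<lambda>s. p s + (- p a))"
    by (intro real_polynomial_function.intros p)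
  then have "AE s in lborel. p s + (- p a) \<noteq> 0"
    using ab by (intro AE_polynomial_not_zero[of _ b]) auto
  then have "AE s in lborel. AE t in lborel. a + t *\<^sub>R (s - a) \<notin> {s. p s \<in> N}"
  proof eventually_elim
    case (elim s)
    obtain P where P: "\<And>t. p (a + t *\<^sub>R (s - a)) = poly P t"
      using real_polynomial_function_on_line[OF p] by metis
    have "pderiv P \<noteq> 0"
    proof
      assume "pderiv P = 0"
      then obtain c where "P = [:c:]" by (auto simp: pderiv_eq_0_iff elim: degree_eq_zeroE)
      then show False using P[of 0] P[of 1] elim by simp
    qed
    then show ?case
      using AE_poly_not_in_null[OF _ N] by (simp add: P)
  qed
  then show ?thesis
    using AE_not_in_rays[of "{s. p s \<in> N}" a] by simp
qed

section \<open>Boxes\<close>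

definition nat_box :: "nat ^ 'd \<Rightarrow> (nat ^ 'd) set" where
  "nat_box N = {n. \<forall>i. n $ i < N $ i}"

lemma card_nat_box: "card (nat_box N) = (\<Prod>i\<in>UNIV. N $ i)" and finite_nat_box: "finite (nat_box N)"
proof -
  have "bij_betw vec_lambda (PiE UNIV (\<lambda>i. {..<N $ i})) (nat_box N)"
    by (rule bij_betwI[where g=vec_nth]) (auto simp: nat_box_def)
  then show "card (nat_box N) = (\<Prod>i\<in>UNIV. N $ i)" "finite (nat_box N)"
    using bij_betw_same_card bij_betw_finite by (force simp: card_PiE finite_PiE)+
qed

lemma nat_box_nonempty: "(\<And>i. 0 < N $ i) \<Longrightarrow> nat_box N \<noteq> {}"
  by (rule ex_in_conv[THEN iffD1], rule exI[of _ 0]) (simp add: nat_box_def)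

lemma card_slab_le:
  fixes N l :: "nat ^ 'd"
  assumes "\<And>i. 0 < N $ i"
  shows "real (card {n \<in> nat_box N. n $ i < l $ i}) \<le> real (l $ i) / real (N $ i) * real (card (nat_box N))"
proof -
  let ?N = "\<chi> k. if k = i then l $ i else N $ k"
  have "card {n \<in> nat_box N. n $ i < l $ i} \<le> card (nat_box ?N)"
    by (rule card_mono[OF finite_nat_box]) (auto simp: nat_box_def)
  also have "\<dots> = l $ i * (\<Prod>k\<in>UNIV - {i}. N $ k)"
    unfolding card_nat_box by (subst prod.remove[of _ i]) (auto intro!: prod.cong)
  finally have "real (card {n \<in> nat_box N. n $ i < l $ i}) \<le> real (l $ i) * real (\<Prod>k\<in>UNIV - {i}. N $ k)"
    unfolding of_nat_mult[symmetric] of_nat_le_iff .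
  also have "\<dots> = real (l $ i) / real (N $ i) * real (N $ i * (\<Prod>k\<in>UNIV - {i}. N $ k))"
    using assms[of i] by simp
  also have "N $ i * (\<Prod>k\<in>UNIV - {i}. N $ k) = card (nat_box N)"
    unfolding card_nat_box by (subst prod.remove[of UNIV i]) auto
  finally show ?thesis .
qed

text \<open>A point of the box outside its translate has some coordinate below \<open>l $ i\<close>
  and lies in one of the slabs. The other half of the symmetric difference has equal size, hence the
  factor 2.\<close>

lemma nat_box_shift_le:
  fixes N l :: "nat ^ 'd"
  assumes "\<And>i. 0 < N $ i"
  shows "real (card ((nat_box N - (+) l ` nat_box N) \<union> ((+) l ` nat_box N - nat_box N))) / real (card (nat_box N))
    \<le> 2 * (\<Sum>i\<in>UNIV. real (l $ i) / real (N $ i))"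
proof -
  let ?B = "nat_box N" and ?C = "(+) l ` nat_box N"
  note fin = finite_nat_box[of N]
  have "card ?C = card ?B" by (rule card_image) simp
  then have "card (?C - ?B) = card (?B - ?C)"
    using fin card_Int_Diff[of ?B ?C] card_Int_Diff[of ?C ?B] by (simp add: Int_commute)
  moreover have "card ((?B - ?C) \<union> (?C - ?B)) = card (?B - ?C) + card (?C - ?B)"
    using fin by (intro card_Un_disjoint) auto
  ultimately have eq: "card ((?B - ?C) \<union> (?C - ?B)) = 2 * card (?B - ?C)" by simp
  have "?B - ?C \<subseteq> (\<Union>i. {n \<in> ?B. n $ i < l $ i})"
  proof
    fix n assume n: "n \<in> ?B - ?C"
    show "n \<in> (\<Union>i. {n \<in> ?B. n $ i < l $ i})"
    proof (rule ccontr)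
      assume "n \<notin> (\<Union>i. {n \<in> ?B. n $ i < l $ i})"
      then have le: "l $ i \<le> n $ i" for i using n by (auto simp: not_less)
      have "n = l + (\<chi> i. n $ i - l $ i)"
        using le by (simp add: vec_eq_iff)
      moreover have "(\<chi> i. n $ i - l $ i) \<in> ?B"
        using n by (auto simp: nat_box_def intro: le_less_trans[OF diff_le_self])
      ultimately show False using n by blast
    qed
  qed
  then have "card (?B - ?C) \<le> card (\<Union>i. {n \<in> ?B. n $ i < l $ i})"
    using fin by (intro card_mono) auto
  also have "\<dots> \<le> (\<Sum>i\<in>UNIV. card {n \<in> ?B. n $ i < l $ i})"
    by (rule card_UN_le) simp
  finally have "real (card (?B - ?C)) \<le> (\<Sum>i\<in>UNIV. real (card {n \<in> ?B. n $ i < l $ i}))"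
    unfolding of_nat_sum[symmetric] of_nat_le_iff .
  also have "\<dots> \<le> (\<Sum>i\<in>UNIV. real (l $ i) / real (N $ i) * real (card ?B))"
    by (intro sum_mono card_slab_le assms)
  finally have "real (card (?B - ?C)) \<le> (\<Sum>i\<in>UNIV. real (l $ i) / real (N $ i)) * real (card ?B)"
    by (simp add: sum_distrib_right)
  moreover have "0 < card ?B"
    using nat_box_nonempty[of N] assms fin by (simp add: card_gt_0_iff)
  ultimately show ?thesis
    unfolding eq by (simp add: field_simps)
qed

lemma nat_box_folner:
  fixes N :: "nat \<Rightarrow> nat ^ 'd"
  assumes "\<And>j i. 0 < N j $ i" "\<And>i. filterlim (\<lambda>j. N j $ i) at_top sequentially"
  shows "(\<lambda>j. real (card ((nat_box (N j) - (+) l ` nat_box (N j)) \<union> ((+) l ` nat_box (N j) - nat_box (N j)))) /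
    real (card (nat_box (N j)))) \<longlonglongrightarrow> 0"
proof (rule tendsto_sandwich[OF always_eventually always_eventually tendsto_const])
  have "(\<lambda>j. real (l $ i) / real (N j $ i)) \<longlonglongrightarrow> 0" for i
    by (rule real_tendsto_divide_at_top[OF tendsto_const
        filterlim_compose[OF filterlim_real_sequentially assms(2)]])
  then have "(\<lambda>j. 2 * (\<Sum>i\<in>UNIV. real (l $ i) / real (N j $ i))) \<longlonglongrightarrow> 2 * (\<Sum>i\<in>(UNIV :: 'd set). 0)"
    by (intro tendsto_mult_left tendsto_sum)
  then show "(\<lambda>j. 2 * (\<Sum>i\<in>UNIV. real (l $ i) / real (N j $ i))) \<longlonglongrightarrow> 0" by simp
qed (use nat_box_shift_le[OF assms(1)] in auto)

text \<open>Half open, so that integer translates of the cube tile the box exactly.\<close>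

definition half_open_box :: "nat ^ 'd \<Rightarrow> (real ^ 'd) set" where
  "half_open_box N = {s. \<forall>i. 0 \<le> s $ i \<and> s $ i < real (N $ i)}"

definition half_open_cube :: "(real ^ 'd) set" where
  "half_open_cube = {s. \<forall>i. 0 \<le> s $ i \<and> s $ i < 1}"

lemma half_open_borel [measurable]:
  "half_open_box N \<in> sets borel" "half_open_cube \<in> sets (borel :: (real ^ 'd) measure)"
  unfolding half_open_box_def half_open_cube_def by measurable

lemma sum_indicator_half_open_cube:
  fixes s :: "real ^ 'd"
  shows "(\<Sum>n\<in>nat_box N. indicator half_open_cube (s - of_nat_vec n)) = (indicator (half_open_box N) s :: real)"
proof (cases "s \<in> half_open_box N")
  case True
  define m :: "nat ^ 'd" where "m = (\<chi> i. nat \<lfloor>s $ i\<rfloor>)"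
  have m: "m \<in> nat_box N"
    using True by (auto simp: m_def nat_box_def half_open_box_def) (metis floor_less_iff nat_less_iff of_int_of_nat_eq zero_le_floor)
  have "s - of_nat_vec n \<in> half_open_cube \<longleftrightarrow> n = m" for n
  proof -
    have "0 \<le> s $ i - real (n $ i) \<and> s $ i - real (n $ i) < 1 \<longleftrightarrow> n $ i = nat \<lfloor>s $ i\<rfloor>" for i
      using True by (auto simp: half_open_box_def) linarith+
    then show ?thesis
      by (simp add: half_open_cube_def of_nat_vec_def m_def vec_eq_iff)
  qed
  then have "(\<Sum>n\<in>nat_box N. indicator half_open_cube (s - of_nat_vec n)) =
      (\<Sum>n\<in>nat_box N. if n = m then 1 else (0::real))"
    by (intro sum.cong) (auto simp: indicator_def)
  then show ?thesis using m True finite_nat_box[of N] by simp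
next
  case False
  have "s - of_nat_vec n \<notin> half_open_cube" if "n \<in> nat_box N" for n
  proof
    assume s: "s - of_nat_vec n \<in> half_open_cube"
    have "0 \<le> s $ i \<and> s $ i < real (N $ i)" for i
    proof -
      have "0 \<le> s $ i - real (n $ i)" "s $ i - real (n $ i) < 1" "n $ i < N $ i"
        using s that by (auto simp: half_open_cube_def of_nat_vec_def nat_box_def)
      then show ?thesis by linarith
    qed
    with False show False by (simp add: half_open_box_def)
  qed
  then show ?thesis using False by simp
qed

text \<open>A density keeps the whole of R^d as the space, so that no membership conditions arise
  for v.\<close>

definition cube_measure :: "(real ^ 'd) measure" where
  "cube_measure = density lborel (indicator half_open_cube)"

lemma sets_cube_measure [measurable_cong, simp]: "sets cube_measure = sets borel"
  by (simp add: cube_measure_def)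

lemma space_cube_measure [simp]: "space cube_measure = UNIV"
  by (simp add: cube_measure_def)

lemma prod_Basis_vec_one: "(\<Prod>b\<in>Basis. (1 :: real ^ 'd) \<bullet> b) = 1"
  by (intro prod.neutral) (auto simp: Basis_vec_def inner_axis)

lemma emeasure_half_open_cube: "emeasure lborel (half_open_cube :: (real ^ 'd) set) = 1"
proof (rule antisym)
  have le: "(0 :: real ^ 'd) \<bullet> b \<le> 1 \<bullet> b" if "b \<in> Basis" for b
    using that by (auto simp: Basis_vec_def inner_axis)
  have "half_open_cube \<subseteq> cbox 0 (1 :: real ^ 'd)"
    by (auto simp: half_open_cube_def mem_box_cart less_imp_le)
  then have "emeasure lborel (half_open_cube :: (real ^ 'd) set) \<le> emeasure lborel (cbox 0 (1 :: real ^ 'd))"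
    by (rule emeasure_mono) simp
  then show "emeasure lborel (half_open_cube :: (real ^ 'd) set) \<le> 1"
    using le by (simp add: prod_Basis_vec_one)
  have "box 0 (1 :: real ^ 'd) \<subseteq> half_open_cube"
    by (auto simp: half_open_cube_def mem_box_cart less_imp_le)
  then have "emeasure lborel (box 0 (1 :: real ^ 'd)) \<le> emeasure lborel (half_open_cube :: (real ^ 'd) set)"
    by (rule emeasure_mono) simp
  then show "1 \<le> emeasure lborel (half_open_cube :: (real ^ 'd) set)"
    using le by (simp add: prod_Basis_vec_one)
qed

lemma prob_space_cube_measure: "prob_space (cube_measure :: (real ^ 'd) measure)"
  by (rule prob_spaceI)
    (simp add: cube_measure_def emeasure_density nn_integral_indicator emeasure_half_open_cube)

lemma integral_cube_measure:
  fixes g :: "real ^ 'd \<Rightarrow> real"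
  assumes [measurable]: "g \<in> borel_measurable borel"
  shows "(\<integral>v. g v \<partial>cube_measure) = (\<integral>v. indicator half_open_cube v * g v \<partial>lborel)"
proof -
  have eq: "cube_measure = density lborel (\<lambda>v :: real ^ 'd. ennreal (indicator half_open_cube v))"
    unfolding cube_measure_def by (intro arg_cong[where f="density lborel"]) (auto simp: indicator_def)
  show ?thesis
    unfolding eq by (subst integral_density) simp_all
qed

lemma integral_lborel_translate:
  fixes g :: "real ^ 'd \<Rightarrow> real"
  assumes [measurable]: "g \<in> borel_measurable borel"
  shows "(\<integral>s. g s \<partial>lborel) = (\<integral>v. g (v + c) \<partial>lborel)"
proof -
  have "(\<integral>s. g s \<partial>lborel) = (\<integral>s. g s \<partial>distr lborel borel ((+) c))"
    by (simp add: lborel_distr_plus)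
  also have "\<dots> = (\<integral>v. g (c + v) \<partial>lborel)"
    by (rule integral_distr) measurable
  finally show ?thesis by (simp add: add.commute)
qed

lemma integrable_indicator_bounded:
  fixes g :: "real ^ 'd \<Rightarrow> real"
  assumes [measurable]: "g \<in> borel_measurable borel" "A \<in> sets borel"
    and "\<And>s. \<bar>g s\<bar> \<le> D" "emeasure lborel A < \<infinity>"
  shows "integrable lborel (\<lambda>s. indicator A s * g s)"
proof -
  have "integrable lborel (\<lambda>s. indicator A s * D)"
    using assms(4) by (intro integrable_mult_left integrable_real_indicator) auto
  then show ?thesis
  proof (rule Bochner_Integration.integrable_bound)
    show "AE s in lborel. norm (indicator A s * g s) \<le> norm (indicator A s * D)"
      using assms(3) by (intro AE_I2) (auto simp: indicator_def intro: order_trans[OF _ abs_ge_self])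
  qed simp
qed

lemma integral_half_open_box:
  fixes g :: "real ^ 'd \<Rightarrow> real"
  assumes g [measurable]: "g \<in> borel_measurable borel" and D: "\<And>s. \<bar>g s\<bar> \<le> D"
  shows "(\<integral>s. indicator (half_open_box N) s * g s \<partial>lborel) =
    (\<Sum>n\<in>nat_box N. \<integral>v. g (v + of_nat_vec n) \<partial>cube_measure)"
    and "integrable lborel (\<lambda>s. indicator (half_open_box N) s * g s)"
proof -
  let ?I = "\<lambda>n s. indicator half_open_cube (s - of_nat_vec n) * g s"
  have cube: "integrable lborel (\<lambda>v. indicator half_open_cube v * g (v + of_nat_vec n))" for n
    by (rule integrable_indicator_bounded[OF _ _ D]) (simp_all add: emeasure_half_open_cube)
  have int: "integrable lborel (?I n)" for n
  proof -
    have "integrable (distr lborel borel ((+) (of_nat_vec n))) (?I n)"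
      using cube[of n] by (subst integrable_distr_eq) (simp_all add: add.commute)
    then show ?thesis by (simp add: lborel_distr_plus)
  qed
  have eq: "indicator (half_open_box N) s * g s = (\<Sum>n\<in>nat_box N. ?I n s)" for s
    unfolding sum_indicator_half_open_cube[symmetric] by (rule sum_distrib_right)
  show "integrable lborel (\<lambda>s. indicator (half_open_box N) s * g s)"
    unfolding eq using int by simp
  have "(\<integral>s. indicator (half_open_box N) s * g s \<partial>lborel) = (\<Sum>n\<in>nat_box N. \<integral>s. ?I n s \<partial>lborel)"
    unfolding eq using int by (rule Bochner_Integration.integral_sum)
  also have "\<dots> = (\<Sum>n\<in>nat_box N. \<integral>v. g (v + of_nat_vec n) \<partial>cube_measure)"
  proof (rule sum.cong[OF refl])
    fix n
    have "(\<integral>s. ?I n s \<partial>lborel) = (\<integral>v. ?I n (v + of_nat_vec n) \<partial>lborel)"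
      by (rule integral_lborel_translate) measurable
    also have "\<dots> = (\<integral>v. g (v + of_nat_vec n) \<partial>cube_measure)"
      by (subst integral_cube_measure) simp_all
    finally show "(\<integral>s. ?I n s \<partial>lborel) = (\<integral>v. g (v + of_nat_vec n) \<partial>cube_measure)" .
  qed
  finally show "(\<integral>s. indicator (half_open_box N) s * g s \<partial>lborel) =
    (\<Sum>n\<in>nat_box N. \<integral>v. g (v + of_nat_vec n) \<partial>cube_measure)" .
qed

lemma abs_integral_indicator_le:
  fixes g :: "real ^ 'd \<Rightarrow> real"
  assumes [measurable]: "g \<in> borel_measurable borel" "A \<in> sets borel"
    and D: "\<And>s. \<bar>g s\<bar> \<le> D" and A: "emeasure lborel A < \<infinity>"
  shows "\<bar>\<integral>s. indicator A s * g s \<partial>lborel\<bar> \<le> D * measure lborel A"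
proof -
  have D0: "0 \<le> D" using D[of 0] by linarith
  have "\<bar>\<integral>s. indicator A s * g s \<partial>lborel\<bar> \<le> (\<integral>s. \<bar>indicator A s * g s\<bar> \<partial>lborel)"
    by (rule integral_abs_bound)
  also have "\<dots> \<le> (\<integral>s. indicator A s * D \<partial>lborel)"
  proof (rule integral_mono)
    show "integrable lborel (\<lambda>s. \<bar>indicator A s * g s\<bar>)"
      by (intro integrable_abs integrable_indicator_bounded[OF _ _ D A]) measurable
    show "integrable lborel (\<lambda>s. indicator A s * D)"
      using D0 by (intro integrable_indicator_bounded[where D=D] A) auto
    show "\<bar>indicator A s * g s\<bar> \<le> indicator A s * D" for s
      using D by (auto simp: indicator_def)
  qed
  also have "\<dots> = D * measure lborel A"
    by simp
  finally show ?thesis .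
qed

definition floor_vec :: "real ^ 'd \<Rightarrow> nat ^ 'd" where
  "floor_vec R = (\<chi> i. nat \<lfloor>R $ i\<rfloor>)"

lemma measure_half_open_box:
  "emeasure lborel (half_open_box N) < \<infinity>" "measure lborel (half_open_box N) = (\<Prod>i\<in>UNIV. real (N $ i))"
proof -
  interpret prob_space "cube_measure :: (real ^ 'd) measure" by (rule prob_space_cube_measure)
  have "integrable lborel (\<lambda>s. indicator (half_open_box N) s * (1::real))"
    by (rule integral_half_open_box(2)[where D=1]) auto
  then have "integrable lborel (indicator (half_open_box N) :: _ \<Rightarrow> real)" by simp
  then show "emeasure lborel (half_open_box N) < \<infinity>"
    by (simp add: integrable_indicator_iff)
  have "(\<integral>s. indicator (half_open_box N) s * (1::real) \<partial>lborel) = real (card (nat_box N))"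
    by (subst integral_half_open_box(1)[where D=1]) (auto simp: prob_space[simplified])
  then show "measure lborel (half_open_box N) = (\<Prod>i\<in>UNIV. real (N $ i))"
    by (simp add: card_nat_box)
qed

text \<open>Let V and W be the volumes of the real box and of its integer part. Discarding the
  boundary costs at most D (V - W) / V; renormalising the rest, whose integral is at most D W, costs
  at most D W (1 / W - 1 / V). Both equal D (1 - W / V).\<close>

lemma box_average_approx:
  fixes g :: "real ^ 'd \<Rightarrow> real" and R :: "real ^ 'd"
  assumes [measurable]: "g \<in> borel_measurable borel"
    and D: "\<And>s. \<bar>g s\<bar> \<le> D" and R: "\<And>i. 1 \<le> R $ i"
  shows "\<bar>(\<Prod>i\<in>UNIV. 1 / R $ i) * (\<integral>s. indicator (cbox 0 R) s * g s \<partial>lborel) -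
      avg (nat_box (floor_vec R)) (\<lambda>n. \<integral>v. g (v + of_nat_vec n) \<partial>cube_measure)\<bar>
    \<le> 2 * D * (1 - (\<Prod>i\<in>UNIV. real (floor_vec R $ i) / R $ i))"
proof -
  define N where "N = floor_vec R"
  have D0: "0 \<le> D" using D[of 0] by linarith
  have NR: "1 \<le> real (N $ i)" "real (N $ i) \<le> R $ i" for i
    using R[of i] unfolding N_def floor_vec_def by simp_all
  define V where "V = (\<Prod>i\<in>UNIV. R $ i)"
  define W where "W = (\<Prod>i\<in>UNIV. real (N $ i))"
  have R0: "0 < R $ i" for i using R[of i] by linarith
  have N0: "0 < real (N $ i)" for i using NR(1)[of i] by linarith
  have V: "0 < V" unfolding V_def using R0 by (intro prod_pos) auto
  have W: "0 < W" unfolding W_def using N0 by (intro prod_pos) auto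
  have "cbox 0 R \<noteq> {}" using R0 by (auto simp: interval_ne_empty_cart less_imp_le)
  then have mC: "measure lborel (cbox 0 R) = V"
    unfolding V_def by (subst content_cbox_cart) auto
  have fC: "emeasure lborel (cbox 0 R) < \<infinity>" by (rule emeasure_lborel_cbox_finite)
  have mH: "emeasure lborel (half_open_box N) < \<infinity>" "measure lborel (half_open_box N) = W"
    unfolding W_def by (rule measure_half_open_box)+
  have sub: "half_open_box N \<subseteq> cbox 0 R"
    using NR(2) by (auto simp: half_open_box_def mem_box_cart) (meson less_imp_le less_le_trans)
  have fD: "emeasure lborel (cbox 0 R - half_open_box N) < \<infinity>"
    using fC by (rule le_less_trans[rotated]) (intro emeasure_mono, auto)
  have mD: "measure lborel (cbox 0 R - half_open_box N) = V - W"
    using fC mC mH sub by (subst measure_Diff) auto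
  define a where "a = (\<integral>s. indicator (cbox 0 R) s * g s \<partial>lborel)"
  define b where "b = (\<integral>s. indicator (half_open_box N) s * g s \<partial>lborel)"
  have "a - b = (\<integral>s. indicator (cbox 0 R) s * g s - indicator (half_open_box N) s * g s \<partial>lborel)"
    unfolding a_def b_def
    by (rule Bochner_Integration.integral_diff[symmetric];
        rule integrable_indicator_bounded[where D=D]) (use D fC mH in simp_all)
  also have "\<dots> = (\<integral>s. indicator (cbox 0 R - half_open_box N) s * g s \<partial>lborel)"
    using sub by (intro Bochner_Integration.integral_cong) (auto simp: indicator_def)
  finally have ab: "\<bar>a - b\<bar> \<le> D * (V - W)"
    using abs_integral_indicator_le[of g "cbox 0 R - half_open_box N" D] D fD mD by simp
  have b: "\<bar>b\<bar> \<le> D * W"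
    unfolding b_def mH(2)[symmetric] by (rule abs_integral_indicator_le) (use D mH in simp_all)
  have VW: "W \<le> V"
    unfolding V_def W_def using NR N0 by (intro prod_mono) (auto simp: less_imp_le)
  have avg: "avg (nat_box N) (\<lambda>n. \<integral>v. g (v + of_nat_vec n) \<partial>cube_measure) = b / W"
    unfolding avg_def b_def W_def using D
    by (subst integral_half_open_box(1)[where D=D]) (auto simp: card_nat_box)
  have "a / V - b / W = (a - b) / V + b * (1 / V - 1 / W)"
    by (simp add: field_simps diff_divide_distrib)
  also have "\<bar>\<dots>\<bar> \<le> \<bar>(a - b) / V\<bar> + \<bar>b * (1 / V - 1 / W)\<bar>"
    by (rule abs_triangle_ineq)
  also have "\<bar>(a - b) / V\<bar> \<le> D * (V - W) / V"
    using ab V by (simp add: divide_right_mono)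
  also have "\<bar>b * (1 / V - 1 / W)\<bar> \<le> (D * W) * (1 / W - 1 / V)"
  proof -
    have "1 / V \<le> 1 / W" using VW W by (simp add: frac_le)
    then have "\<bar>1 / V - 1 / W\<bar> = 1 / W - 1 / V" by simp
    then show ?thesis
      unfolding abs_mult using b \<open>1 / V \<le> 1 / W\<close> by (simp add: mult_right_mono)
  qed
  also have "D * (V - W) / V + (D * W) * (1 / W - 1 / V) = 2 * D * (1 - W / V)"
    using V W by (simp add: field_simps)
  finally have "\<bar>a / V - b / W\<bar> \<le> 2 * D * (1 - W / V)" by simp
  then show ?thesis
    unfolding N_def[symmetric] avg a_def[symmetric]
    by (simp add: prod_dividef V_def W_def)
qed

lemma floor_ratio_tendsto:
  fixes R :: "nat \<Rightarrow> real ^ 'd"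
  assumes "\<And>j i. 1 \<le> R j $ i" "\<And>i. filterlim (\<lambda>j. R j $ i) at_top sequentially"
  shows "(\<lambda>j. \<Prod>i\<in>UNIV. real (floor_vec (R j) $ i) / R j $ i) \<longlonglongrightarrow> 1"
proof -
  have "(\<lambda>j. real (floor_vec (R j) $ i) / R j $ i) \<longlonglongrightarrow> 1" for i
  proof (rule tendsto_sandwich[OF always_eventually always_eventually _ tendsto_const])
    show "(\<lambda>j. 1 - 1 / R j $ i) \<longlonglongrightarrow> 1"
      using tendsto_diff[OF tendsto_const real_tendsto_divide_at_top[OF tendsto_const assms(2)[of i]], of 1 1]
      by simp
    show "\<forall>j. 1 - 1 / R j $ i \<le> real (floor_vec (R j) $ i) / R j $ i"
    proof
      fix j
      have "R j $ i - 1 \<le> real (floor_vec (R j) $ i)" "0 < R j $ i"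
        using assms(1)[of j i] unfolding floor_vec_def by simp_all
      then show "1 - 1 / R j $ i \<le> real (floor_vec (R j) $ i) / R j $ i"
        using divide_right_mono[of "R j $ i - 1" "real (floor_vec (R j) $ i)" "R j $ i"]
        by (simp add: diff_divide_distrib)
    qed
    show "\<forall>j. real (floor_vec (R j) $ i) / R j $ i \<le> 1"
    proof
      fix j
      have "real (floor_vec (R j) $ i) \<le> R j $ i" "0 < R j $ i"
        using assms(1)[of j i] unfolding floor_vec_def by simp_all
      then show "real (floor_vec (R j) $ i) / R j $ i \<le> 1" by simp
    qed
  qed
  then have "(\<lambda>j. \<Prod>i\<in>UNIV. real (floor_vec (R j) $ i) / R j $ i) \<longlonglongrightarrow> (\<Prod>i\<in>(UNIV :: 'd set). 1)"
    by (rule tendsto_prod)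
  then show ?thesis by simp
qed

lemma floor_vec_at_top:
  assumes "filterlim (\<lambda>j. R j $ i) at_top sequentially"
  shows "filterlim (\<lambda>j. floor_vec (R j) $ i) at_top sequentially"
  unfolding floor_vec_def using assms
  by (simp add: filterlim_compose[OF filterlim_nat_sequentially filterlim_compose[OF filterlim_floor_sequentially]])

section \<open>Convergence in mean square\<close>

context prob_space
begin

lemma power2_integral_le:
  fixes h :: "'a \<Rightarrow> real"
  assumes [measurable]: "h \<in> borel_measurable M" and D: "\<And>x. x \<in> space M \<Longrightarrow> \<bar>h x\<bar> \<le> D"
  shows "(\<integral>x. h x \<partial>M)\<^sup>2 \<le> (\<integral>x. (h x)\<^sup>2 \<partial>M)"
proof -
  have i1: "integrable M h"
    using D by (intro integrable_const_bound[of _ D]) auto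
  have i2: "integrable M (\<lambda>x. (h x)\<^sup>2)"
    using power_mono[OF D, where n=2] by (intro integrable_const_bound[of _ "D\<^sup>2"]) auto
  have "0 \<le> variance h" by (rule integral_nonneg_AE) simp
  then show ?thesis using variance_eq[OF i1 i2] by simp
qed

lemma L2_complete_bounded:
  fixes u :: "nat \<Rightarrow> 'a \<Rightarrow> real"
  assumes m [measurable]: "\<And>n. u n \<in> borel_measurable M" and D: "\<And>n x. x \<in> space M \<Longrightarrow> \<bar>u n x\<bar> \<le> D"
    and cauchy: "\<And>\<epsilon>. 0 < \<epsilon> \<Longrightarrow> \<exists>J. \<forall>i\<ge>J. \<forall>j\<ge>J. (\<integral>x. (u i x - u j x)\<^sup>2 \<partial>M) \<le> \<epsilon>"
  obtains F where "F \<in> borel_measurable M" "\<And>x. \<bar>F x\<bar> \<le> \<bar>D\<bar>" "(\<lambda>n. \<integral>x. (u n x - F x)\<^sup>2 \<partial>M) \<longlonglongrightarrow> 0"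
proof -
  \<comment> \<open>Squared distances at most 4^-k mean distances at most 2^-k. These are summable,
    so a fast subsequence converges almost everywhere.\<close>
  have "\<exists>J. \<forall>i\<ge>J. \<forall>j\<ge>J. (\<integral>x. (u i x - u j x)\<^sup>2 \<partial>M) \<le> (1/4) ^ k" for k :: nat
    by (rule cauchy) simp
  then obtain J where J: "\<And>k i j. i \<ge> J k \<Longrightarrow> j \<ge> J k \<Longrightarrow> (\<integral>x. (u i x - u j x)\<^sup>2 \<partial>M) \<le> (1/4) ^ k"
    by metis
  \<comment> \<open>Summing the thresholds puts both \<open>r k\<close> and \<open>r (Suc k)\<close>
    beyond \<open>J k\<close>.\<close>
  define r where "r = (\<lambda>k. \<Sum>i\<le>k. J i)"
  have r: "J k \<le> r k" "J k \<le> r (Suc k)" for k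
    unfolding r_def by (auto intro: member_le_sum trans_le_add1)
  define v where "v = (\<lambda>k x. \<bar>u (r (Suc k)) x - u (r k) x\<bar>)"
  have v [measurable]: "v k \<in> borel_measurable M" for k unfolding v_def by measurable
  have vD: "\<bar>v k x\<bar> \<le> 2 * D" if "x \<in> space M" for k x
    using D[OF that, of "r (Suc k)"] D[OF that, of "r k"] by (simp add: v_def)
  have vi: "integrable M (v k)" for k
    using vD by (intro integrable_const_bound[of _ "2 * D"]) auto
  have le: "(\<integral>x. v k x \<partial>M) \<le> (1/2) ^ k" for k
  proof (rule power2_le_imp_le)
    have "(\<integral>x. v k x \<partial>M)\<^sup>2 \<le> (\<integral>x. (v k x)\<^sup>2 \<partial>M)"
      by (rule power2_integral_le[OF v vD])
    also have "\<dots> \<le> (1/4) ^ k"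
      using J[OF r(2,1), of k] by (simp add: v_def)
    also have "\<dots> = ((1/2) ^ k)\<^sup>2"
      by (simp add: power_mult[symmetric] power_divide mult.commute[of k] power_mult)
    finally show "(\<integral>x. v k x \<partial>M)\<^sup>2 \<le> ((1/2) ^ k)\<^sup>2" .
  qed simp
  have "(\<integral>\<^sup>+x. (\<Sum>k. ennreal (v k x)) \<partial>M) = (\<Sum>k. \<integral>\<^sup>+x. ennreal (v k x) \<partial>M)"
    by (rule nn_integral_suminf) measurable
  also have "\<dots> = (\<Sum>k. ennreal (\<integral>x. v k x \<partial>M))"
    using vi by (intro suminf_cong nn_integral_eq_integral) (auto simp: v_def)
  also have "\<dots> \<le> (\<Sum>k. ennreal ((1/2) ^ k))"
    using le by (intro suminf_le ennreal_leI) auto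
  also have "\<dots> = ennreal (\<Sum>k. (1/2) ^ k)"
    by (rule suminf_ennreal2) (auto intro: summable_geometric)
  also have "\<dots> < \<infinity>" by simp
  finally have "AE x in M. (\<Sum>k. ennreal (v k x)) \<noteq> \<infinity>"
    by (intro nn_integral_noteq_infinite) auto
  then have conv: "AE x in M. convergent (\<lambda>k. u (r k) x)"
  proof eventually_elim
    case (elim x)
    then have "summable (\<lambda>k. v k x)"
      by (intro summable_suminf_not_top) (auto simp: v_def)
    then have "summable (\<lambda>k. u (r (Suc k)) x - u (r k) x)"
      unfolding v_def by (rule summable_rabs_cancel)
    then have "convergent (\<lambda>n. \<Sum>k<n. u (r (Suc k)) x - u (r k) x)"
      by (simp add: summable_iff_convergent)
    then have "convergent (\<lambda>n. u (r n) x - u (r 0) x)"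
      by (simp add: sum_lessThan_telescope[of "\<lambda>n. u (r n) x"])
    then show ?case
      using convergent_add[OF _ convergent_const[of "u (r 0) x"]] by fastforce
  qed
  \<comment> \<open>Clamping bounds F everywhere and changes nothing at points of the space where
    the subsequence converges, as its limit there lies in [-D, D].\<close>
  define F where "F = (\<lambda>x. max (- \<bar>D\<bar>) (min \<bar>D\<bar> (lim (\<lambda>k. u (r k) x))))"
  have F [measurable]: "F \<in> borel_measurable M" unfolding F_def by measurable
  have FD: "\<bar>F x\<bar> \<le> \<bar>D\<bar>" for x unfolding F_def by auto
  have lim: "AE x in M. (\<lambda>k. u (r k) x) \<longlonglongrightarrow> F x"
    using conv AE_space
  proof eventually_elim
    case (elim x)
    then have l: "(\<lambda>k. u (r k) x) \<longlonglongrightarrow> lim (\<lambda>k. u (r k) x)"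
      by (simp add: convergent_LIMSEQ_iff)
    have "lim (\<lambda>k. u (r k) x) \<le> D" "- D \<le> lim (\<lambda>k. u (r k) x)"
      using D[OF elim(2)] by (auto intro!: LIMSEQ_le_const2[OF l] LIMSEQ_le_const[OF l] simp: abs_le_iff minus_le_iff)
    then have "F x = lim (\<lambda>k. u (r k) x)" by (simp add: F_def)
    with l show ?case by simp
  qed
  have bnd: "(u n x - F x)\<^sup>2 \<le> (2 * \<bar>D\<bar>)\<^sup>2" if "x \<in> space M" for n x
    using D[OF that, of n] FD[of x] by (intro power2_le_iff_abs_le[THEN iffD2]) auto
  have sub: "(\<lambda>k. \<integral>x. (u (r k) x - F x)\<^sup>2 \<partial>M) \<longlonglongrightarrow> (\<integral>x. 0 \<partial>M)"
  proof (rule integral_dominated_convergence[where w="\<lambda>_. (2 * \<bar>D\<bar>)\<^sup>2"])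
    show "AE x in M. (\<lambda>k. (u (r k) x - F x)\<^sup>2) \<longlonglongrightarrow> 0"
      using lim
    proof eventually_elim
      case (elim x)
      from tendsto_power[OF tendsto_diff[OF elim tendsto_const[of "F x"]], of 2] show ?case by simp
    qed
    show "AE x in M. norm ((u (r k) x - F x)\<^sup>2) \<le> (2 * \<bar>D\<bar>)\<^sup>2" for k
      using bnd by (intro AE_I2) simp
  qed simp_all
  have int: "integrable M (\<lambda>x. (u n x - F x)\<^sup>2)" for n
    using bnd by (intro integrable_const_bound[of _ "(2 * \<bar>D\<bar>)\<^sup>2"]) auto
  have int2: "integrable M (\<lambda>x. (u n x - u k x)\<^sup>2)" for n k
  proof (rule integrable_const_bound[of _ "(2 * \<bar>D\<bar>)\<^sup>2"])
    show "AE x in M. norm ((u n x - u k x)\<^sup>2) \<le> (2 * \<bar>D\<bar>)\<^sup>2"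
    proof (rule AE_I2)
      fix x assume x: "x \<in> space M"
      have "(u n x - u k x)\<^sup>2 \<le> (2 * \<bar>D\<bar>)\<^sup>2"
        using D[OF x, of n] D[OF x, of k] by (intro power2_le_iff_abs_le[THEN iffD2]) auto
      then show "norm ((u n x - u k x)\<^sup>2) \<le> (2 * \<bar>D\<bar>)\<^sup>2" by simp
    qed
  qed simp
  have "(\<lambda>n. \<integral>x. (u n x - F x)\<^sup>2 \<partial>M) \<longlonglongrightarrow> 0"
  proof (rule LIMSEQ_I)
    fix \<epsilon> :: real assume \<epsilon>: "0 < \<epsilon>"
    obtain K where K: "\<And>k. k \<ge> K \<Longrightarrow> (\<integral>x. (u (r k) x - F x)\<^sup>2 \<partial>M) < \<epsilon> / 8"
      using LIMSEQ_D[OF sub, of "\<epsilon> / 8"] \<epsilon> by auto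
    obtain L where L: "\<And>k. k \<ge> L \<Longrightarrow> (1/4 :: real) ^ k < \<epsilon> / 8"
      using LIMSEQ_D[OF LIMSEQ_power_zero[of "1/4 :: real"], of "\<epsilon> / 8"] \<epsilon> by auto
    define k where "k = max K L"
    show "\<exists>N. \<forall>n\<ge>N. norm ((\<integral>x. (u n x - F x)\<^sup>2 \<partial>M) - 0) < \<epsilon>"
    proof (intro exI allI impI)
      fix n assume n: "n \<ge> J k"
      have "(\<integral>x. (u n x - F x)\<^sup>2 \<partial>M) \<le> (\<integral>x. 2 * (u n x - u (r k) x)\<^sup>2 + 2 * (u (r k) x - F x)\<^sup>2 \<partial>M)"
      proof (rule integral_mono[OF int])
        show "integrable M (\<lambda>x. 2 * (u n x - u (r k) x)\<^sup>2 + 2 * (u (r k) x - F x)\<^sup>2)"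
          using int int2 by simp
        show "(u n x - F x)\<^sup>2 \<le> 2 * (u n x - u (r k) x)\<^sup>2 + 2 * (u (r k) x - F x)\<^sup>2" for x
          using zero_le_power2[of "(u n x - u (r k) x) - (u (r k) x - F x)"]
          by (simp add: power2_eq_square algebra_simps)
      qed
      also have "\<dots> = 2 * (\<integral>x. (u n x - u (r k) x)\<^sup>2 \<partial>M) + 2 * (\<integral>x. (u (r k) x - F x)\<^sup>2 \<partial>M)"
        using int int2 by simp
      also have "\<dots> < \<epsilon>"
        using J[OF n r(1)] L[of k] K[of k] \<epsilon> by (simp add: k_def)
      finally show "norm ((\<integral>x. (u n x - F x)\<^sup>2 \<partial>M) - 0) < \<epsilon>"
        by (simp add: integral_nonneg_AE)
    qed
  qed
  then show ?thesis using that F FD by blast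
qed

end

lemma (in complete_measure) borel_measurable_AE_eq:
  fixes f g :: "'a \<Rightarrow> real"
  assumes g: "g \<in> borel_measurable M" and ae: "AE x in M. f x = g x"
  shows "f \<in> borel_measurable M"
proof (rule measurableI)
  fix A :: "real set" assume A: "A \<in> sets borel"
  show "f -` A \<inter> space M \<in> sets M"
  proof (rule in_sets_AE)
    show "AE x in M. x \<in> g -` A \<inter> space M \<longleftrightarrow> x \<in> f -` A \<inter> space M"
      using ae by eventually_elim auto
    show "g -` A \<inter> space M \<in> sets M"
      using g A by (rule measurable_sets)
  qed auto
qed simp

section \<open>From discrete to continuous averages\<close>

lemma flow_measurable: "measure_preserving_flow M T \<Longrightarrow> T t \<in> measurable M M"
  by (simp add: measure_preserving_flow_def invertible_measure_preserving_def)

lemma flow_distr: "measure_preserving_flow M T \<Longrightarrow> distr M M (T t) = M"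
  by (simp add: measure_preserving_flow_def invertible_measure_preserving_def)

text \<open>Off a null set N0 the function f(T(t, x)) equals a product measurable H. Substituting t
  = p(s) is legitimate if almost every s avoids the null set N of times at which the section of N0
  is not null; this holds for nonconstant p. A constant p might lie in N for every s, and there
  measurability of the single map \<open>T (p 0)\<close> is used.\<close>

lemma flow_joint_measurable:
  fixes p :: "real ^ 'd \<Rightarrow> real" and f :: "'a \<Rightarrow> real"
  assumes "prob_space M" and flow: "measure_preserving_flow M T"
    and p: "real_polynomial_function p" and f: "f \<in> borel_measurable M"
  obtains G where "G \<in> borel_measurable (lborel \<Otimes>\<^sub>M M)"
    "AE z in lborel \<Otimes>\<^sub>M M. f (T (p (fst z)) (snd z)) = G z"
proof (cases "\<forall>s. p s = p 0")
  case True
  have "(\<lambda>z. f (T (p 0) (snd z))) \<in> borel_measurable (lborel \<Otimes>\<^sub>M M)"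
    by (rule measurable_compose[OF measurable_snd measurable_compose[OF flow_measurable[OF flow] f]])
  moreover have "f (T (p (fst z)) (snd z)) = f (T (p 0) (snd z))" for z :: "(real ^ 'd) \<times> 'a"
    using True[rule_format, of "fst z"] by simp
  then have "AE z in lborel \<Otimes>\<^sub>M M. f (T (p (fst z)) (snd z)) = f (T (p 0) (snd z))"
    by (rule AE_I2)
  ultimately show ?thesis by (rule that)
next
  case False
  then obtain a where a: "p 0 \<noteq> p a" by metis
  interpret prob_space M by fact
  interpret L1: pair_sigma_finite "lborel :: real measure" M ..
  interpret L2: pair_sigma_finite "lborel :: (real ^ 'd) measure" M ..
  have [measurable]: "p \<in> borel_measurable borel" using p by (rule real_polynomial_function_borel)
  have "(\<lambda>(t, x). T t x) \<in> measurable (completion (lborel \<Otimes>\<^sub>M M)) M"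
    using flow by (simp add: measure_preserving_flow_def)
  from measurable_compose[OF this f] obtain H where H [measurable]: "H \<in> borel_measurable (lborel \<Otimes>\<^sub>M M)"
    and ae: "AE z in lborel \<Otimes>\<^sub>M M. f (case z of (t, x) \<Rightarrow> T t x) = H z"
    using completion_ex_borel_measurable_real by blast
  then obtain N0 where N0: "N0 \<in> null_sets (lborel \<Otimes>\<^sub>M M)"
    and N0_sub: "{z \<in> space (lborel \<Otimes>\<^sub>M M). f (case z of (t, x) \<Rightarrow> T t x) \<noteq> H z} \<subseteq> N0"
    unfolding eventually_ae_filter by auto
  have sub: "f (T t x) = H (t, x)" if "x \<in> space M" "(t, x) \<notin> N0" for t x
    using subsetD[OF N0_sub, of "(t, x)"] that by (auto simp: space_pair_measure)
  have [measurable]: "N0 \<in> sets (lborel \<Otimes>\<^sub>M M)" using N0 by auto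
  have "AE t in lborel. AE x in M. (t, x) \<notin> N0"
    using L1.AE_pair[OF AE_not_in[OF N0]] .
  then obtain N where N: "N \<in> null_sets lborel" "{t. \<not> (AE x in M. (t, x) \<notin> N0)} \<subseteq> N"
    unfolding eventually_ae_filter[of _ "lborel :: real measure"] by auto
  have "AE s in lborel. AE x in M. (p s, x) \<notin> N0"
    using AE_polynomial_not_in_null[OF p a N(1)] by eventually_elim (use N(2) in auto)
  moreover have "{z \<in> space (lborel \<Otimes>\<^sub>M M). (p (fst z), snd z) \<notin> N0} \<in> sets (lborel \<Otimes>\<^sub>M M)"
    by measurable
  ultimately have "AE z in lborel \<Otimes>\<^sub>M M. (p (fst z), snd z) \<notin> N0"
    by (intro L2.AE_pair_measure) auto
  then have "AE z in lborel \<Otimes>\<^sub>M M. f (T (p (fst z)) (snd z)) = H (p (fst z), snd z)"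
    using AE_space by eventually_elim (use sub in \<open>auto simp: space_pair_measure\<close>)
  then show ?thesis
    by (intro that[of "\<lambda>z. H (p (fst z), snd z)"]) measurable
qed

lemma flow_product_joint_measurable:
  fixes p :: "nat \<Rightarrow> real ^ 'd \<Rightarrow> real" and f :: "nat \<Rightarrow> 'a \<Rightarrow> real"
  assumes "prob_space M" and flow: "measure_preserving_flow M T"
    and p: "\<And>j. j \<in> K \<Longrightarrow> real_polynomial_function (p j)"
    and f: "\<And>j. j \<in> K \<Longrightarrow> f j \<in> borel_measurable M" and K: "finite K"
  obtains G where "G \<in> borel_measurable (lborel \<Otimes>\<^sub>M M)"
    "AE z in lborel \<Otimes>\<^sub>M M. (\<Prod>j\<in>K. f j (T (p j (fst z)) (snd z))) = G z"
proof -
  have "\<exists>G. G \<in> borel_measurable (lborel \<Otimes>\<^sub>M M) \<and>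
      (AE z in lborel \<Otimes>\<^sub>M M. f j (T (p j (fst z)) (snd z)) = G z)" if j: "j \<in> K" for j
    by (rule flow_joint_measurable[OF assms(1) flow p[OF j] f[OF j]]) blast
  then have "\<forall>j\<in>K. \<exists>G. G \<in> borel_measurable (lborel \<Otimes>\<^sub>M M) \<and>
      (AE z in lborel \<Otimes>\<^sub>M M. f j (T (p j (fst z)) (snd z)) = G z)"
    by (rule ballI)
  from bchoice[OF this] obtain G where "\<forall>j\<in>K. G j \<in> borel_measurable (lborel \<Otimes>\<^sub>M M) \<and>
      (AE z in lborel \<Otimes>\<^sub>M M. f j (T (p j (fst z)) (snd z)) = G j z)"
    by (rule exE)
  then have G: "\<And>j. j \<in> K \<Longrightarrow> G j \<in> borel_measurable (lborel \<Otimes>\<^sub>M M)"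
    "\<And>j. j \<in> K \<Longrightarrow> AE z in lborel \<Otimes>\<^sub>M M. f j (T (p j (fst z)) (snd z)) = G j z"
    by blast+
  have "AE z in lborel \<Otimes>\<^sub>M M. \<forall>j\<in>K. f j (T (p j (fst z)) (snd z)) = G j z"
    using G(2) by (intro AE_finite_allI K)
  then have "AE z in lborel \<Otimes>\<^sub>M M. (\<Prod>j\<in>K. f j (T (p j (fst z)) (snd z))) = (\<Prod>j\<in>K. G j z)"
    by eventually_elim simp
  then show ?thesis
    using G(1) by (intro that[of "\<lambda>z. \<Prod>j\<in>K. G j z"]) (auto intro: borel_measurable_prod)
qed

text \<open>The average with the product of the \<open>f j\<close> replaced by a jointly measurable
  G, so that no completion is involved and Fubini applies.\<close>

definition kernel_average :: "((real ^ 'd) \<times> 'a \<Rightarrow> real) \<Rightarrow> real ^ 'd \<Rightarrow> 'a \<Rightarrow> real" where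
  "kernel_average G R x = (\<Prod>i\<in>UNIV. 1 / R $ i) * (\<integral>s. indicator (cbox 0 R) s * G (s, x) \<partial>lborel)"

lemma kernel_average_bound:
  fixes G :: "(real ^ 'd) \<times> 'a \<Rightarrow> real"
  assumes G: "(\<lambda>s. G (s, x)) \<in> borel_measurable borel" and D: "\<And>z. \<bar>G z\<bar> \<le> D" and R: "\<And>i. 1 \<le> R $ i"
  shows "\<bar>kernel_average G R x\<bar> \<le> D"
proof -
  have R0: "0 < R $ i" for i using R[of i] by linarith
  have "cbox 0 R \<noteq> {}" using R0 by (auto simp: interval_ne_empty_cart less_imp_le)
  then have m: "measure lborel (cbox 0 R) = (\<Prod>i\<in>UNIV. R $ i)"
    by (subst content_cbox_cart) auto
  have V: "0 < (\<Prod>i\<in>UNIV. R $ i)" using R0 by (intro prod_pos) auto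
  have "\<bar>\<integral>s. indicator (cbox 0 R) s * G (s, x) \<partial>lborel\<bar> \<le> D * (\<Prod>i\<in>UNIV. R $ i)"
    unfolding m[symmetric] by (rule abs_integral_indicator_le[OF G _ D emeasure_lborel_cbox_finite]) simp
  then show ?thesis
    using V unfolding kernel_average_def by (simp add: prod_dividef abs_mult field_simps)
qed

lemma kernel_average_measurable:
  fixes G :: "(real ^ 'd) \<times> 'a \<Rightarrow> real"
  assumes [measurable]: "G \<in> borel_measurable (lborel \<Otimes>\<^sub>M M)"
  shows "kernel_average G R \<in> borel_measurable M"
proof -
  have "(\<lambda>(x, s). indicator (cbox 0 R) s * G (s, x)) \<in> borel_measurable (M \<Otimes>\<^sub>M lborel)"
    by measurable
  from lborel.borel_measurable_lebesgue_integral[OF this]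
  show ?thesis unfolding kernel_average_def[abs_def] by measurable
qed

text \<open>Measurability of the integrand is not given either: it follows from equality almost
  everywhere with a section of G, because Lebesgue measure is complete.\<close>

lemma polynomial_average_eq_kernel_average:
  fixes G :: "(real ^ 'd) \<times> 'a \<Rightarrow> real"
  assumes [measurable]: "G \<in> borel_measurable (lborel \<Otimes>\<^sub>M M)" and x: "x \<in> space M"
    and ae: "AE s in lborel. (\<Prod>j=1..k. f j (T (p j s) x)) = G (s, x)"
  shows "polynomial_average T k p f R x = kernel_average G R x"
proof -
  let ?h = "\<lambda>s. indicator (cbox 0 R) s * (\<Prod>j=1..k. f j (T (p j s) x))"
  let ?g = "\<lambda>s. indicator (cbox 0 R) s * G (s, x)"
  have g [measurable]: "?g \<in> borel_measurable lborel"
    using x by measurable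
  have g': "?g \<in> borel_measurable lebesgue" using g by (rule measurable_completion)
  have "AE s in lborel. ?h s = ?g s" using ae by eventually_elim simp
  then have eq: "AE s in lebesgue. ?h s = ?g s" by (rule AE_completion)
  have "?h \<in> borel_measurable lebesgue"
    by (rule completion.borel_measurable_AE_eq[OF g' eq])
  then have "(\<integral>s. ?h s \<partial>lebesgue) = (\<integral>s. ?g s \<partial>lebesgue)"
    using g' eq by (rule integral_cong_AE)
  also have "\<dots> = (\<integral>s. ?g s \<partial>lborel)" using g by (rule integral_completion)
  finally show ?thesis
    by (simp add: polynomial_average_def kernel_average_def set_lebesgue_integral_def)
qed

text \<open>The equality is needed with either variable outermost: with s for the integer averages
  at almost every base point, with x to identify the average of the original \<open>f j\<close> for
  almost every x. Truncating \<open>f j\<close> to \<open>h j\<close> is invisible at each fixed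
  time because the flow preserves the measure; G is truncated to the bound D of the
  products.\<close>

lemma bounded_kernel_exists:
  fixes p :: "nat \<Rightarrow> real ^ 'd \<Rightarrow> real" and f :: "nat \<Rightarrow> 'a \<Rightarrow> real"
  assumes "prob_space M" and flow: "measure_preserving_flow M T" and K: "finite K"
    and p: "\<And>j. j \<in> K \<Longrightarrow> real_polynomial_function (p j)"
    and f: "\<And>j. j \<in> K \<Longrightarrow> f j \<in> L_infinity M"
  obtains G h C D where "G \<in> borel_measurable (lborel \<Otimes>\<^sub>M M)" "\<And>z. \<bar>G z\<bar> \<le> D"
    "\<And>j. j \<in> K \<Longrightarrow> h j \<in> borel_measurable M" "\<And>j x. \<bar>h j x\<bar> \<le> C"
    "AE s in lborel. AE x in M. G (s, x) = (\<Prod>j\<in>K. h j (T (p j s) x))"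
    "AE x in M. AE s in lborel. (\<Prod>j\<in>K. f j (T (p j s) x)) = G (s, x)"
proof -
  interpret prob_space M by fact
  interpret L: pair_sigma_finite "lborel :: (real ^ 'd) measure" M ..
  have fm [measurable]: "f j \<in> borel_measurable M" if "j \<in> K" for j
    using f[OF that] by (simp add: L_infinity_def)
  have "\<forall>j\<in>K. \<exists>c. AE x in M. \<bar>f j x\<bar> \<le> c"
    using f by (auto simp: L_infinity_def)
  from bchoice[OF this] obtain c where c: "\<And>j. j \<in> K \<Longrightarrow> AE x in M. \<bar>f j x\<bar> \<le> c j" by blast
  define C where "C = (\<Sum>j\<in>K. \<bar>c j\<bar>)"
  have C0: "0 \<le> C" by (simp add: C_def sum_nonneg)
  have cC: "c j \<le> C" if "j \<in> K" for j
    using member_le_sum[of j K "\<lambda>j. \<bar>c j\<bar>"] K that by (simp add: C_def)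
  define h where "h = (\<lambda>j x. max (- C) (min C (f j x)))"
  have hm: "h j \<in> borel_measurable M" if "j \<in> K" for j
    using fm[OF that] unfolding h_def by measurable
  have hC: "\<bar>h j x\<bar> \<le> C" for j x using C0 by (auto simp: h_def)
  have hf: "AE x in M. f j x = h j x" if "j \<in> K" for j
    using c[OF that] by eventually_elim (use cC[OF that] in \<open>auto simp: h_def\<close>)
  have hfT: "AE x in M. \<forall>j\<in>K. f j (T (t j) x) = h j (T (t j) x)" for t
  proof (rule AE_finite_allI[OF K])
    fix j assume "j \<in> K"
    then have "AE x in distr M M (T (t j)). f j x = h j x"
      unfolding flow_distr[OF flow] by (rule hf)
    then show "AE x in M. f j (T (t j) x) = h j (T (t j) x)"
      by (rule AE_distrD[OF flow_measurable[OF flow]])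
  qed
  define D where "D = (\<Prod>j\<in>K. C)"
  have hD: "\<bar>\<Prod>j\<in>K. h j (T (t j) x)\<bar> \<le> D" for t x
    unfolding D_def abs_prod using hC by (intro prod_mono) auto
  have D0: "0 \<le> D" using C0 by (simp add: D_def)
  obtain G' where G' [measurable]: "G' \<in> borel_measurable (lborel \<Otimes>\<^sub>M M)"
    and PG': "AE z in lborel \<Otimes>\<^sub>M M. (\<Prod>j\<in>K. f j (T (p j (fst z)) (snd z))) = G' z"
    by (rule flow_product_joint_measurable[where K=K and f=f and p=p, OF assms(1) flow p fm K])
  define G where "G = (\<lambda>z. max (- D) (min D (G' z)))"
  have G [measurable]: "G \<in> borel_measurable (lborel \<Otimes>\<^sub>M M)" unfolding G_def by measurable
  have GD: "\<bar>G z\<bar> \<le> D" for z using D0 by (auto simp: G_def)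
  have "AE s in lborel. AE x in M. (\<Prod>j\<in>K. f j (T (p j s) x)) = G' (s, x)"
    using L.AE_pair[OF PG'] by simp
  then have both: "AE s in lborel. AE x in M. G' (s, x) = G (s, x) \<and> G (s, x) = (\<Prod>j\<in>K. h j (T (p j s) x))"
  proof eventually_elim
    case (elim s)
    show ?case
      using elim hfT[of "\<lambda>j. p j s"]
    proof eventually_elim
      case (elim x)
      have "G' (s, x) = (\<Prod>j\<in>K. h j (T (p j s) x))"
        using elim by (metis (mono_tags, lifting) prod.cong)
      then show ?case
        using hD[of "\<lambda>j. p j s" x] by (simp add: G_def abs_le_iff)
    qed
  qed
  have 1: "AE s in lborel. AE x in M. G (s, x) = (\<Prod>j\<in>K. h j (T (p j s) x))"
    using both by eventually_elim (auto elim: eventually_mono)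
  have "AE s in lborel. AE x in M. G' (s, x) = G (s, x)"
    using both by eventually_elim (auto elim: eventually_mono)
  moreover have "{z \<in> space (lborel \<Otimes>\<^sub>M M). G' z = G z} \<in> sets (lborel \<Otimes>\<^sub>M M)"
    by measurable
  ultimately have "AE z in lborel \<Otimes>\<^sub>M M. G' z = G z"
    by (intro L.AE_pair_measure)
  with PG' have "AE z in lborel \<Otimes>\<^sub>M M. (\<Prod>j\<in>K. f j (T (p j (fst z)) (snd z))) = G z"
    by eventually_elim simp
  \<comment> \<open>Exchanging the two almost-everywhere quantifiers requires a measurable set, so
    the exceptional set is first enclosed in a measurable null set.\<close>
  then obtain N where N: "N \<in> null_sets (lborel \<Otimes>\<^sub>M M)"
    and N_sub: "{z \<in> space (lborel \<Otimes>\<^sub>M M). (\<Prod>j\<in>K. f j (T (p j (fst z)) (snd z))) \<noteq> G z} \<subseteq> N"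
    unfolding eventually_ae_filter by auto
  have [measurable]: "N \<in> sets (lborel \<Otimes>\<^sub>M M)" using N by auto
  have "AE s in lborel. AE x in M. (s, x) \<notin> N"
    using L.AE_pair[OF AE_not_in[OF N]] .
  then have "AE x in M. AE s in lborel. (s, x) \<notin> N"
    by (subst L.AE_commute[symmetric]) measurable
  then have 2: "AE x in M. AE s in lborel. (\<Prod>j\<in>K. f j (T (p j s) x)) = G (s, x)"
    using AE_space
  proof eventually_elim
    case (elim x)
    from elim(1) show ?case
    proof eventually_elim
      case (elim s)
      then show ?case
        using subsetD[OF N_sub, of "(s, x)"] \<open>x \<in> space M\<close> by (auto simp: space_pair_measure)
    qed
  qed
  show ?thesis
    by (rule that[OF G GD hm hC 1 2])
qed

lemma AE_cube_measure_translates: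
  assumes "AE s in lborel. E s"
  shows "AE v in cube_measure. \<forall>n :: nat ^ 'd. E (v + of_nat_vec n)"
proof -
  have "AE v in lborel. E (v + of_nat_vec n)" for n :: "nat ^ 'd"
  proof -
    have "AE s in distr lborel borel ((+) (of_nat_vec n)). E s"
      unfolding lborel_distr_plus by (rule assms)
    then have "AE v in lborel. E (of_nat_vec n + v)"
      by (rule AE_distrD[rotated]) simp
    then show ?thesis by (simp add: add.commute)
  qed
  then have "AE v in lborel. \<forall>n :: nat ^ 'd. E (v + of_nat_vec n)"
    by (simp add: AE_all_countable)
  then show ?thesis
    unfolding cube_measure_def by (subst AE_density) (auto elim: eventually_mono)
qed

text \<open>The two sequences of boxes are interlaced to one, so that the Cauchy property along a
  single Folner sequence compares them. The lower bound j + 1 makes all sides grow and keeps their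
  integer parts positive.\<close>

lemma kernel_averages_asymptotically_equal:
  fixes p :: "nat \<Rightarrow> real ^ 'd \<Rightarrow> real" and G :: "(real ^ 'd) \<times> 'a \<Rightarrow> real"
    and R R' :: "nat \<Rightarrow> real ^ 'd"
  assumes prob: "prob_space M" and flow: "measure_preserving_flow M T" and K: "finite K"
    and p: "\<And>j. j \<in> K \<Longrightarrow> real_polynomial_function (p j)"
    and G [measurable]: "G \<in> borel_measurable (lborel \<Otimes>\<^sub>M M)" and D: "\<And>z. \<bar>G z\<bar> \<le> D"
    and h: "\<And>j. j \<in> K \<Longrightarrow> h j \<in> borel_measurable M" "\<And>j x. \<bar>h j x\<bar> \<le> C"
    and Gh: "AE s in lborel. AE x in M. G (s, x) = (\<Prod>j\<in>K. h j (T (p j s) x))"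
    and R: "\<And>j i. real j + 1 \<le> R j $ i" "\<And>j i. real j + 1 \<le> R' j $ i"
  shows "(\<lambda>j. \<integral>x. (kernel_average G (R j) x - kernel_average G (R' j) x)\<^sup>2 \<partial>M) \<longlonglongrightarrow> 0"
proof -
  define S where "S = (\<lambda>j. if even j then R (j div 2) else R' (j div 2))"
  have S_ge: "real j / 2 \<le> S j $ i" and S1: "1 \<le> S j $ i" for i j
  proof -
    have "real (j div 2) + 1 \<le> S j $ i" using R by (simp add: S_def)
    moreover have "real j / 2 \<le> real (j div 2) + 1"
    proof -
      have "j \<le> 2 * (j div 2) + 1" by presburger
      then show ?thesis by linarith
    qed
    ultimately show "real j / 2 \<le> S j $ i" "1 \<le> S j $ i" by linarith+
  qed
  have S_top: "filterlim (\<lambda>j. S j $ i) at_top sequentially" for i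
  proof (rule filterlim_at_top_mono[OF _ always_eventually])
    show "filterlim (\<lambda>j. real j / 2) at_top sequentially"
      using filterlim_tendsto_pos_mult_at_top[OF tendsto_const _ filterlim_real_sequentially, of "1/2"] by simp
  qed (use S_ge in auto)
  define N where "N = (\<lambda>j. floor_vec (S j))"
  define B where "B = (\<lambda>j. nat_box (N j))"
  have N_pos: "0 < N j $ i" for j i
    using S1[of j i] by (simp add: N_def floor_vec_def)
  have N_top: "filterlim (\<lambda>j. N j $ i) at_top sequentially" for i
    unfolding N_def by (rule floor_vec_at_top[OF S_top])
  interpret P: prob_space M by (rule prob)
  interpret U: prob_space "cube_measure :: (real ^ 'd) measure" by (rule prob_space_cube_measure)
  interpret UM: pair_prob_space "cube_measure :: (real ^ 'd) measure" M ..
  interpret F: folner_flow M T B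
  proof
    show "T t \<in> measurable M M" "distr M M (T t) = M" for t
      by (rule flow_measurable[OF flow], rule flow_distr[OF flow])
    show "T 0 x = x" if "x \<in> space M" for x
      using flow that by (simp add: measure_preserving_flow_def)
    show "T s (T t x) = T (s + t) x" if "x \<in> space M" for s t x
      using flow that by (simp add: measure_preserving_flow_def)
    show "finite (B j)" for j by (simp add: B_def finite_nat_box)
    show "B j \<noteq> {}" for j unfolding B_def by (rule nat_box_nonempty[OF N_pos])
    show "(\<lambda>j. real (card ((B j - (+) l ` B j) \<union> ((+) l ` B j - B j))) / real (card (B j))) \<longlonglongrightarrow> 0" for l
      unfolding B_def by (rule nat_box_folner[OF N_pos N_top])
  qed
  define A where "A = (\<lambda>j v x. avg (B j) (\<lambda>n. G (v + of_nat_vec n, x)))"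
  have A [measurable]: "(\<lambda>(v, x). A j v x) \<in> borel_measurable (cube_measure \<Otimes>\<^sub>M M)" for j
    unfolding A_def avg_def by measurable
  have AD: "\<bar>A j v x\<bar> \<le> D" for j v x
    unfolding A_def by (intro avg_abs_le F.B_finite F.B_nonempty D)
  define d where "d = (\<lambda>j v x. A (2 * j) v x - A (2 * j + 1) v x)"
  have d [measurable]: "(\<lambda>(v, x). d j v x) \<in> borel_measurable (cube_measure \<Otimes>\<^sub>M M)" for j
    unfolding d_def using A[of "2 * j"] A[of "2 * j + 1"] by (simp add: split_beta)
  have dD: "\<bar>d j v x\<bar> \<le> 2 * D" for j v x
    using AD[of "2 * j" v x] AD[of "2 * j + 1" v x] unfolding d_def by linarith
  have d2: "(d j v x)\<^sup>2 \<le> (2 * D)\<^sup>2" for j v x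
    using power_mono[OF dD[of j v x], where n=2] by simp
  define er where "er = (\<lambda>j. 2 * D * (1 - (\<Prod>i\<in>UNIV. real (floor_vec (S j) $ i) / S j $ i)))"
  have er: "er \<longlonglongrightarrow> 0"
    using tendsto_mult_left[OF tendsto_diff[OF tendsto_const floor_ratio_tendsto[of S, OF S1 S_top]], of "2 * D" 1]
    by (simp add: er_def)
  have approx: "\<bar>kernel_average G (S j) x - (\<integral>v. A j v x \<partial>cube_measure)\<bar> \<le> er j" if x: "x \<in> space M" for j x
  proof -
    have Gx [measurable]: "(\<lambda>s. G (s, x)) \<in> borel_measurable borel"
      using x by measurable
    have "integrable cube_measure (\<lambda>v. G (v + of_nat_vec n, x))" for n
      by (rule U.integrable_const_bound[of _ D]) (use D in auto)
    then have "(\<integral>v. A j v x \<partial>cube_measure) = avg (B j) (\<lambda>n. \<integral>v. G (v + of_nat_vec n, x) \<partial>cube_measure)"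
      unfolding A_def avg_def by (simp add: Bochner_Integration.integral_sum)
    then show ?thesis
      using box_average_approx[OF Gx D S1, of j]
      by (simp add: kernel_average_def er_def B_def N_def)
  qed
  define a where "a = (\<lambda>j v. \<integral>x. (d j v x)\<^sup>2 \<partial>M)"
  \<comment> \<open>There are countably many lattice points, so for almost every v the kernel is the
    product of the \<open>h j\<close> at all v + n simultaneously. The exponents are polynomials in
    n, and the discrete theorem applies to this v.\<close>
  have "AE v in cube_measure. \<forall>n. AE x in M. G (v + of_nat_vec n, x) = (\<Prod>j\<in>K. h j (T (p j (v + of_nat_vec n)) x))"
    by (rule AE_cube_measure_translates[OF Gh])
  then have a_lim: "AE v in cube_measure. (\<lambda>j. a j v) \<longlonglongrightarrow> 0"
  proof eventually_elim
    case (elim v)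
    then have "AE x in M. \<forall>n. G (v + of_nat_vec n, x) = (\<Prod>j\<in>K. h j (T (p j (v + of_nat_vec n)) x))"
      by (simp add: AE_all_countable)
    then have ae: "AE x in M. \<forall>j. A j v x = avg (B j) (\<lambda>n. \<Prod>k\<in>K. h k (T (p k (v + of_nat_vec n)) x))"
      by eventually_elim (simp add: A_def)
    have "\<forall>k\<in>K. \<exists>r. (\<lambda>n :: nat ^ 'd. p k (v + of_nat_vec n)) \<in> polys r"
      using real_polynomial_polys p by blast
    from bchoice[OF this] obtain r where r: "\<And>k. k \<in> K \<Longrightarrow> (\<lambda>n :: nat ^ 'd. p k (v + of_nat_vec n)) \<in> polys (r k)"
      by blast
    have pr: "(\<lambda>n :: nat ^ 'd. p k (v + of_nat_vec n)) \<in> polys (sum r K)" if "k \<in> K" for k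
      using r[OF that] by (rule polys_mono) (rule member_le_sum, use that K in auto)
    show "(\<lambda>j. a j v) \<longlonglongrightarrow> 0"
    proof (rule LIMSEQ_I)
      fix \<epsilon> :: real assume \<epsilon>: "0 < \<epsilon>"
      have "\<exists>J. \<forall>i\<ge>J. \<forall>j\<ge>J.
          (\<integral>x. (avg (B i) (\<lambda>n. \<Prod>k\<in>K. h k (T (p k (v + of_nat_vec n)) x)) -
            avg (B j) (\<lambda>n. \<Prod>k\<in>K. h k (T (p k (v + of_nat_vec n)) x)))\<^sup>2 \<partial>M) \<le> \<epsilon> / 2"
        by (rule F.polynomial_averages_cauchy[OF K pr h(1) h(2)]) (use \<epsilon> in auto)
      then obtain J where J: "\<And>i j. i \<ge> J \<Longrightarrow> j \<ge> J \<Longrightarrow>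
          (\<integral>x. (avg (B i) (\<lambda>n. \<Prod>k\<in>K. h k (T (p k (v + of_nat_vec n)) x)) -
            avg (B j) (\<lambda>n. \<Prod>k\<in>K. h k (T (p k (v + of_nat_vec n)) x)))\<^sup>2 \<partial>M) \<le> \<epsilon> / 2"
        by blast
      show "\<exists>J. \<forall>j\<ge>J. norm (a j v - 0) < \<epsilon>"
      proof (intro exI allI impI)
        fix j assume j: "j \<ge> J"
        have "a j v = (\<integral>x. (avg (B (2 * j)) (\<lambda>n. \<Prod>k\<in>K. h k (T (p k (v + of_nat_vec n)) x)) -
            avg (B (2 * j + 1)) (\<lambda>n. \<Prod>k\<in>K. h k (T (p k (v + of_nat_vec n)) x)))\<^sup>2 \<partial>M)"
          unfolding a_def
        proof (rule integral_cong_AE)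
          have [measurable]: "(\<lambda>x. h k (T t x)) \<in> borel_measurable M" if "k \<in> K" for k t
            by (rule measurable_compose[OF F.T_measurable h(1)[OF that]])
          show "(\<lambda>x. (avg (B (2 * j)) (\<lambda>n. \<Prod>k\<in>K. h k (T (p k (v + of_nat_vec n)) x)) -
            avg (B (2 * j + 1)) (\<lambda>n. \<Prod>k\<in>K. h k (T (p k (v + of_nat_vec n)) x)))\<^sup>2) \<in> borel_measurable M"
            unfolding avg_def by measurable
          show "(\<lambda>x. (d j v x)\<^sup>2) \<in> borel_measurable M"
            unfolding d_def A_def avg_def by measurable
        qed (use ae in \<open>eventually_elim, simp add: d_def\<close>)
        also have "\<dots> \<le> \<epsilon> / 2" using j by (intro J) auto
        finally have "a j v \<le> \<epsilon> / 2" .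
        moreover have "0 \<le> a j v" unfolding a_def by (rule integral_nonneg_AE) simp
        ultimately show "norm (a j v - 0) < \<epsilon>" using \<epsilon> by simp
      qed
    qed
  qed
  have am [measurable]: "a j \<in> borel_measurable cube_measure" for j
  proof -
    have "(\<lambda>(v, x). (d j v x)\<^sup>2) \<in> borel_measurable (cube_measure \<Otimes>\<^sub>M M)"
      using d[of j] by (simp add: split_beta)
    from P.borel_measurable_lebesgue_integral[OF this] show ?thesis by (simp add: a_def[abs_def])
  qed
  have "(\<lambda>j. \<integral>v. a j v \<partial>cube_measure) \<longlonglongrightarrow> (\<integral>v. 0 \<partial>(cube_measure :: (real ^ 'd) measure))"
  proof (rule integral_dominated_convergence[where w="\<lambda>_. (2 * D)\<^sup>2"])
    show "AE v in cube_measure. norm (a j v) \<le> (2 * D)\<^sup>2" for j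
    proof (rule AE_I2)
      fix v :: "real ^ 'd"
      have "(\<lambda>x. (d j v x)\<^sup>2) \<in> borel_measurable M"
        unfolding d_def A_def avg_def by measurable
      then show "norm (a j v) \<le> (2 * D)\<^sup>2"
        unfolding a_def real_norm_def using d2 by (intro F.abs_integral_le) auto
    qed
  qed (use a_lim in simp_all)
  then have a_int: "(\<lambda>j. \<integral>v. a j v \<partial>cube_measure) \<longlonglongrightarrow> 0" by simp
  \<comment> \<open>The difference consists of two boundary errors and the mean over v of a
    difference of integer averages. Squaring three terms gives the factors 3; convexity and Fubini
    bring in \<open>a j\<close>.\<close>
  have bound: "(\<integral>x. (kernel_average G (R j) x - kernel_average G (R' j) x)\<^sup>2 \<partial>M) \<le>
      3 * ((er (2 * j))\<^sup>2 + (er (2 * j + 1))\<^sup>2) + 3 * (\<integral>v. a j v \<partial>cube_measure)" for j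
  proof -
    have int: "integrable (cube_measure \<Otimes>\<^sub>M M) (\<lambda>(v, x). (d j v x)\<^sup>2)"
    proof (rule UM.P.integrable_const_bound[of _ "(2 * D)\<^sup>2"])
      show "(\<lambda>(v, x). (d j v x)\<^sup>2) \<in> borel_measurable (cube_measure \<Otimes>\<^sub>M M)"
        using d[of j] by (simp add: split_beta)
    qed (use d2 in auto)
    note fub = UM.Fubini_integral[OF int]
    note int_x = UM.integrable_snd[OF int]
    have km: "kernel_average G Z \<in> borel_measurable M" for Z
      by (rule kernel_average_measurable[OF G])
    have "(\<integral>x. (kernel_average G (R j) x - kernel_average G (R' j) x)\<^sup>2 \<partial>M) \<le>
        (\<integral>x. 3 * ((er (2 * j))\<^sup>2 + (er (2 * j + 1))\<^sup>2) + 3 * (\<integral>v. (d j v x)\<^sup>2 \<partial>cube_measure) \<partial>M)"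
    proof (rule integral_mono)
      show "integrable M (\<lambda>x. 3 * ((er (2 * j))\<^sup>2 + (er (2 * j + 1))\<^sup>2) + 3 * (\<integral>v. (d j v x)\<^sup>2 \<partial>cube_measure))"
        using int_x by simp
      have kb: "\<bar>kernel_average G (S i) x\<bar> \<le> D" if x: "x \<in> space M" for i x
        by (rule kernel_average_bound[OF _ D S1]) (use x in measurable)
      have SR: "S (2 * j) = R j" "S (2 * j + 1) = R' j" by (simp_all add: S_def)
      show "integrable M (\<lambda>x. (kernel_average G (R j) x - kernel_average G (R' j) x)\<^sup>2)"
      proof (rule P.integrable_const_bound[of _ "(2 * D)\<^sup>2"])
        show "AE x in M. norm ((kernel_average G (R j) x - kernel_average G (R' j) x)\<^sup>2) \<le> (2 * D)\<^sup>2"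
        proof (rule AE_I2)
          fix x assume x: "x \<in> space M"
          have "\<bar>kernel_average G (R j) x - kernel_average G (R' j) x\<bar> \<le> 2 * D"
            using kb[OF x, of "2 * j"] kb[OF x, of "2 * j + 1"] unfolding SR by linarith
          from power_mono[OF this, where n=2]
          show "norm ((kernel_average G (R j) x - kernel_average G (R' j) x)\<^sup>2) \<le> (2 * D)\<^sup>2" by simp
        qed
      qed (use km in measurable)
      fix x assume x: "x \<in> space M"
      have dm: "(\<lambda>v. A i v x) \<in> borel_measurable cube_measure" for i
        unfolding A_def avg_def using x by measurable
      have Ai: "integrable cube_measure (\<lambda>v. A i v x)" for i
        using dm AD by (intro U.integrable_const_bound[of _ D]) auto
      define y where "y = (\<integral>v. d j v x \<partial>cube_measure)"
      have y: "y = (\<integral>v. A (2 * j) v x \<partial>cube_measure) - (\<integral>v. A (2 * j + 1) v x \<partial>cube_measure)"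
        unfolding y_def d_def using Ai by (intro Bochner_Integration.integral_diff)
      have y2: "y\<^sup>2 \<le> (\<integral>v. (d j v x)\<^sup>2 \<partial>cube_measure)"
        unfolding y_def using dm dD
        by (intro U.power2_integral_le[of _ "2 * D"]) (auto simp: d_def[abs_def])
      define b where "b = kernel_average G (R j) x - (\<integral>v. A (2 * j) v x \<partial>cube_measure)"
      define c where "c = kernel_average G (R' j) x - (\<integral>v. A (2 * j + 1) v x \<partial>cube_measure)"
      have b: "b\<^sup>2 \<le> (er (2 * j))\<^sup>2"
        using power_mono[OF approx[OF x, of "2 * j"], where n=2] by (simp add: SR b_def)
      have c: "c\<^sup>2 \<le> (er (2 * j + 1))\<^sup>2"
        using power_mono[OF approx[OF x, of "2 * j + 1"], where n=2] unfolding SR c_def by simp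
      have "kernel_average G (R j) x - kernel_average G (R' j) x = b - c + y"
        by (simp add: b_def c_def y)
      \<comment> \<open>The right side minus the left is the sum of the squares of b + c, b - y and
        c + y.\<close>
      moreover have "(b - c + y)\<^sup>2 \<le> 3 * (b\<^sup>2 + c\<^sup>2) + 3 * y\<^sup>2"
        using zero_le_power2[of "b + c"] zero_le_power2[of "b - y"] zero_le_power2[of "c + y"]
        by (simp add: power2_eq_square algebra_simps)
      ultimately show "(kernel_average G (R j) x - kernel_average G (R' j) x)\<^sup>2 \<le>
          3 * ((er (2 * j))\<^sup>2 + (er (2 * j + 1))\<^sup>2) + 3 * (\<integral>v. (d j v x)\<^sup>2 \<partial>cube_measure)"
        using b c y2 by simp
    qed
    also have "\<dots> = 3 * ((er (2 * j))\<^sup>2 + (er (2 * j + 1))\<^sup>2) + 3 * (\<integral>x. (\<integral>v. (d j v x)\<^sup>2 \<partial>cube_measure) \<partial>M)"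
      using int_x by (simp add: P.prob_space)
    also have "(\<integral>x. (\<integral>v. (d j v x)\<^sup>2 \<partial>cube_measure) \<partial>M) = (\<integral>v. a j v \<partial>cube_measure)"
      unfolding a_def by (rule fub)
    finally show ?thesis .
  qed
  have e1: "(\<lambda>j. er (2 * j)) \<longlonglongrightarrow> 0" "(\<lambda>j. er (2 * j + 1)) \<longlonglongrightarrow> 0"
    using LIMSEQ_subseq_LIMSEQ[OF er, of "\<lambda>j. 2 * j"] LIMSEQ_subseq_LIMSEQ[OF er, of "\<lambda>j. 2 * j + 1"]
    by (simp_all add: strict_mono_def comp_def)
  have lim: "(\<lambda>j. 3 * ((er (2 * j))\<^sup>2 + (er (2 * j + 1))\<^sup>2) + 3 * (\<integral>v. a j v \<partial>cube_measure)) \<longlonglongrightarrow>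
      3 * (0\<^sup>2 + 0\<^sup>2) + 3 * 0"
    by (intro tendsto_add tendsto_mult_left tendsto_power e1 a_int)
  show ?thesis
  proof (rule tendsto_sandwich[OF always_eventually always_eventually tendsto_const])
    show "\<forall>j. 0 \<le> (\<integral>x. (kernel_average G (R j) x - kernel_average G (R' j) x)\<^sup>2 \<partial>M)"
      by (intro allI integral_nonneg_AE) simp
    show "\<forall>j. (\<integral>x. (kernel_average G (R j) x - kernel_average G (R' j) x)\<^sup>2 \<partial>M) \<le>
        3 * ((er (2 * j))\<^sup>2 + (er (2 * j + 1))\<^sup>2) + 3 * (\<integral>v. a j v \<partial>cube_measure)"
      using bound by (rule allI)
  qed (use lim in simp)
qed

theorem theorem1p1:
  fixes M :: "'a measure"
    and T :: "real \<Rightarrow> 'a \<Rightarrow> 'a"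
    and k :: nat
    and p :: "nat \<Rightarrow> real ^ 'd \<Rightarrow> real"
    and f :: "nat \<Rightarrow> 'a \<Rightarrow> real"
  assumes "lebesgue_space M"
    and "measure_preserving_flow M T"
    and "\<And>j. j \<in> {1..k} \<Longrightarrow> real_polynomial_function (p j)"
    and "\<And>j. j \<in> {1..k} \<Longrightarrow> f j \<in> L_infinity M"
  shows "converges_in_L_two M (polynomial_average T k p f) at_top"
proof -
  have prob: "prob_space M" and complete: "complete_measure M"
    using assms(1) by (auto simp: lebesgue_space_def)
  interpret prob_space M by (rule prob)
  interpret complete_measure M by (rule complete)
  obtain G h C D where G [measurable]: "G \<in> borel_measurable (lborel \<Otimes>\<^sub>M M)" and D: "\<And>z. \<bar>G z\<bar> \<le> D"
    and h: "\<And>j. j \<in> {1..k} \<Longrightarrow> h j \<in> borel_measurable M" "\<And>j x. \<bar>h j x\<bar> \<le> C"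
    and Gh: "AE s in lborel. AE x in M. G (s, x) = (\<Prod>j\<in>{1..k}. h j (T (p j s) x))"
    and fG: "AE x in M. AE s in lborel. (\<Prod>j\<in>{1..k}. f j (T (p j s) x)) = G (s, x)"
    by (rule bounded_kernel_exists[where K="{1..k}" and p=p and f=f, OF prob assms(2) _ assms(3,4)]) auto
  define u where "u = kernel_average G"
  have um [measurable]: "u R \<in> borel_measurable M" for R
    unfolding u_def by (rule kernel_average_measurable[OF G])
  have uD: "\<bar>u R x\<bar> \<le> D" if "x \<in> space M" "\<And>i. 1 \<le> R $ i" for R x
    unfolding u_def by (rule kernel_average_bound[OF _ D that(2)]) (use that(1) in measurable)
  have avg_eq: "AE x in M. polynomial_average T k p f R x = u R x" for R
    using fG AE_space unfolding u_def
    by eventually_elim (rule polynomial_average_eq_kernel_average[OF G])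
  have avg_m [measurable]: "polynomial_average T k p f R \<in> borel_measurable M" for R
    by (rule borel_measurable_AE_eq[OF um avg_eq])
  \<comment> \<open>A failure would give, for every r, two boxes with sides at least r + 1 and
    squared distance above \<epsilon>, against asymptotic equality along these sequences. The sides
    are otherwise unrelated, so they may grow independently.\<close>
  have cauchy: "\<exists>r::nat. \<forall>R R'. (\<forall>i. real r + 1 \<le> R $ i) \<longrightarrow> (\<forall>i. real r + 1 \<le> R' $ i) \<longrightarrow>
      (\<integral>x. (u R x - u R' x)\<^sup>2 \<partial>M) \<le> \<epsilon>" if \<epsilon>: "0 < \<epsilon>" for \<epsilon>
  proof (rule ccontr)
    assume "\<not> ?thesis"
    then have "\<forall>r::nat. \<exists>RR. (\<forall>i. real r + 1 \<le> fst RR $ i) \<and> (\<forall>i. real r + 1 \<le> snd RR $ i) \<and>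
        \<epsilon> < (\<integral>x. (u (fst RR) x - u (snd RR) x)\<^sup>2 \<partial>M)"
      by (simp add: not_le)
    from choice[OF this] obtain RR where RR: "\<And>r i. real r + 1 \<le> fst (RR r) $ i"
        "\<And>r i. real r + 1 \<le> snd (RR r) $ i"
        "\<And>r. \<epsilon> < (\<integral>x. (u (fst (RR r)) x - u (snd (RR r)) x)\<^sup>2 \<partial>M)"
      by blast
    have "(\<lambda>r. \<integral>x. (u (fst (RR r)) x - u (snd (RR r)) x)\<^sup>2 \<partial>M) \<longlonglongrightarrow> 0"
      unfolding u_def
      by (rule kernel_averages_asymptotically_equal[OF prob assms(2) _ assms(3) G D h Gh RR(1,2)]) simp
    then have "\<epsilon> \<le> 0"
      by (rule LIMSEQ_le_const) (use RR(3) in \<open>auto intro: less_imp_le\<close>)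
    with \<epsilon> show False by simp
  qed
  \<comment> \<open>Any sequence with all sides tending to infinity identifies the limit; side n + 1
    also meets the bound 1 in \<open>uD\<close>.\<close>
  define R0 where "R0 = (\<lambda>n. \<chi> i. real n + 1 :: real ^ 'd)"
  obtain F where Fm [measurable]: "F \<in> borel_measurable M" and FD: "\<And>x. \<bar>F x\<bar> \<le> \<bar>D\<bar>"
    and F: "(\<lambda>n. \<integral>x. (u (R0 n) x - F x)\<^sup>2 \<partial>M) \<longlonglongrightarrow> 0"
  proof (rule L2_complete_bounded[of "\<lambda>n. u (R0 n)" D])
    show "\<bar>u (R0 n) x\<bar> \<le> D" if "x \<in> space M" for n x
      using that by (intro uD) (auto simp: R0_def)
    show "\<exists>J. \<forall>i\<ge>J. \<forall>j\<ge>J. (\<integral>x. (u (R0 i) x - u (R0 j) x)\<^sup>2 \<partial>M) \<le> \<epsilon>" if \<epsilon>: "0 < \<epsilon>" for \<epsilon>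
    proof -
      obtain r :: nat where "\<And>R R'. (\<And>i. real r + 1 \<le> R $ i) \<Longrightarrow> (\<And>i. real r + 1 \<le> R' $ i) \<Longrightarrow>
          (\<integral>x. (u R x - u R' x)\<^sup>2 \<partial>M) \<le> \<epsilon>"
        using cauchy[OF \<epsilon>] by blast
      then show ?thesis
        by (intro exI[of _ r]) (simp add: R0_def)
    qed
  qed auto
  have int: "integrable M (\<lambda>x. (g x)\<^sup>2)" if [measurable]: "g \<in> borel_measurable M"
    and g: "\<And>x. x \<in> space M \<Longrightarrow> \<bar>g x\<bar> \<le> c" for g :: "'a \<Rightarrow> real" and c
    using power_mono[OF g, where n=2] by (intro integrable_const_bound[of _ "c\<^sup>2"]) auto
  have uF: "\<bar>u R x - F x\<bar> \<le> 2 * \<bar>D\<bar>" if "x \<in> space M" "\<And>i. 1 \<le> R $ i" for R x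
    using uD[OF that] FD[of x] by linarith
  have uu: "\<bar>u R x - u R' x\<bar> \<le> 2 * \<bar>D\<bar>" if "x \<in> space M" "\<And>i. 1 \<le> R $ i" "\<And>i. 1 \<le> R' $ i" for R R' x
    using uD[OF that(1,2)] uD[OF that(1,3)] by linarith
  have norm_eq: "L_two_norm M (\<lambda>x. polynomial_average T k p f R x - F x) = sqrt (\<integral>x. (u R x - F x)\<^sup>2 \<partial>M)" for R
    unfolding L_two_norm_def
    by (intro arg_cong[where f=sqrt] integral_cong_AE) (use avg_eq[of R] in \<open>auto elim: eventually_mono\<close>)
  show ?thesis
    unfolding converges_in_L_two_def
  proof (intro conjI bexI[of _ F])
    show "\<forall>\<^sub>F R in at_top. polynomial_average T k p f R \<in> L_two M"
      unfolding eventually_at_top_vec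
    proof (intro exI[of _ 1] allI impI)
      fix R :: "real ^ 'd" assume R: "\<forall>i. 1 \<le> R $ i"
      have "integrable M (\<lambda>x. (u R x)\<^sup>2)"
        using uD R by (intro int[of _ D]) auto
      then have "integrable M (\<lambda>x. (polynomial_average T k p f R x)\<^sup>2)"
        by (rule integrable_cong_AE_imp) (use avg_eq[of R] in \<open>auto elim: eventually_mono\<close>)
      then show "polynomial_average T k p f R \<in> L_two M"
        by (simp add: L_two_def avg_m)
    qed
    show "F \<in> L_two M"
      using int[OF Fm FD] by (simp add: L_two_def)
    show "((\<lambda>R. L_two_norm M (\<lambda>x. polynomial_average T k p f R x - F x)) \<longlongrightarrow> 0) at_top"
      unfolding norm_eq
    proof (rule tendstoI)
      fix e :: real assume e: "0 < e"
      \<comment> \<open>Twice the two squared distances is below e^2 / 2, hence below e^2 before the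
        root is taken.\<close>
      then have e8: "0 < e\<^sup>2 / 8" by simp
      obtain r :: nat where r: "\<And>R R'. (\<And>i. real r + 1 \<le> R $ i) \<Longrightarrow> (\<And>i. real r + 1 \<le> R' $ i) \<Longrightarrow>
          (\<integral>x. (u R x - u R' x)\<^sup>2 \<partial>M) \<le> e\<^sup>2 / 8"
        using cauchy[OF e8] by blast
      obtain n where n: "\<And>m. m \<ge> n \<Longrightarrow> (\<integral>x. (u (R0 m) x - F x)\<^sup>2 \<partial>M) < e\<^sup>2 / 8"
        using LIMSEQ_D[OF F e8] by auto
      define m where "m = max n r"
      have R0: "real r + 1 \<le> R0 m $ i" for i by (simp add: R0_def m_def)
      have R01: "1 \<le> R0 m $ i" for i by (simp add: R0_def)
      show "\<forall>\<^sub>F R in at_top. dist (sqrt (\<integral>x. (u R x - F x)\<^sup>2 \<partial>M)) 0 < e"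
        unfolding eventually_at_top_vec
      proof (intro exI[of _ "real r + 1"] allI impI)
        fix R :: "real ^ 'd" assume R: "\<forall>i. real r + 1 \<le> R $ i"
        have R1: "1 \<le> R $ i" for i using R[rule_format, of i] by linarith
        have i1: "integrable M (\<lambda>x. (u R x - u (R0 m) x)\<^sup>2)"
          using uu[OF _ R1 R01] by (intro int[of _ "2 * \<bar>D\<bar>"]) auto
        have i2: "integrable M (\<lambda>x. (u (R0 m) x - F x)\<^sup>2)"
          using uF[OF _ R01] by (intro int[of _ "2 * \<bar>D\<bar>"]) auto
        have i3: "integrable M (\<lambda>x. (u R x - F x)\<^sup>2)"
          using uF[OF _ R1] by (intro int[of _ "2 * \<bar>D\<bar>"]) auto
        have "(\<integral>x. (u R x - F x)\<^sup>2 \<partial>M) \<le> (\<integral>x. 2 * (u R x - u (R0 m) x)\<^sup>2 + 2 * (u (R0 m) x - F x)\<^sup>2 \<partial>M)"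
        proof (rule integral_mono[OF i3])
          show "integrable M (\<lambda>x. 2 * (u R x - u (R0 m) x)\<^sup>2 + 2 * (u (R0 m) x - F x)\<^sup>2)"
            using i1 i2 by simp
          show "(u R x - F x)\<^sup>2 \<le> 2 * (u R x - u (R0 m) x)\<^sup>2 + 2 * (u (R0 m) x - F x)\<^sup>2" for x
            using zero_le_power2[of "(u R x - u (R0 m) x) - (u (R0 m) x - F x)"]
            by (simp add: power2_eq_square algebra_simps)
        qed
        also have "\<dots> = 2 * (\<integral>x. (u R x - u (R0 m) x)\<^sup>2 \<partial>M) + 2 * (\<integral>x. (u (R0 m) x - F x)\<^sup>2 \<partial>M)"
          using i1 i2 by simp
        also have "\<dots> < e\<^sup>2"
        proof -
          have "(\<integral>x. (u R x - u (R0 m) x)\<^sup>2 \<partial>M) \<le> e\<^sup>2 / 8"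
            using R R0 by (intro r) auto
          moreover have "(\<integral>x. (u (R0 m) x - F x)\<^sup>2 \<partial>M) < e\<^sup>2 / 8"
            by (rule n) (simp add: m_def)
          ultimately show ?thesis using e8 by linarith
        qed
        finally have "sqrt (\<integral>x. (u R x - F x)\<^sup>2 \<partial>M) < sqrt (e\<^sup>2)"
          by (rule real_sqrt_less_mono)
        then show "dist (sqrt (\<integral>x. (u R x - F x)\<^sup>2 \<partial>M)) 0 < e"
          using e by (simp add: integral_nonneg_AE)
      qed
    qed
  qed
qed

end
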